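(* Let $p\ge 1$, let $F$ be a $d$-dimensional inner product distribution, and for each $n$ let $(A,X)\sim\mathrm{RDPG}(F,n)$. Let $\hat F_n=n^{-1}\sum_{i=1}^n\delta_{\hat X_i}$ be the empirical distribution of the rows $\hat X_1,\dots,\hat X_n$ of $\hat X=\mathrm{ASE}(A,d)$, and, given $A$, generate $\hat A^*\sim\mathrm{RDPG}(\hat F_n,n)$. If $(H,Z)\sim\mathrm{RDPG}(F,n)$ is an independent copy of $(A,X)$, then $$W_p^p(\hat A^*,H)=O\!\left((n^{-1/2}+n^{-1/d})\log n\right)\quad\text{as } n\to\infty.$$
   Context: A distribution $F$ on $\mathbb{R}^d$ is a $d$-dimensional inner product distribution if $0\le x^Ty\le 1$ for all $x,y\in\operatorname{supp}F$. Throughout, the second moment matrix $\Delta=\mathbb{E}X_1X_1^T$ ($X_1\sim F$) is assumed to have full rank $d$, and $d$ is fixed. $(A,X)\sim\mathrm{RDPG}(F,n)$ means: $X_1,\dots,X_n$ are i.i.d. from $F$, forming the rows of $X\in\mathbb{R}^{n\times d}$, and conditionally on $X$ the symmetric adjacency matrix $A\in\{0,1\}^{n\times n}$ (zero diagonal) has independent entries $A_{ij}\sim\mathrm{Bernoulli}(X_i^TX_j)$ for $1\le i<j\le n$. When $\mathrm{RDPG}(\hat F_n,n)$ is sampled, any inner product falling outside $[0,1]$ is clipped to $[0,1]$, i.e. the edge probability is $\max(0,\min(1,\hat X_i^{*T}\hat X_j^* ))$, with $\hat X_1^*,\dots,\hat X_n^*$ i.i.d. from $\hat F_n$ given $A$.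 Adjacency spectral embedding: $\mathrm{ASE}(A,d)=\hat U\hat S^{1/2}\in\mathbb{R}^{n\times d}$, where $\hat S$ is the diagonal matrix of the $d$ largest-magnitude eigenvalues of $A$ and the columns of $\hat U\in\mathbb{R}^{n\times d}$ are the corresponding unit (orthonormal) eigenvectors. Graph matching distance: for adjacency matrices $A_1,A_2\in\mathbb{R}^{n\times n}$, $$d_{\mathrm{GM}}(A_1,A_2)=\min_{P\in\Pi_n}\binom n2^{-1}\frac{\|A_1-PA_2P^T\|_1}{2},$$ where $\Pi_n$ is the set of $n\times n$ permutation matrices and $\|M\|_1=\sum_{i,j}|M_{ij}|$. Wasserstein distance between random graphs: for random adjacency matrices $A_1,A_2$ on $n$ vertices, with $\Gamma(A_1,A_2)$ the set of all couplings of (the distributions of) $A_1$ and $A_2$, $$W_p^p(A_1,A_2)=\inf_{\nu\in\Gamma(A_1,A_2)}\int d_{\mathrm{GM}}^p(A_1,A_2)\,d\nu.$$ Here the distribution of $\hat A^*$ is its marginal distribution under the two-stage sampling (first $(A,X)$, then $\hat A^*$ given $A$). *)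

theory Defs
  imports
    "HOL-Probability.Probability"
    "HOL-Library.Landau_Symbols"
    "Jordan_Normal_Form.Char_Poly"
begin

text \<open>
  Points of \<open>\<real>\<^sup>d\<close> have type \<^typ>\<open>real ^ 'd\<close>, so that \<open>d = CARD('d)\<close>. Matrices whose size
  depends on the number \<open>n\<close> of vertices have type \<^typ>\<open>real mat\<close>, with rows and columns
  indexed from 0. The \<open>n \<times> d\<close> matrices \<open>X\<close> and \<open>Xhat\<close> are represented by the family of
  their rows, \<^typ>\<open>nat \<Rightarrow> real ^ 'd\<close>, of which only the indices \<open>i < n\<close> matter.
\<close>


subsection \<open>Inner product distributions\<close>

definition msupp :: "'a::topological_space measure \<Rightarrow> 'a set" where
  "msupp M = {x. \<forall>U. open U \<and> x \<in> U \<longrightarrow> emeasure M U > 0}"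

definition inner_product_distribution :: "(real ^ 'd) measure \<Rightarrow> bool" where
  "inner_product_distribution F \<longleftrightarrow>
     prob_space F \<and> sets F = sets borel \<and>
     (\<forall>x\<in>msupp F. \<forall>y\<in>msupp F. 0 \<le> inner x y \<and> inner x y \<le> 1)"

definition second_moment :: "(real ^ 'd) measure \<Rightarrow> real ^ 'd ^ 'd" where
  "second_moment F = (\<chi> k l. \<integral>x. vec_nth x k * vec_nth x l \<partial>F)"


subsection \<open>Random dot product graphs\<close>

definition adj_mats :: "nat \<Rightarrow> real mat set" where
  "adj_mats n = {A \<in> carrier_mat n n.
     (\<forall>i<n. \<forall>j<n. A $$ (i, j) \<in> {0, 1} \<and> A $$ (i, j) = A $$ (j, i)) \<and>
     (\<forall>i<n. A $$ (i, i) = 0)}"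

abbreviation graph_space :: "nat \<Rightarrow> real mat measure" where
  "graph_space n \<equiv> count_space (adj_mats n)"

abbreviation latent_space :: "nat \<Rightarrow> (nat \<Rightarrow> real ^ 'd) measure" where
  "latent_space n \<equiv> Pi\<^sub>M {..<n} (\<lambda>_. borel)"

definition edge_pmf :: "nat \<Rightarrow> (nat \<Rightarrow> real ^ 'd) \<Rightarrow> (nat \<times> nat \<Rightarrow> bool) pmf" where
  "edge_pmf n X = Pi_pmf {(i, j). i < j \<and> j < n} False
     (\<lambda>(i, j). bernoulli_pmf (max 0 (min 1 (inner (X i) (X j)))))"

definition adj_of_edges :: "nat \<Rightarrow> (nat \<times> nat \<Rightarrow> bool) \<Rightarrow> real mat" where
  "adj_of_edges n e =
     mat n n (\<lambda>(i, j). if i \<noteq> j \<and> e (min i j, max i j) then 1 else 0)"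

text \<open>
  The joint law of \<open>(A, X)\<close>. One definition covers both uses of the model: for an inner
  product distribution clipping the edge probabilities is almost surely vacuous.
\<close>

definition rdpg :: "(real ^ 'd) measure \<Rightarrow> nat \<Rightarrow> (real mat \<times> (nat \<Rightarrow> real ^ 'd)) measure" where
  "rdpg F n = Pi\<^sub>M {..<n} (\<lambda>_. F) \<bind>
     (\<lambda>X. distr (measure_pmf (edge_pmf n X)) (graph_space n \<Otimes>\<^sub>M latent_space n)
             (\<lambda>e. (adj_of_edges n e, X)))"

definition rdpg_graph :: "(real ^ 'd) measure \<Rightarrow> nat \<Rightarrow> real mat measure" where
  "rdpg_graph F n = distr (rdpg F n) (graph_space n) fst"


subsection \<open>Adjacency spectral embedding and resampling\<close>

text \<open>
  \<open>is_ASE A Xhat\<close>: the rows of \<open>Xhat\<close> are those of \<open>U S\<^sup>1\<^sup>/\<^sup>2\<close> for some admissible choice of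
  \<open>U\<close> and \<open>S\<close>. Here \<open>u\<close> is an orthonormal basis of eigenvectors of \<open>A\<close>, listed (with
  multiplicity) by decreasing magnitude of the eigenvalues \<open>s\<close>, and \<open>U\<close>, \<open>S\<close> consist of its
  first \<open>d\<close> members; the bijection \<open>c\<close> only labels the columns by elements of \<open>'d\<close>. The
  embedding is determined only up to the choice of the eigenvectors, hence a relation. One of
  the \<open>d\<close> leading eigenvalues may be negative; its root is taken of the absolute value.
\<close>

definition is_ASE :: "real mat \<Rightarrow> (nat \<Rightarrow> real ^ 'd) \<Rightarrow> bool" where
  "is_ASE A Xhat \<longleftrightarrow> CARD('d) \<le> dim_row A \<and>
     (\<exists>u s c.
        (\<forall>k<dim_row A. eigenvector A (u k) (s k)) \<and>
        (\<forall>k<dim_row A. \<forall>l<dim_row A. scalar_prod (u k) (u l) = (if k = l then 1 else 0)) \<and>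
        (\<forall>k l. k \<le> l \<and> l < dim_row A \<longrightarrow> \<bar>s l\<bar> \<le> \<bar>s k\<bar>) \<and>
        bij_betw c (UNIV :: 'd set) {..<CARD('d)} \<and>
        (\<forall>i<dim_row A. Xhat i = (\<chi> m. vec_index (u (c m)) i * sqrt \<bar>s (c m)\<bar>)))"

definition empirical :: "nat \<Rightarrow> (nat \<Rightarrow> real ^ 'd) \<Rightarrow> (real ^ 'd) measure" where
  "empirical n x = distr (measure_pmf (pmf_of_set {..<n})) borel x"

text \<open>
  The joint law of \<open>((A, X), Astar)\<close> under two-stage sampling: first \<open>(A, X)\<close> from
  \<open>RDPG(F, n)\<close>, then, given these, \<open>Astar\<close> from \<open>RDPG(Fhat, n)\<close>, where \<open>Fhat\<close> is the
  empirical distribution of the rows of the embedding \<open>ase A\<close>.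
\<close>

definition resampling_law ::
  "(real mat \<Rightarrow> nat \<Rightarrow> real ^ 'd) \<Rightarrow> (real ^ 'd) measure \<Rightarrow> nat \<Rightarrow>
   ((real mat \<times> (nat \<Rightarrow> real ^ 'd)) \<times> real mat) measure" where
  "resampling_law ase F n = rdpg F n \<bind>
     (\<lambda>(A, X). distr (rdpg_graph (empirical n (ase A)) n)
                ((graph_space n \<Otimes>\<^sub>M latent_space n) \<Otimes>\<^sub>M graph_space n)
                (\<lambda>B. ((A, X), B)))"

definition has_law :: "'w measure \<Rightarrow> ('w \<Rightarrow> 'a) \<Rightarrow> 'a measure \<Rightarrow> bool" where
  "has_law M Y L \<longleftrightarrow> Y \<in> measurable M L \<and> distr M L Y = L"


subsection \<open>Graph matching and Wasserstein distances\<close>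

definition perm_mats :: "nat \<Rightarrow> real mat set" where
  "perm_mats n = {mat n n (\<lambda>(i, j). if i = \<sigma> j then 1 else 0) | \<sigma>. \<sigma> permutes {..<n}}"

definition l1_norm :: "real mat \<Rightarrow> real" where
  "l1_norm A = (\<Sum>i<dim_row A. \<Sum>j<dim_col A. \<bar>A $$ (i, j)\<bar>)"

definition d_GM :: "real mat \<Rightarrow> real mat \<Rightarrow> real" where
  "d_GM A B = (MIN P\<in>perm_mats (dim_row A).
     inverse (real (dim_row A choose 2)) * (l1_norm (A - P * B * transpose_mat P) / 2))"

definition couplings :: "'a measure \<Rightarrow> 'b measure \<Rightarrow> ('a \<times> 'b) measure set" where
  "couplings M N =
     {C. sets C = sets (M \<Otimes>\<^sub>M N) \<and> distr C M fst = M \<and> distr C N snd = N}"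

text \<open>The \<open>p\<close>-th power of the \<open>p\<close>-Wasserstein distance, as a function of the two laws.\<close>

definition wasserstein_pow :: "real \<Rightarrow> real mat measure \<Rightarrow> real mat measure \<Rightarrow> real" where
  "wasserstein_pow p M N = (INF C\<in>couplings M N. \<integral>z. d_GM (fst z) (snd z) powr p \<partial>C)"

end

theory Submission
  imports Defs
begin

text \<open>
  Only edge disagreements under the identity matching are used. By Kantorovich duality on the
  finite set of graphs it suffices to compare the expectations of a function \<open>\<phi>\<close> that is
  1-Lipschitz for the normalised Hamming distance, and this is done in two steps, conditionally
  on \<open>X\<close>.

  Replacing the embedding by \<open>X\<close> itself costs at most \<open>n\<^sup>-\<^sup>1\<close> times the Frobenius distance of the
  two Gram matrices, so the orthogonal non-identifiability of the embedding plays no role. If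
  \<open>A - X X\<^sup>T\<close> has operator norm at most \<open>t\<close>, then Weyl's inequality and positive semidefiniteness
  of \<open>X X\<^sup>T\<close> bound this distance by a multiple of \<open>t\<close>, both matrices having rank at most \<open>d\<close>;
  no spectral gap is involved. A net argument with Hoeffding's inequality gives \<open>t = O(sqrt n)\<close>
  outside an event of probability \<open>exp (- n)\<close>.

  Replacing the empirical distribution of \<open>X\<close> by \<open>F\<close>, one vertex at a time, costs the dual
  1-Wasserstein distance between the two. Telescoping a Lipschitz function over dyadic cells
  bounds it by the weighted deviations of the cell frequencies, whose expectations are
  controlled by their variances and Cauchy-Schwarz.
\<close>

section \<open>Kantorovich duality on a finite set\<close>

text \<open>The distance takes values in [0, 1], so its p-th power is at most the distance itself
  and every p \<ge> 1 is governed by a bound for p = 1; this is why the rate is free of p.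
  Resampling makes the law of the new graph a mixture over measures that depend on A. Expectations
  of a test function are linear in such mixtures, so stages can be integrated out one after the
  other without choosing couplings measurably in \<open>X\<close>; a single coupling is produced, at
  the very end, for the unconditional laws. Both comparisons act on the expectation of the test
  function given the positions. An edge weighs 1 / binom(n, 2) and a vertex lies on n - 1 edges, so
  moving one position by h costs at most 2 h / n, and exchanging all n positions costs a constant
  times what exchanging one costs, with no loss in n. The logarithm counts scales: about log n
  dyadic levels are needed to reach cells of side n^(-1/d), and each contributes O(n^(-1/2) +
  n^(-1/d)). Counting levels treats all dimensions alike, including d = 2, where no single scale
  dominates.\<close>

lemma compact_simplex:
  fixes T :: "'b set"
  assumes "finite T"
  shows "compact {g :: 'b \<Rightarrow> real. (\<forall>z\<in>T. 0 \<le> g z) \<and> (\<forall>z. z \<notin> T \<longrightarrow> g z = 0) \<and> sum g T = 1}"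
proof -
  \<comment> \<open>Coordinates outside \<open>T\<close> are pinned to 0, so the set is a closed
    part of a product of compact sets over the whole index type, where Tychonoff's theorem
    applies.\<close>
  define B :: "'b \<Rightarrow> real set" where "B = (\<lambda>z. if z \<in> T then {0..1} else {0})"
  have "compactin (product_topology (\<lambda>_. euclidean) UNIV) (Pi\<^sub>E UNIV B)"
    unfolding compactin_PiE by (auto simp: B_def)
  hence 1: "compact (Pi\<^sub>E UNIV B)"
    by (simp add: euclidean_product_topology)
  have 2: "closed {g :: 'b \<Rightarrow> real. sum g T = 1}"
    by (intro closed_Collect_eq continuous_on_sum) auto
  have "{g :: 'b \<Rightarrow> real. (\<forall>z\<in>T. 0 \<le> g z) \<and> (\<forall>z. z \<notin> T \<longrightarrow> g z = 0) \<and> sum g T = 1}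
      = Pi\<^sub>E UNIV B \<inter> {g. sum g T = 1}" (is "?L = ?R")
  proof
    have "g \<in> ?R" if "g \<in> ?L" for g
    proof -
      have "g z \<le> 1" if "z \<in> T" for z
        using member_le_sum[of z T g] that \<open>g \<in> ?L\<close> assms by auto
      thus ?thesis using that by (auto simp: B_def)
    qed
    thus "?L \<subseteq> ?R" ..
    have "g \<in> ?L" if "g \<in> ?R" for g
    proof -
      have B: "g z \<in> B z" for z using that by (auto simp: PiE_def Pi_def)
      have "0 \<le> g z" if "z \<in> T" for z using B[of z] that by (simp add: B_def)
      moreover have "g z = 0" if "z \<notin> T" for z using B[of z] that by (simp add: B_def)
      ultimately show ?thesis using that by simp
    qed
    thus "?R \<subseteq> ?L" ..
  qed
  thus ?thesis using compact_Int_closed[OF 1 2] by simp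
qed

text \<open>Divide by t and let t tend to 0. For negative \<open>a\<close> the witness t makes t *
  \<bar>b\<bar> smaller than half of -a, so the linear term wins.\<close>

lemma linear_coeff_nonneg:
  fixes a b :: real
  assumes "\<And>t. 0 < t \<Longrightarrow> t \<le> 1 \<Longrightarrow> 0 \<le> t * a + t\<^sup>2 * b"
  shows "0 \<le> a"
proof (rule ccontr)
  assume "\<not> 0 \<le> a"
  define t where "t = min 1 (- a / (2 * (\<bar>b\<bar> + 1)))"
  have t: "0 < t" "t \<le> 1" using \<open>\<not> 0 \<le> a\<close> by (auto simp: t_def divide_simps)
  have "t \<le> - a / (2 * (\<bar>b\<bar> + 1))" by (simp add: t_def)
  hence "t * (2 * (\<bar>b\<bar> + 1)) \<le> - a"
    by (rule pos_le_divide_eq[THEN iffD1, rotated]) simp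
  moreover have "t * b \<le> t * \<bar>b\<bar>" using t by (intro mult_left_mono) auto
  ultimately have "2 * (t * b) + 2 * t \<le> - a" by (simp add: algebra_simps)
  hence "a + t * b < 0" using t \<open>\<not> 0 \<le> a\<close> by linarith
  hence "t * (a + t * b) < 0" using t by (simp add: mult_pos_neg)
  moreover have "0 \<le> t * (a + t * b)" using assms[OF t] by (simp add: algebra_simps power2_eq_square)
  ultimately show False by simp
qed

lemma sum_indicator_pair:
  fixes x y :: 'a and c :: "'a \<Rightarrow> 'a \<Rightarrow> real"
  assumes "finite S" "x \<in> S" "y \<in> S"
  shows "(\<Sum>z\<in>S\<times>S. (if z = (x, y) then 1 else 0) * c (fst z) (snd z)) = c x y"
  using assms by (subst sum.cong[OF refl, of _ _ "\<lambda>z. if z = (x,y) then c x y else 0"]) auto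

text \<open>
  The coupling is found by minimising, over all probability weights on \<open>S \<times> S\<close>, the squared
  violation of the two marginal constraints and of the cost bound. If the minimum is positive,
  the first-order conditions are a separating functional, whose \<open>c\<close>-transform contradicts
  the hypothesis.
\<close>

lemma finite_kantorovich_duality:
  fixes c :: "'a \<Rightarrow> 'a \<Rightarrow> real" and \<mu> \<nu> :: "'a \<Rightarrow> real"
  assumes fin: "finite S"
    and c0: "\<And>x. x \<in> S \<Longrightarrow> c x x = 0"
    and tri: "\<And>x y z. x \<in> S \<Longrightarrow> y \<in> S \<Longrightarrow> z \<in> S \<Longrightarrow> c x z \<le> c x y + c y z"
    and mu: "\<And>x. x \<in> S \<Longrightarrow> 0 \<le> \<mu> x" "sum \<mu> S = 1"
    and nu: "\<And>x. x \<in> S \<Longrightarrow> 0 \<le> \<nu> x" "sum \<nu> S = 1"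
    and dual: "\<And>\<phi>. (\<And>x y. x \<in> S \<Longrightarrow> y \<in> S \<Longrightarrow> \<phi> x - \<phi> y \<le> c x y) \<Longrightarrow>
                 (\<Sum>x\<in>S. \<phi> x * \<mu> x) - (\<Sum>x\<in>S. \<phi> x * \<nu> x) \<le> \<epsilon>"
  obtains \<gamma> :: "'a \<times> 'a \<Rightarrow> real" where
    "\<And>z. z \<in> S \<times> S \<Longrightarrow> 0 \<le> \<gamma> z"
    "\<And>x. x \<in> S \<Longrightarrow> (\<Sum>y\<in>S. \<gamma> (x, y)) = \<mu> x"
    "\<And>y. y \<in> S \<Longrightarrow> (\<Sum>x\<in>S. \<gamma> (x, y)) = \<nu> y"
    "(\<Sum>z\<in>S \<times> S. \<gamma> z * c (fst z) (snd z)) \<le> \<epsilon>"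
proof -
  define K where "K = {g :: 'a \<times> 'a \<Rightarrow> real. (\<forall>z\<in>S\<times>S. 0 \<le> g z) \<and> (\<forall>z. z \<notin> S\<times>S \<longrightarrow> g z = 0) \<and> sum g (S\<times>S) = 1}"
  have ne: "S \<noteq> {}" using mu by auto
  have compK: "compact K" unfolding K_def using fin by (intro compact_simplex) auto
  define m1 where "m1 = (\<lambda>(g :: 'a \<times> 'a \<Rightarrow> real) x. \<Sum>y\<in>S. g (x, y))"
  define m2 where "m2 = (\<lambda>(g :: 'a \<times> 'a \<Rightarrow> real) y. \<Sum>x\<in>S. g (x, y))"
  define cost where "cost = (\<lambda>g :: 'a \<times> 'a \<Rightarrow> real. \<Sum>z\<in>S \<times> S. g z * c (fst z) (snd z))"
  \<comment> \<open>The cost enters through a squared positive part: plans cheaper than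
    \<open>\<epsilon>\<close> are not penalised, and a first-order condition is still
    available.\<close>
  define Q where "Q = (\<lambda>g. (\<Sum>x\<in>S. (m1 g x - \<mu> x)\<^sup>2) + (\<Sum>y\<in>S. (m2 g y - \<nu> y)\<^sup>2) + (max 0 (cost g - \<epsilon>))\<^sup>2)"
  have contQ: "continuous_on K Q"
    unfolding Q_def m1_def m2_def cost_def
    by (intro continuous_intros continuous_on_product_coordinates[THEN continuous_on_subset]) auto
  define \<delta> where "\<delta> = (\<lambda>x y z. if z = (x :: 'a, y :: 'a) then 1 else 0 :: real)"
  have m1\<delta>: "m1 (\<delta> x y) x' = (if x' = x then 1 else 0)" if "x \<in> S" "y \<in> S" "x' \<in> S" for x y x'
    using that fin by (auto simp: m1_def \<delta>_def)
  have m2\<delta>: "m2 (\<delta> x y) x' = (if x' = y then 1 else 0)" if "x \<in> S" "y \<in> S" "x' \<in> S" for x y x'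
    using that fin by (auto simp: m2_def \<delta>_def)
  have cost\<delta>: "cost (\<delta> x y) = c x y" if "x \<in> S" "y \<in> S" for x y
    using sum_indicator_pair[OF fin that, of c] by (simp add: cost_def \<delta>_def)
  have \<delta>K: "\<delta> x y \<in> K" if "x \<in> S" "y \<in> S" for x y
    using that fin by (auto simp: K_def \<delta>_def)
  have Kne: "K \<noteq> {}" using \<delta>K ne by blast
  obtain g where g: "g \<in> K" "\<And>g'. g' \<in> K \<Longrightarrow> Q g \<le> Q g'"
    using continuous_attains_inf[OF compK Kne contQ] by blast
  define f1 where "f1 = (\<lambda>x. m1 g x - \<mu> x)"
  define f2 where "f2 = (\<lambda>x. m2 g x - \<nu> x)"
  define h where "h = max 0 (cost g - \<epsilon>)"
  have h0: "0 \<le> h" by (simp add: h_def)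
  have Qg: "Q g = (\<Sum>x\<in>S. (f1 x)\<^sup>2) + (\<Sum>x\<in>S. (f2 x)\<^sup>2) + h\<^sup>2" by (simp add: Q_def f1_def f2_def h_def)
  \<comment> \<open>The value at \<open>g\<close> of the linear functional given by half the
    gradient of \<open>Q\<close>. Minimality of \<open>g\<close> says that no vertex of the simplex,
    that is no point mass, has a smaller value.\<close>
  define \<kappa> where "\<kappa> = (\<Sum>x\<in>S. f1 x * m1 g x) + (\<Sum>x\<in>S. f2 x * m2 g x) + h * cost g"
  have foc: "\<kappa> \<le> f1 x + f2 y + h * c x y" if xy: "x \<in> S" "y \<in> S" for x y
  proof -
    define d1 where "d1 = (\<lambda>x'. m1 (\<delta> x y) x' - m1 g x')"
    define d2 where "d2 = (\<lambda>x'. m2 (\<delta> x y) x' - m2 g x')"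
    define b where "b = c x y - cost g"
    have "0 \<le> 2 * ((\<Sum>x\<in>S. f1 x * d1 x) + (\<Sum>x\<in>S. f2 x * d2 x) + h * b)"
    proof (rule linear_coeff_nonneg)
      fix t :: real assume t: "0 < t" "t \<le> 1"
      define gt where "gt = (\<lambda>z. g z + t * (\<delta> x y z - g z))"
      have "gt z = (1 - t) * g z + t * \<delta> x y z" for z by (simp add: gt_def algebra_simps)
      moreover have "sum gt (S \<times> S) = 1"
        using g(1) \<delta>K[OF xy] by (simp add: gt_def K_def sum.distrib sum_subtractf flip: sum_distrib_left)
      ultimately have gtK: "gt \<in> K" using g(1) \<delta>K[OF xy] t by (auto simp: K_def)
      have 1: "m1 gt x' - \<mu> x' = f1 x' + t * d1 x'" for x'
        by (simp add: gt_def m1_def f1_def d1_def sum.distrib sum_subtractf flip: sum_distrib_left)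
      have 2: "m2 gt x' - \<nu> x' = f2 x' + t * d2 x'" for x'
        by (simp add: gt_def m2_def f2_def d2_def sum.distrib sum_subtractf flip: sum_distrib_left)
      have "cost gt = cost g + t * (cost (\<delta> x y) - cost g)"
        by (simp add: gt_def cost_def algebra_simps sum.distrib sum_subtractf sum_distrib_left)
      hence 3: "cost gt - \<epsilon> = (cost g - \<epsilon>) + t * b" using cost\<delta>[OF xy] by (simp add: b_def)
      \<comment> \<open>The positive part is replaced by a bound affine in t with the same value at
        t = 0, so that the increment of \<open>Q\<close> is majorised by an exact quadratic
        polynomial in t.\<close>
      have "\<bar>max 0 (cost gt - \<epsilon>)\<bar> \<le> \<bar>h + t * b\<bar>" unfolding 3 h_def by (auto simp: max_def)
      hence 4: "(max 0 (cost gt - \<epsilon>))\<^sup>2 \<le> (h + t * b)\<^sup>2"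
        by (simp only: abs_le_square_iff)
      have "Q g \<le> Q gt" by (rule g(2)[OF gtK])
      also have "Q gt \<le> (\<Sum>x\<in>S. (f1 x + t * d1 x)\<^sup>2) + (\<Sum>y\<in>S. (f2 y + t * d2 y)\<^sup>2) + (h + t * b)\<^sup>2"
        unfolding Q_def 1 2 using 4 by simp
      also have "\<dots> = Q g + (t * (2 * ((\<Sum>x\<in>S. f1 x * d1 x) + (\<Sum>x\<in>S. f2 x * d2 x) + h * b)) +
          t\<^sup>2 * ((\<Sum>x\<in>S. (d1 x)\<^sup>2) + (\<Sum>x\<in>S. (d2 x)\<^sup>2) + b\<^sup>2))"
        unfolding Qg by (simp add: power2_eq_square algebra_simps sum.distrib sum_distrib_left)
      finally show "0 \<le> t * (2 * ((\<Sum>x\<in>S. f1 x * d1 x) + (\<Sum>x\<in>S. f2 x * d2 x) + h * b)) +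
          t\<^sup>2 * ((\<Sum>x\<in>S. (d1 x)\<^sup>2) + (\<Sum>x\<in>S. (d2 x)\<^sup>2) + b\<^sup>2)" by simp
    qed
    moreover have "(\<Sum>x\<in>S. f1 x * d1 x) = f1 x - (\<Sum>x\<in>S. f1 x * m1 g x)"
    proof -
      have "(\<Sum>x'\<in>S. f1 x' * d1 x') = (\<Sum>x'\<in>S. (if x' = x then f1 x else 0) - f1 x' * m1 g x')"
        by (intro sum.cong refl) (auto simp: d1_def m1\<delta>[OF xy] algebra_simps)
      thus ?thesis using xy fin by (simp add: sum_subtractf)
    qed
    moreover have "(\<Sum>x\<in>S. f2 x * d2 x) = f2 y - (\<Sum>x\<in>S. f2 x * m2 g x)"
    proof -
      have "(\<Sum>x'\<in>S. f2 x' * d2 x') = (\<Sum>x'\<in>S. (if x' = y then f2 y else 0) - f2 x' * m2 g x')"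
        by (intro sum.cong refl) (auto simp: d2_def m2\<delta>[OF xy] algebra_simps)
      thus ?thesis using xy fin by (simp add: sum_subtractf)
    qed
    ultimately show ?thesis by (simp add: \<kappa>_def b_def algebra_simps)
  qed
  have hh: "h * (cost g - \<epsilon>) = h\<^sup>2" by (auto simp: h_def max_def power2_eq_square)
  have \<kappa>: "\<kappa> = (\<Sum>x\<in>S. f1 x * \<mu> x) + (\<Sum>x\<in>S. f2 x * \<nu> x) + h * \<epsilon> + Q g"
  proof -
    have "(\<Sum>x\<in>S. f1 x * m1 g x) = (\<Sum>x\<in>S. f1 x * \<mu> x) + (\<Sum>x\<in>S. (f1 x)\<^sup>2)"
      unfolding sum.distrib[symmetric] by (intro sum.cong) (auto simp: f1_def power2_eq_square algebra_simps)
    moreover have "(\<Sum>x\<in>S. f2 x * m2 g x) = (\<Sum>x\<in>S. f2 x * \<nu> x) + (\<Sum>x\<in>S. (f2 x)\<^sup>2)"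
      unfolding sum.distrib[symmetric] by (intro sum.cong) (auto simp: f2_def power2_eq_square algebra_simps)
    moreover have "h * cost g = h * \<epsilon> + h\<^sup>2" using hh by (simp add: algebra_simps)
    ultimately show ?thesis by (simp add: \<kappa>_def Qg)
  qed
  have Qnn: "0 \<le> Q g" unfolding Qg by (intro add_nonneg_nonneg sum_nonneg) auto
  have "Q g = 0"
  proof (rule ccontr)
    assume "Q g \<noteq> 0"
    hence Qp: "0 < Q g" using Qnn by simp
    \<comment> \<open>If the cost constraint were inactive, averaging \<open>foc\<close> over the
      product of \<open>\<mu>\<close> and \<open>\<nu>\<close>, a plan with the right marginals,
      would contradict the formula for \<open>\<kappa>\<close>, which exceeds that average by
      \<open>Q g\<close>.\<close>
    have "0 < h"
    proof (rule ccontr)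
      assume "\<not> 0 < h"
      hence h: "h = 0" using h0 by simp
      have "(\<Sum>x\<in>S. \<Sum>y\<in>S. \<mu> x * \<nu> y * \<kappa>) \<le> (\<Sum>x\<in>S. \<Sum>y\<in>S. \<mu> x * \<nu> y * (f1 x + f2 y))"
        using foc h mu nu by (intro sum_mono mult_left_mono) auto
      moreover have "(\<Sum>x\<in>S. \<Sum>y\<in>S. \<mu> x * \<nu> y * \<kappa>) = \<kappa>"
        using mu nu by (simp add: sum_distrib_left[symmetric] sum_distrib_right[symmetric])
      moreover have "(\<Sum>x\<in>S. \<Sum>y\<in>S. \<mu> x * \<nu> y * (f1 x + f2 y)) =
           (\<Sum>x\<in>S. f1 x * \<mu> x) * sum \<nu> S + sum \<mu> S * (\<Sum>y\<in>S. f2 y * \<nu> y)"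
        unfolding sum_product sum.distrib[symmetric] by (intro sum.cong refl) (simp add: algebra_simps)
      ultimately show False using \<kappa> Qp h mu nu by simp
    qed
    \<comment> \<open>The triangle inequality makes this transform of \<open>f2 / h\<close>
      Lipschitz, the zero diagonal of \<open>c\<close> gives \<open>\<phi> x \<le> f2 x / h\<close>,
      and \<open>foc\<close> gives \<open>\<kappa> \<le> f1 x + h * \<phi> x\<close>. Integrated
      against \<open>\<nu>\<close> and \<open>\<mu>\<close>, the last two violate the dual
      inequality by the positive amount \<open>Q g\<close>.\<close>
    define \<phi> where "\<phi> = (\<lambda>x. Min ((\<lambda>y. f2 y / h + c x y) ` S))"
    have \<phi>le: "\<phi> x \<le> f2 y / h + c x y" if "y \<in> S" for x y
      unfolding \<phi>_def using fin that by (intro Min_le) auto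
    have \<phi>ex: "\<exists>y\<in>S. \<phi> x = f2 y / h + c x y" for x
    proof -
      have "\<phi> x \<in> (\<lambda>y. f2 y / h + c x y) ` S" unfolding \<phi>_def using fin ne by (intro Min_in) auto
      thus ?thesis by auto
    qed
    have lip: "\<phi> x - \<phi> x' \<le> c x x'" if x: "x \<in> S" "x' \<in> S" for x x'
    proof -
      obtain y where "y \<in> S" "\<phi> x' = f2 y / h + c x' y" using \<phi>ex by blast
      thus ?thesis using \<phi>le[of y x] tri[of x x' y] x by simp
    qed
    have 1: "(\<Sum>x\<in>S. \<phi> x * \<mu> x) - (\<Sum>x\<in>S. \<phi> x * \<nu> x) \<le> \<epsilon>" by (rule dual[OF lip])
    have "(\<Sum>x\<in>S. \<phi> x * \<nu> x) \<le> (\<Sum>x\<in>S. f2 x / h * \<nu> x)"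
    proof (intro sum_mono mult_right_mono)
      fix x assume x: "x \<in> S"
      show "\<phi> x \<le> f2 x / h" using \<phi>le[OF x, of x] c0[OF x] by simp
      show "0 \<le> \<nu> x" using nu x by simp
    qed
    hence 2: "h * (\<Sum>x\<in>S. \<phi> x * \<nu> x) \<le> (\<Sum>x\<in>S. f2 x * \<nu> x)"
      using \<open>0 < h\<close> by (simp add: pos_le_divide_eq mult.commute flip: sum_divide_distrib)
    have "\<kappa> \<le> f1 x + h * \<phi> x" if x: "x \<in> S" for x
    proof -
      obtain y where "y \<in> S" "\<phi> x = f2 y / h + c x y" using \<phi>ex by blast
      thus ?thesis using foc[OF x, of y] \<open>0 < h\<close> by (simp add: algebra_simps)
    qed
    hence "(\<Sum>x\<in>S. \<kappa> * \<mu> x) \<le> (\<Sum>x\<in>S. (f1 x + h * \<phi> x) * \<mu> x)"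
      using mu by (intro sum_mono mult_right_mono) auto
    also have "\<dots> = (\<Sum>x\<in>S. f1 x * \<mu> x) + h * (\<Sum>x\<in>S. \<phi> x * \<mu> x)"
      by (simp add: sum.distrib sum_distrib_left algebra_simps)
    finally have 3: "\<kappa> \<le> (\<Sum>x\<in>S. f1 x * \<mu> x) + h * (\<Sum>x\<in>S. \<phi> x * \<mu> x)"
      using mu by (simp flip: sum_distrib_left)
    have "h * ((\<Sum>x\<in>S. \<phi> x * \<mu> x) - (\<Sum>x\<in>S. \<phi> x * \<nu> x)) \<le> h * \<epsilon>"
      using 1 \<open>0 < h\<close> by (intro mult_left_mono) auto
    hence "h * (\<Sum>x\<in>S. \<phi> x * \<mu> x) - h * (\<Sum>x\<in>S. \<phi> x * \<nu> x) \<le> h * \<epsilon>" by (simp add: algebra_simps)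
    thus False using 2 3 \<kappa> Qp by linarith
  qed
  hence z: "(\<Sum>x\<in>S. (f1 x)\<^sup>2) = 0" "(\<Sum>x\<in>S. (f2 x)\<^sup>2) = 0" "h\<^sup>2 = 0"
    using sum_nonneg[of S "\<lambda>x. (f1 x)\<^sup>2"] sum_nonneg[of S "\<lambda>x. (f2 x)\<^sup>2"] unfolding Qg
    by (smt (verit) zero_le_power2)+
  have "\<And>x. x \<in> S \<Longrightarrow> f1 x = 0" "\<And>x. x \<in> S \<Longrightarrow> f2 x = 0"
    using z fin by (auto simp: sum_nonneg_eq_0_iff)
  moreover have "cost g \<le> \<epsilon>" using z(3) by (simp add: h_def max_def split: if_splits)
  ultimately show ?thesis
    using g(1) by (intro that[of g]) (auto simp: K_def f1_def f2_def m1_def m2_def cost_def)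
qed

section \<open>Spectral truncation of a noisy Gram matrix\<close>

text \<open>The dimension n varies, so vectors are functions of which only the indices below n
  count. Equalities of vectors are therefore proved pointwise for i < n and transferred by
  \<open>ip_cong\<close>.\<close>

definition ip :: "nat \<Rightarrow> (nat \<Rightarrow> real) \<Rightarrow> (nat \<Rightarrow> real) \<Rightarrow> real" where
  "ip n x y = (\<Sum>i<n. x i * y i)"

definition mv :: "nat \<Rightarrow> (nat \<Rightarrow> nat \<Rightarrow> real) \<Rightarrow> (nat \<Rightarrow> real) \<Rightarrow> nat \<Rightarrow> real" where
  "mv n M y = (\<lambda>i. \<Sum>j<n. M i j * y j)"

abbreviation sqnorm :: "nat \<Rightarrow> (nat \<Rightarrow> real) \<Rightarrow> real" where
  "sqnorm n x \<equiv> ip n x x"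

lemma ip_commute: "ip n x y = ip n y x"
  by (simp add: ip_def mult.commute)

lemma ip_cong: "(\<And>i. i < n \<Longrightarrow> x i = x' i) \<Longrightarrow> (\<And>i. i < n \<Longrightarrow> y i = y' i) \<Longrightarrow> ip n x y = ip n x' y'"
  by (simp add: ip_def)

lemma ip_nonneg [simp]: "0 \<le> sqnorm n x"
  by (auto simp: ip_def intro: sum_nonneg)

lemma ip_sum_left: "ip n (\<lambda>i. \<Sum>k\<in>K. f k i) y = (\<Sum>k\<in>K. ip n (f k) y)"
  unfolding ip_def by (simp add: sum_distrib_right) (rule sum.swap)

lemma ip_sum_right: "ip n y (\<lambda>i. \<Sum>k\<in>K. f k i) = (\<Sum>k\<in>K. ip n y (f k))"
  using ip_sum_left[of n f K y] by (simp add: ip_commute)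

lemma ip_scale_left: "ip n (\<lambda>i. a * x i) y = a * ip n x y"
  by (simp add: ip_def sum_distrib_left mult.assoc)

lemma ip_scale_right: "ip n y (\<lambda>i. a * x i) = a * ip n y x"
  by (simp add: ip_def sum_distrib_left algebra_simps)

lemma ip_add_left: "ip n (\<lambda>i. x i + y i) z = ip n x z + ip n y z"
  by (simp add: ip_def algebra_simps sum.distrib)

lemma ip_diff_left: "ip n (\<lambda>i. x i - y i) z = ip n x z - ip n y z"
  by (simp add: ip_def algebra_simps sum_subtractf)

lemma ip_diff_right: "ip n z (\<lambda>i. x i - y i) = ip n z x - ip n z y"
  by (simp add: ip_def algebra_simps sum_subtractf)

lemma ip_add_right: "ip n z (\<lambda>i. x i + y i) = ip n z x + ip n z y"
  by (simp add: ip_def algebra_simps sum.distrib)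

lemma ip_self_eq_0: "sqnorm n x = 0 \<Longrightarrow> i < n \<Longrightarrow> x i = 0"
  by (simp add: ip_def sum_nonneg_eq_0_iff)

lemma ip_Cauchy_Schwarz: "(ip n x y)\<^sup>2 \<le> sqnorm n x * sqnorm n y"
  using Cauchy_Schwarz_ineq_sum[of x y "{..<n}"] by (simp add: ip_def power2_eq_square)

lemma ip_add_sq_le: "sqnorm n (\<lambda>i. x i + y i) \<le> 2 * sqnorm n x + 2 * sqnorm n y"
proof -
  have "(x i + y i) * (x i + y i) \<le> 2 * (x i * x i) + 2 * (y i * y i)" for i
    using sum_squares_bound[of "x i" "y i"] by (simp add: power2_eq_square algebra_simps)
  thus ?thesis unfolding ip_def sum_distrib_left sum.distrib[symmetric] by (intro sum_mono)
qed

lemma ip_mv_symmetric: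
  assumes "\<And>i j. i < n \<Longrightarrow> j < n \<Longrightarrow> M i j = M j i"
  shows "ip n (mv n M x) y = ip n x (mv n M y)"
proof -
  have "ip n (mv n M x) y = (\<Sum>i<n. \<Sum>j<n. M i j * x j * y i)"
    by (simp add: ip_def mv_def sum_distrib_right)
  also have "\<dots> = (\<Sum>j<n. \<Sum>i<n. M i j * x j * y i)" by (rule sum.swap)
  also have "\<dots> = (\<Sum>j<n. \<Sum>i<n. x j * (M j i * y i))"
    by (intro sum.cong refl) (simp add: assms algebra_simps)
  also have "\<dots> = ip n x (mv n M y)" by (simp add: ip_def mv_def sum_distrib_left)
  finally show ?thesis .
qed

definition orthonormal :: "nat \<Rightarrow> nat \<Rightarrow> (nat \<Rightarrow> nat \<Rightarrow> real) \<Rightarrow> bool" where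
  "orthonormal n r e \<longleftrightarrow> (\<forall>k<r. \<forall>l<r. ip n (e k) (e l) = (if k = l then 1 else 0))"

lemma orthonormal_coeff:
  assumes "orthonormal n r e" "l < r"
  shows "ip n (\<lambda>i. \<Sum>k<r. a k * e k i) (e l) = a l"
proof -
  have "ip n (\<lambda>i. \<Sum>k<r. a k * e k i) (e l) = (\<Sum>k<r. if k = l then a l else 0)"
    unfolding ip_sum_left ip_scale_left using assms
    by (intro sum.cong refl) (auto simp: orthonormal_def)
  thus ?thesis using assms by simp
qed

lemma orthonormal_norm:
  assumes "orthonormal n r e"
  shows "sqnorm n (\<lambda>i. \<Sum>k<r. a k * e k i) = (\<Sum>k<r. (a k)\<^sup>2)"
proof -
  have "sqnorm n (\<lambda>i. \<Sum>k<r. a k * e k i)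
     = (\<Sum>k<r. a k * ip n (\<lambda>i. \<Sum>k<r. a k * e k i) (e k))"
    by (subst ip_sum_right) (simp add: ip_scale_right)
  also have "\<dots> = (\<Sum>k<r. (a k)\<^sup>2)"
    using orthonormal_coeff[OF assms] by (intro sum.cong refl) (auto simp: power2_eq_square)
  finally show ?thesis .
qed

lemma gram_schmidt_exists:
  fixes x :: "'m \<Rightarrow> nat \<Rightarrow> real"
  assumes "finite J"
  shows "\<exists>r e. r \<le> card J \<and> orthonormal n r e \<and>
           (\<forall>l\<in>J. \<forall>i<n. x l i = (\<Sum>k<r. ip n (x l) (e k) * e k i))"
  using assms
proof (induction J rule: finite_induct)
  case empty
  show ?case by (rule exI[of _ 0]) (simp add: orthonormal_def)
next
  case (insert m J)
  then obtain r e where re: "r \<le> card J" "orthonormal n r e"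
    "\<And>l i. l \<in> J \<Longrightarrow> i < n \<Longrightarrow> x l i = (\<Sum>k<r. ip n (x l) (e k) * e k i)" by blast
  define w where "w = (\<lambda>i. x m i - (\<Sum>k<r. ip n (x m) (e k) * e k i))"
  have we: "ip n w (e k) = 0" if "k < r" for k
    unfolding w_def ip_diff_left orthonormal_coeff[OF re(2) that] by simp
  show ?case
  proof (cases "sqnorm n w = 0")
    case True
    have "x m i = (\<Sum>k<r. ip n (x m) (e k) * e k i)" if "i < n" for i
      using ip_self_eq_0[OF True that] by (simp add: w_def)
    thus ?thesis using re insert(1,2) by (intro exI[of _ r] exI[of _ e]) auto
  next
    case False
    define c where "c = sqrt (sqnorm n w)"
    have c: "c > 0" "c * c = sqnorm n w"
      using False ip_nonneg[of n w] by (auto simp: c_def order_less_le)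
    define f where "f = e(r := (\<lambda>i. (1 / c) * w i))"
    have fr: "f r = (\<lambda>i. (1 / c) * w i)" by (simp add: f_def)
    have fk: "f k = e k" if "k < r" for k using that by (simp add: f_def)
    have ew: "ip n (e k) w = 0" if "k < r" for k using we[OF that] by (simp add: ip_commute)
    have on: "orthonormal n (Suc r) f"
      unfolding orthonormal_def
    proof (intro allI impI)
      fix k l assume "k < Suc r" "l < Suc r"
      then consider "k < r" "l < r" | "k < r" "l = r" | "k = r" "l < r" | "k = r" "l = r" by linarith
      thus "ip n (f k) (f l) = (if k = l then 1 else 0)"
      proof cases
        case 1 thus ?thesis using re(2) by (simp add: fk orthonormal_def)
      next
        case 2 thus ?thesis unfolding 2(2) fr ip_scale_right fk[OF 2(1)] ew[OF 2(1)] by simp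
      next
        case 3 thus ?thesis unfolding 3(1) fr ip_scale_left fk[OF 3(2)] we[OF 3(2)] by simp
      next
        case 4
        have "sqnorm n (f r) = (1 / c) * ((1 / c) * (c * c))"
          by (simp only: fr ip_scale_left ip_scale_right c(2))
        thus ?thesis using 4 c(1) by simp
      qed
    qed
    have xw: "ip n (x l) w = 0" if "l \<in> J" for l
    proof -
      have "ip n (x l) w = ip n (\<lambda>i. \<Sum>k<r. ip n (x l) (e k) * e k i) w"
        by (rule ip_cong) (auto simp: re(3)[OF that])
      also have "\<dots> = 0" unfolding ip_sum_left ip_scale_left by (simp add: ew)
      finally show ?thesis .
    qed
    have mw: "ip n (x m) w = sqnorm n w"
    proof -
      have "ip n (x m) w = ip n (\<lambda>i. w i + (\<Sum>k<r. ip n (x m) (e k) * e k i)) w"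
        by (rule ip_cong) (auto simp: w_def)
      also have "\<dots> = sqnorm n w" 
        unfolding ip_add_left ip_sum_left ip_scale_left by (simp add: ew)
      finally show ?thesis .
    qed
    have "x l i = (\<Sum>k<Suc r. ip n (x l) (f k) * f k i)" if "l \<in> insert m J" "i < n" for l i
    proof (cases "l = m")
      case True
      have "(\<Sum>k<Suc r. ip n (x m) (f k) * f k i) = (\<Sum>k<r. ip n (x m) (e k) * e k i) + w i"
      proof -
        have "ip n (x m) (f r) = (1 / c) * (c * c)" by (simp only: fr ip_scale_right mw c(2))
        hence "ip n (x m) (f r) * f r i = w i" using c(1) by (simp add: fr)
        thus ?thesis by (simp add: fk)
      qed
      thus ?thesis by (simp add: True w_def)
    next
      case False
      hence l: "l \<in> J" using that by auto
      have "(\<Sum>k<Suc r. ip n (x l) (f k) * f k i) = (\<Sum>k<r. ip n (x l) (e k) * e k i)"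
      proof -
        have "ip n (x l) (f r) = 0" by (simp only: fr ip_scale_right xw[OF l])
        thus ?thesis by (simp add: fk)
      qed
      thus ?thesis using re(3)[OF l that(2)] by simp
    qed
    thus ?thesis using on re(1) insert(1,2) by (intro exI[of _ "Suc r"] exI[of _ f]) auto
  qed
qed

text \<open>d + 1 vectors in dimension d are dependent. The relation is wanted for an indexed
  family, whereas \<open>dependent\<close> speaks of a set and does not see repetitions; a repeated
  vector gives the relation 1, -1 directly.\<close>

lemma linear_relation_exists:
  fixes y :: "nat \<Rightarrow> real ^ 'd"
  shows "\<exists>c. (\<Sum>k\<le>CARD('d). c k *\<^sub>R y k) = 0 \<and> (\<exists>k\<le>CARD('d). c k \<noteq> 0)"
proof (cases "inj_on y {..CARD('d)}")
  case False
  then obtain k l where kl: "k \<le> CARD('d)" "l \<le> CARD('d)" "y k = y l" "k \<noteq> l" by (auto simp: inj_on_def)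
  let ?c = "\<lambda>j. if j = k then 1 else if j = l then -1 else (0 :: real)"
  have "(\<Sum>j\<le>CARD('d). ?c j *\<^sub>R y j) = (\<Sum>j\<in>{k,l}. ?c j *\<^sub>R y j)"
    using kl by (intro sum.mono_neutral_right) auto
  also have "\<dots> = 0" using kl by auto
  finally show ?thesis using kl by (intro exI[of _ ?c]) auto
next
  case True
  have "dependent (y ` {..CARD('d)})"
    by (rule dependent_biggerset) (simp add: card_image[OF True])
  then obtain q where q: "(\<Sum>v\<in>y ` {..CARD('d)}. q v *\<^sub>R v) = 0" "\<exists>v\<in>y ` {..CARD('d)}. q v \<noteq> 0"
    by (subst (asm) dependent_finite) auto
  thus ?thesis using True by (intro exI[of _ "q \<circ> y"]) (auto simp: sum.reindex)
qed

text \<open>With P the Gram matrix and D = B - P, the squared Frobenius norm of D is the sum of the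
  squared norms of D u_k over the eigenbasis of A. For k < d, D u_k = (\<bar>s_k\<bar> - s_k) u_k +
  E u_k contributes at most 2 * 4 t^2 + 2 t^2 = 10 t^2. For k \<ge> d, D u_k = - P u_k; one by one
  these terms are only O(t^2) for n - d indices, but the rank of P lets their total be rewritten as
  at most d sums, each at most 4 t^2. Together this is 14 d t^2.\<close>

lemma truncated_eigen_frobenius:
  fixes A E B :: "nat \<Rightarrow> nat \<Rightarrow> real" and X :: "nat \<Rightarrow> real ^ 'd"
  assumes AE: "\<And>i j. i < n \<Longrightarrow> j < n \<Longrightarrow> A i j = inner (X i) (X j) + E i j"
    and E_sym: "\<And>i j. i < n \<Longrightarrow> j < n \<Longrightarrow> E i j = E j i"
    and eig: "\<And>k i. k < n \<Longrightarrow> i < n \<Longrightarrow> mv n A (u k) i = s k * u k i"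
    and on: "orthonormal n n u"
    and complete: "\<And>i j. i < n \<Longrightarrow> j < n \<Longrightarrow> (\<Sum>k<n. u k i * u k j) = (if i = j then 1 else 0)"
    and mono: "\<And>k l. k \<le> l \<Longrightarrow> l < n \<Longrightarrow> \<bar>s l\<bar> \<le> \<bar>s k\<bar>"
    and dn: "CARD('d) \<le> n"
    and op: "\<And>y. sqnorm n (mv n E y) \<le> t\<^sup>2 * sqnorm n y"
    and B: "\<And>i j. i < n \<Longrightarrow> j < n \<Longrightarrow> B i j = (\<Sum>k<CARD('d). \<bar>s k\<bar> * u k i * u k j)"
  shows "(\<Sum>i<n. \<Sum>j<n. (B i j - inner (X i) (X j))\<^sup>2) \<le> 14 * real CARD('d) * t\<^sup>2"
proof -
  let ?d = "CARD('d)"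
  define P where "P = (\<lambda>i j. inner (X i) (X j))"
  define D where "D = (\<lambda>i j. B i j - P i j)"
  have unit: "sqnorm n (u k) = 1" if "k < n" for k using on that by (simp add: orthonormal_def)
  have P_sym: "P i j = P j i" for i j by (simp add: P_def inner_commute)
  have A_sym: "A i j = A j i" if "i < n" "j < n" for i j
    using AE[OF that] AE[OF that(2,1)] E_sym[OF that] P_sym[of i j] by (simp add: P_def)
  have mvA: "mv n A y i = mv n P y i + mv n E y i" if "i < n" for y i
    using that by (simp add: mv_def AE P_def algebra_simps sum.distrib)
  have parseval: "(\<Sum>k<n. (ip n y (u k))\<^sup>2) = sqnorm n y" for y
  proof -
    have "(\<Sum>k<n. (ip n y (u k))\<^sup>2) = (\<Sum>k<n. \<Sum>i<n. \<Sum>j<n. y i * y j * (u k i * u k j))"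
      unfolding ip_def power2_eq_square sum_product by (simp add: algebra_simps)
    also have "\<dots> = (\<Sum>i<n. \<Sum>k<n. \<Sum>j<n. y i * y j * (u k i * u k j))" by (rule sum.swap)
    also have "\<dots> = (\<Sum>i<n. \<Sum>j<n. \<Sum>k<n. y i * y j * (u k i * u k j))"
      by (intro sum.cong refl sum.swap)
    also have "\<dots> = (\<Sum>i<n. \<Sum>j<n. if i = j then y i * y i else 0)"
      unfolding sum_distrib_left[symmetric] by (intro sum.cong refl) (auto simp: complete)
    also have "\<dots> = sqnorm n y" by (simp add: ip_def)
    finally show ?thesis .
  qed
  have tail: "(\<Sum>k\<in>{?d..<n}. (ip n y (u k))\<^sup>2) \<le> sqnorm n y" for y
  proof -
    have "(\<Sum>k\<in>{?d..<n}. (ip n y (u k))\<^sup>2) \<le> (\<Sum>k<n. (ip n y (u k))\<^sup>2)"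
      by (intro sum_mono2) auto
    thus ?thesis by (simp add: parseval)
  qed
  have psd: "0 \<le> ip n y (mv n P y)" for y
  proof -
    have "ip n y (mv n P y) = (\<Sum>i<n. \<Sum>j<n. inner (y i *\<^sub>R X i) (y j *\<^sub>R X j))"
      by (simp add: ip_def mv_def P_def sum_distrib_left mult_ac)
    also have "\<dots> = inner (\<Sum>i<n. y i *\<^sub>R X i) (\<Sum>j<n. y j *\<^sub>R X j)"
      by (simp only: inner_sum_left inner_sum_right) (rule sum.swap)
    finally have "ip n y (mv n P y) = inner (\<Sum>i<n. y i *\<^sub>R X i) (\<Sum>j<n. y j *\<^sub>R X j)" .
    thus ?thesis by simp
  qed
  have E_ip: "\<bar>ip n (u k) (mv n E (u k))\<bar> \<le> \<bar>t\<bar>" if "k < n" for k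
  proof -
    have "(ip n (u k) (mv n E (u k)))\<^sup>2 \<le> t\<^sup>2"
      using ip_Cauchy_Schwarz[of n "u k" "mv n E (u k)"] op[of "u k"] unit[OF that] by simp
    thus ?thesis by (simp only: abs_le_square_iff)
  qed
  \<comment> \<open>The eigenvalue is a Rayleigh quotient of P, which is nonnegative, plus one of E.
    Hence it is at least -\<bar>t\<bar>, and taking its absolute value changes it by at most 2
    \<bar>t\<bar>.\<close>
  have neg: "(\<bar>s k\<bar> - s k)\<^sup>2 \<le> 4 * t\<^sup>2" if k: "k < n" for k
  proof -
    have "s k = ip n (u k) (mv n A (u k))"
    proof -
      have "ip n (u k) (mv n A (u k)) = ip n (u k) (\<lambda>i. s k * u k i)"
        by (rule ip_cong) (auto simp: eig[OF k])
      thus ?thesis by (simp add: ip_scale_right unit[OF k])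
    qed
    also have "\<dots> = ip n (u k) (mv n P (u k)) + ip n (u k) (mv n E (u k))"
      unfolding ip_add_right[symmetric] by (rule ip_cong) (auto simp: mvA)
    finally have "- \<bar>t\<bar> \<le> s k" using psd[of "u k"] E_ip[OF k] by linarith
    hence "\<bar>\<bar>s k\<bar> - s k\<bar> \<le> \<bar>2 * t\<bar>" by auto
    thus ?thesis unfolding abs_le_square_iff by (simp add: power_mult_distrib)
  qed
  \<comment> \<open>Among the combinations of the d + 1 leading eigenvectors there is a nonzero v
    annihilated by P, by counting dimensions. Then A v = E v has norm at most \<bar>t\<bar> times
    that of v, while A stretches v by at least \<bar>s_d\<bar>.\<close>
  have weyl: "(s k)\<^sup>2 \<le> t\<^sup>2" if k: "?d \<le> k" "k < n" for k
  proof -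
    obtain c where c: "(\<Sum>k\<le>?d. c k *\<^sub>R (\<Sum>i<n. u k i *\<^sub>R X i)) = 0" "\<exists>k\<le>?d. c k \<noteq> 0"
      using linear_relation_exists[of "\<lambda>k. \<Sum>i<n. u k i *\<^sub>R X i"] by blast
    have on': "orthonormal n (Suc ?d) u" using on k by (auto simp: orthonormal_def)
    define v where "v = (\<lambda>i. \<Sum>k<Suc ?d. c k * u k i)"
    have vv: "sqnorm n v = (\<Sum>k<Suc ?d. (c k)\<^sup>2)" unfolding v_def by (rule orthonormal_norm[OF on'])
    have Xv: "(\<Sum>j<n. v j *\<^sub>R X j) = 0"
    proof -
      have "(\<Sum>j<n. v j *\<^sub>R X j) = (\<Sum>j<n. \<Sum>k<Suc ?d. (c k * u k j) *\<^sub>R X j)"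
        by (simp add: v_def scaleR_sum_left del: sum.lessThan_Suc)
      also have "\<dots> = (\<Sum>k<Suc ?d. \<Sum>j<n. (c k * u k j) *\<^sub>R X j)" by (rule sum.swap)
      also have "\<dots> = 0" using c(1) by (simp add: scaleR_sum_right lessThan_Suc_atMost del: sum.lessThan_Suc)
      finally show ?thesis .
    qed
    have Pv: "mv n P v i = 0" for i
    proof -
      have "mv n P v i = inner (X i) (\<Sum>j<n. v j *\<^sub>R X j)"
        by (simp add: mv_def P_def inner_sum_right algebra_simps)
      thus ?thesis by (simp add: Xv)
    qed
    have Av: "mv n A v i = (\<Sum>k<Suc ?d. (c k * s k) * u k i)" if i: "i < n" for i
    proof -
      have "mv n A v i = (\<Sum>j<n. \<Sum>k<Suc ?d. c k * (A i j * u k j))"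
        by (simp add: mv_def v_def sum_distrib_left algebra_simps del: sum.lessThan_Suc)
      also have "\<dots> = (\<Sum>k<Suc ?d. \<Sum>j<n. c k * (A i j * u k j))" by (rule sum.swap)
      also have "\<dots> = (\<Sum>k<Suc ?d. c k * mv n A (u k) i)"
        by (simp add: mv_def sum_distrib_left del: sum.lessThan_Suc)
      also have "\<dots> = (\<Sum>k<Suc ?d. (c k * s k) * u k i)"
        using k i by (intro sum.cong refl) (auto simp: eig)
      finally show ?thesis .
    qed
    have "(\<Sum>k<Suc ?d. (c k * s k)\<^sup>2) = sqnorm n (mv n A v)"
      unfolding orthonormal_norm[OF on', symmetric] by (rule ip_cong) (auto simp: Av)
    also have "\<dots> = sqnorm n (mv n E v)" by (rule ip_cong) (auto simp: mvA Pv)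
    also have "\<dots> \<le> t\<^sup>2 * (\<Sum>k<Suc ?d. (c k)\<^sup>2)" using op[of v] by (simp add: vv)
    finally have 1: "(\<Sum>k<Suc ?d. (c k * s k)\<^sup>2) \<le> t\<^sup>2 * (\<Sum>k<Suc ?d. (c k)\<^sup>2)" .
    have 2: "(s ?d)\<^sup>2 * (\<Sum>k<Suc ?d. (c k)\<^sup>2) \<le> (\<Sum>k<Suc ?d. (c k * s k)\<^sup>2)"
      unfolding sum_distrib_left
    proof (intro sum_mono)
      fix l assume "l \<in> {..<Suc ?d}"
      hence "\<bar>s ?d\<bar> \<le> \<bar>s l\<bar>" using k by (intro mono) auto
      hence "(s ?d)\<^sup>2 \<le> (s l)\<^sup>2" by (simp only: abs_le_square_iff)
      thus "(s ?d)\<^sup>2 * (c l)\<^sup>2 \<le> (c l * s l)\<^sup>2"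
        by (simp add: power_mult_distrib mult.commute mult_left_mono)
    qed
    have "0 < (\<Sum>k<Suc ?d. (c k)\<^sup>2)"
    proof -
      obtain l where l: "l \<le> ?d" "c l \<noteq> 0" using c(2) by blast
      have "(c l)\<^sup>2 \<le> (\<Sum>k<Suc ?d. (c k)\<^sup>2)" using l by (intro member_le_sum) auto
      moreover have "0 < (c l)\<^sup>2" using l by simp
      ultimately show ?thesis by linarith
    qed
    hence "(s ?d)\<^sup>2 \<le> t\<^sup>2" using order_trans[OF 2 1] by simp
    moreover have "\<bar>s k\<bar> \<le> \<bar>s ?d\<bar>" using k by (intro mono) auto
    hence "(s k)\<^sup>2 \<le> (s ?d)\<^sup>2" by (simp only: abs_le_square_iff)
    ultimately show ?thesis by simp
  qed
  have mvB: "mv n B (u k) i = (if k < ?d then \<bar>s k\<bar> * u k i else 0)" if "k < n" "i < n" for k i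
  proof -
    have "mv n B (u k) i = (\<Sum>j<n. \<Sum>l<?d. (\<bar>s l\<bar> * u l i) * (u l j * u k j))"
      unfolding mv_def
      by (intro sum.cong refl) (use that in \<open>simp add: B sum_distrib_right sum_distrib_left algebra_simps\<close>)
    also have "\<dots> = (\<Sum>l<?d. \<Sum>j<n. (\<bar>s l\<bar> * u l i) * (u l j * u k j))" by (rule sum.swap)
    also have "\<dots> = (\<Sum>l<?d. (\<bar>s l\<bar> * u l i) * ip n (u l) (u k))"
      by (simp add: ip_def sum_distrib_left)
    also have "\<dots> = (\<Sum>l<?d. if l = k then \<bar>s k\<bar> * u k i else 0)"
      using on that dn by (intro sum.cong refl) (auto simp: orthonormal_def)
    finally show ?thesis by simp
  qed
  have mvD: "mv n D (u k) i = mv n B (u k) i - mv n P (u k) i" for k i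
    by (simp add: mv_def D_def algebra_simps sum_subtractf)
  have head: "sqnorm n (mv n D (u k)) \<le> 10 * t\<^sup>2" if k: "k < ?d" for k
  proof -
    have kn: "k < n" using k dn by simp
    have "sqnorm n (mv n D (u k)) =
        sqnorm n (\<lambda>i. (\<bar>s k\<bar> - s k) * u k i + mv n E (u k) i)"
      using k kn eig[OF kn] mvA by (intro ip_cong) (auto simp: mvD mvB algebra_simps)
    also have "\<dots> \<le> 2 * ((\<bar>s k\<bar> - s k)\<^sup>2) + 2 * t\<^sup>2"
      using ip_add_sq_le[of n "\<lambda>i. (\<bar>s k\<bar> - s k) * u k i" "mv n E (u k)"] op[of "u k"] unit[OF kn]
      by (simp add: ip_scale_left ip_scale_right power2_eq_square)
    also have "\<dots> \<le> 10 * t\<^sup>2" using neg[OF kn] by simp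
    finally show ?thesis .
  qed
  \<comment> \<open>An orthonormal basis of the column space of the positions. As P maps into its
    span, the squared norm of P u_k is a sum over the r \<le> d vectors \<open>e l\<close>, and the
    sums over k and l can be exchanged.\<close>
  obtain r e where re: "r \<le> ?d" "orthonormal n r e"
    and col: "\<And>m i. i < n \<Longrightarrow> X i $ m = (\<Sum>l<r. ip n (\<lambda>i. X i $ m) (e l) * e l i)"
    using gram_schmidt_exists[of "UNIV :: 'd set" n "\<lambda>m i. X i $ m"] by auto
  have Pnorm: "sqnorm n (mv n P y) = (\<Sum>l<r. (ip n (mv n P (e l)) y)\<^sup>2)" for y
  proof -
    define a where "a = (\<lambda>l. \<Sum>m\<in>UNIV. (\<Sum>j<n. y j *\<^sub>R X j) $ m * ip n (\<lambda>i. X i $ m) (e l))"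
    have Py: "mv n P y i = (\<Sum>l<r. a l * e l i)" if i: "i < n" for i
    proof -
      have "mv n P y i = inner (X i) (\<Sum>j<n. y j *\<^sub>R X j)"
        by (simp add: mv_def P_def inner_sum_right algebra_simps)
      also have "\<dots> = (\<Sum>m\<in>UNIV. X i $ m * (\<Sum>j<n. y j *\<^sub>R X j) $ m)" by (simp add: inner_vec_def)
      also have "\<dots> = (\<Sum>m\<in>UNIV. (\<Sum>l<r. ip n (\<lambda>i. X i $ m) (e l) * e l i) * (\<Sum>j<n. y j *\<^sub>R X j) $ m)"
        using col[OF i] by simp
      also have "\<dots> = (\<Sum>m\<in>UNIV. \<Sum>l<r. (\<Sum>j<n. y j *\<^sub>R X j) $ m * ip n (\<lambda>i. X i $ m) (e l) * e l i)"
        by (simp add: sum_distrib_right sum_distrib_left algebra_simps)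
      also have "\<dots> = (\<Sum>l<r. a l * e l i)"
        unfolding a_def by (subst sum.swap) (simp add: sum_distrib_right)
      finally show ?thesis .
    qed
    have "ip n (mv n P (e l)) y = a l" if l: "l < r" for l
    proof -
      have "ip n (mv n P (e l)) y = ip n (mv n P y) (e l)"
        using ip_mv_symmetric[of n P "e l" y] P_sym by (metis ip_commute)
      also have "\<dots> = ip n (\<lambda>i. \<Sum>l<r. a l * e l i) (e l)" by (rule ip_cong) (auto simp: Py)
      also have "\<dots> = a l" by (rule orthonormal_coeff[OF re(2) l])
      finally show ?thesis .
    qed
    moreover have "sqnorm n (mv n P y) = (\<Sum>l<r. (a l)\<^sup>2)"
      unfolding orthonormal_norm[OF re(2), symmetric] by (rule ip_cong) (auto simp: Py)
    ultimately show ?thesis by simp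
  qed
  \<comment> \<open>On the tail eigenvectors A acts by factors of size at most \<bar>t\<bar>, and P
    = A - E. Summed over k by Bessel's inequality, both terms on the right are at most 2 t^2 for
    each unit vector \<open>e l\<close>.\<close>
  have Pe: "(ip n (mv n P (e l)) (u k))\<^sup>2 \<le> 2 * t\<^sup>2 * (ip n (e l) (u k))\<^sup>2 + 2 * (ip n (mv n E (e l)) (u k))\<^sup>2"
    if k: "?d \<le> k" "k < n" for l k
  proof -
    have "ip n (mv n P (e l)) (u k) = ip n (\<lambda>i. mv n A (e l) i - mv n E (e l) i) (u k)"
      by (rule ip_cong) (auto simp: mvA)
    also have "\<dots> = ip n (e l) (mv n A (u k)) - ip n (mv n E (e l)) (u k)"
      unfolding ip_diff_left using ip_mv_symmetric[of n A "e l" "u k"] A_sym by simp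
    also have "ip n (e l) (mv n A (u k)) = ip n (e l) (\<lambda>i. s k * u k i)"
      by (rule ip_cong) (auto simp: eig[OF k(2)])
    finally have *: "ip n (mv n P (e l)) (u k) = s k * ip n (e l) (u k) - ip n (mv n E (e l)) (u k)"
      by (simp add: ip_scale_right)
    have "(a - b)\<^sup>2 \<le> 2 * a\<^sup>2 + 2 * b\<^sup>2" for a b :: real
      using zero_le_power2[of "a + b"] unfolding power2_sum power2_diff by linarith
    hence "(ip n (mv n P (e l)) (u k))\<^sup>2 \<le> 2 * (s k * ip n (e l) (u k))\<^sup>2 + 2 * (ip n (mv n E (e l)) (u k))\<^sup>2"
      unfolding * .
    moreover have "(s k * ip n (e l) (u k))\<^sup>2 \<le> t\<^sup>2 * (ip n (e l) (u k))\<^sup>2"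
      unfolding power_mult_distrib using weyl[OF k] by (intro mult_right_mono) auto
    ultimately show ?thesis by linarith
  qed
  have "(\<Sum>k\<in>{?d..<n}. sqnorm n (mv n D (u k))) = (\<Sum>k\<in>{?d..<n}. sqnorm n (mv n P (u k)))"
  proof (intro sum.cong refl)
    fix k assume "k \<in> {?d..<n}"
    hence "sqnorm n (mv n D (u k)) = sqnorm n (\<lambda>i. (-1) * mv n P (u k) i)"
      by (intro ip_cong) (auto simp: mvD mvB)
    thus "sqnorm n (mv n D (u k)) = sqnorm n (mv n P (u k))"
      unfolding ip_scale_left ip_scale_right by simp
  qed
  also have "\<dots> = (\<Sum>l<r. \<Sum>k\<in>{?d..<n}. (ip n (mv n P (e l)) (u k))\<^sup>2)"
    unfolding Pnorm by (rule sum.swap)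
  also have "\<dots> \<le> (\<Sum>l<r. 4 * t\<^sup>2)"
  proof (intro sum_mono)
    fix l assume "l \<in> {..<r}"
    hence l: "sqnorm n (e l) = 1" using re(2) by (simp add: orthonormal_def)
    have "(\<Sum>k\<in>{?d..<n}. (ip n (mv n P (e l)) (u k))\<^sup>2)
      \<le> (\<Sum>k\<in>{?d..<n}. 2 * t\<^sup>2 * (ip n (e l) (u k))\<^sup>2 + 2 * (ip n (mv n E (e l)) (u k))\<^sup>2)"
      by (intro sum_mono Pe) auto
    also have "\<dots> = 2 * t\<^sup>2 * (\<Sum>k\<in>{?d..<n}. (ip n (e l) (u k))\<^sup>2) + 2 * (\<Sum>k\<in>{?d..<n}. (ip n (mv n E (e l)) (u k))\<^sup>2)"
      by (simp add: sum.distrib sum_distrib_left)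
    also have "\<dots> \<le> 2 * t\<^sup>2 * sqnorm n (e l) + 2 * sqnorm n (mv n E (e l))"
      by (intro add_mono mult_left_mono tail) auto
    also have "\<dots> \<le> 4 * t\<^sup>2" using op[of "e l"] l by simp
    finally show "(\<Sum>k\<in>{?d..<n}. (ip n (mv n P (e l)) (u k))\<^sup>2) \<le> 4 * t\<^sup>2" .
  qed
  also have "\<dots> \<le> real ?d * (4 * t\<^sup>2)" using re(1) by (simp add: mult_right_mono)
  finally have tailD: "(\<Sum>k\<in>{?d..<n}. sqnorm n (mv n D (u k))) \<le> real ?d * (4 * t\<^sup>2)" .
  have "(\<Sum>k<?d. sqnorm n (mv n D (u k))) \<le> (\<Sum>k<?d. 10 * t\<^sup>2)"
    by (intro sum_mono head) auto
  hence headD: "(\<Sum>k<?d. sqnorm n (mv n D (u k))) \<le> real ?d * (10 * t\<^sup>2)" by simp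
  have "(\<Sum>i<n. \<Sum>j<n. (D i j)\<^sup>2) = (\<Sum>i<n. \<Sum>k<n. (ip n (D i) (u k))\<^sup>2)"
    unfolding parseval by (simp add: ip_def power2_eq_square)
  also have "\<dots> = (\<Sum>k<n. \<Sum>i<n. (ip n (D i) (u k))\<^sup>2)" by (rule sum.swap)
  also have "\<dots> = (\<Sum>k<n. sqnorm n (mv n D (u k)))"
    by (simp add: ip_def mv_def power2_eq_square)
  also have "\<dots> = (\<Sum>k<?d. sqnorm n (mv n D (u k))) + (\<Sum>k\<in>{?d..<n}. sqnorm n (mv n D (u k)))"
    by (subst sum.union_disjoint[symmetric]) (auto simp: ivl_disj_un dn)
  also have "\<dots> \<le> 14 * real ?d * t\<^sup>2" using headD tailD by simp
  finally show ?thesis by (simp add: D_def P_def)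
qed

text \<open>Inner products of embedded rows undo the square roots: their Gram matrix is the sum of
  \<bar>s_k\<bar> u_k u_k^T over the d leading eigenpairs, from which the labelling of the columns
  and the signs of the eigenvectors have disappeared.\<close>

lemma ase_frobenius:
  fixes X Y :: "nat \<Rightarrow> real ^ 'd"
  assumes A: "A \<in> adj_mats n" and Y: "is_ASE A Y"
    and op: "\<And>y. sqnorm n (mv n (\<lambda>i j. A $$ (i, j) - inner (X i) (X j)) y)
               \<le> t\<^sup>2 * sqnorm n y"
  shows "(\<Sum>i<n. \<Sum>j<n. (inner (Y i) (Y j) - inner (X i) (X j))\<^sup>2) \<le> 14 * real CARD('d) * t\<^sup>2"
proof -
  have dimA: "A \<in> carrier_mat n n" "dim_row A = n" "dim_col A = n" using A by (auto simp: adj_mats_def)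
  have Asym: "A $$ (i, j) = A $$ (j, i)" if "i < n" "j < n" for i j
    using A that by (auto simp: adj_mats_def)
  obtain u s c where Q: "CARD('d) \<le> n" "\<forall>k<n. eigenvector A (u k) (s k)"
      "\<forall>k<n. \<forall>l<n. scalar_prod (u k) (u l) = (if k = l then 1 else 0)"
      "\<forall>k l. k \<le> l \<and> l < n \<longrightarrow> \<bar>s l\<bar> \<le> \<bar>s k\<bar>"
      "bij_betw c (UNIV :: 'd set) {..<CARD('d)}"
      "\<forall>i<n. Y i = (\<chi> m. vec_index (u (c m)) i * sqrt \<bar>s (c m)\<bar>)"
    using Y unfolding is_ASE_def dimA by (elim conjE exE)
  note d = Q(1) and c = Q(5)
  have ev: "eigenvector A (u k) (s k)" if "k < n" for k using Q(2) that by simp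
  have on: "scalar_prod (u k) (u l) = (if k = l then 1 else 0)" if "k < n" "l < n" for k l
    using Q(3) that by simp
  have mono: "\<bar>s l\<bar> \<le> \<bar>s k\<bar>" if "k \<le> l" "l < n" for k l using Q(4) that by simp
  have Yi: "Y i = (\<chi> m. vec_index (u (c m)) i * sqrt \<bar>s (c m)\<bar>)" if "i < n" for i using Q(6) that by simp
  define v where "v = (\<lambda>k i. vec_index (u k) i)"
  have uc: "u k \<in> carrier_vec n" if "k < n" for k using ev[OF that] dimA by (simp add: eigenvector_def)
  have ip: "ip n (v k) (v l) = scalar_prod (u k) (u l)" if "k < n" "l < n" for k l
    using uc[OF that(2)] by (simp add: ip_def v_def scalar_prod_def atLeast0LessThan)
  have ortho: "orthonormal n n v" by (simp add: orthonormal_def ip on)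
  define U where "U = mat n n (\<lambda>(k, i). v k i)"
  have Uc: "U \<in> carrier_mat n n" "transpose_mat U \<in> carrier_mat n n" by (auto simp: U_def)
  \<comment> \<open>Orthonormality of n vectors in dimension n is a one-sided inverse relation; the
    other side is the completeness relation behind Parseval's identity.\<close>
  have "U * transpose_mat U = 1\<^sub>m n"
    using ortho by (intro eq_matI) (auto simp: U_def scalar_prod_def orthonormal_def ip_def atLeast0LessThan)
  hence UtU: "transpose_mat U * U = 1\<^sub>m n" by (rule mat_mult_left_right_inverse[OF Uc])
  have complete: "(\<Sum>k<n. v k i * v k j) = (if i = j then 1 else 0)" if ij: "i < n" "j < n" for i j
  proof -
    have "(transpose_mat U * U) $$ (i, j) = (\<Sum>k<n. v k i * v k j)"
      using ij by (simp add: U_def scalar_prod_def atLeast0LessThan)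
    thus ?thesis unfolding UtU using ij by simp
  qed
  have eig: "mv n (\<lambda>i j. A $$ (i, j)) (v k) i = s k * v k i" if "k < n" "i < n" for k i
  proof -
    have "mv n (\<lambda>i j. A $$ (i, j)) (v k) i = vec_index (A *\<^sub>v u k) i"
      using that uc[OF that(1)] dimA by (simp add: mv_def v_def scalar_prod_def atLeast0LessThan)
    thus ?thesis using ev[OF that(1)] that uc[OF that(1)] by (simp add: eigenvector_def v_def)
  qed
  have B: "inner (Y i) (Y j) = (\<Sum>k<CARD('d). \<bar>s k\<bar> * v k i * v k j)" if "i < n" "j < n" for i j
  proof -
    have "inner (Y i) (Y j) = (\<Sum>m\<in>UNIV. \<bar>s (c m)\<bar> * v (c m) i * v (c m) j)"
      using that by (simp add: inner_vec_def Yi v_def algebra_simps)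
    also have "\<dots> = (\<Sum>k<CARD('d). \<bar>s k\<bar> * v k i * v k j)" by (rule sum.reindex_bij_betw[OF c])
    finally show ?thesis .
  qed
  show ?thesis
    by (rule truncated_eigen_frobenius[where A = "\<lambda>i j. A $$ (i, j)" and u = v and s = s,
          OF _ _ eig ortho complete mono d op B])
       (auto simp: inner_commute Asym)
qed

text \<open>The net: vectors with integer entries, to be scaled by \<open>1 / (2 * sqrt n)\<close>.\<close>

definition int_net :: "nat \<Rightarrow> (nat \<Rightarrow> int) set" where
  "int_net n = {z \<in> {..<n} \<rightarrow>\<^sub>E {- int (7 * n)..int (7 * n)}. (\<Sum>i<n. (z i)\<^sup>2) \<le> int (7 * n)}"

lemma finite_int_net: "finite (int_net n)"
proof -
  have "finite ({..<n} \<rightarrow>\<^sub>E {- int (7 * n)..int (7 * n)})" by (intro finite_PiE) auto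
  thus ?thesis unfolding int_net_def by simp
qed

lemma abs_le_square_int: "\<bar>k\<bar> \<le> k\<^sup>2" for k :: int
proof (cases "k = 0")
  case False
  hence "1 * \<bar>k\<bar> \<le> \<bar>k\<bar> * \<bar>k\<bar>" by (intro mult_right_mono) auto
  thus ?thesis by (simp add: power2_eq_square abs_mult_self_eq)
qed simp

lemma sum_half_powers: "(\<Sum>k\<in>{- int m..int m}. (1 / 2 :: real) ^ nat \<bar>k\<bar>) = 3 - 2 * (1 / 2) ^ m"
proof (induction m)
  case (Suc m)
  have "{- int (Suc m)..int (Suc m)} = insert (int (Suc m)) (insert (- int (Suc m)) {- int m..int m})" by auto
  thus ?case using Suc by (simp add: nat_add_distrib)
qed simp

text \<open>Give an integer vector z the weight 2^(-sum \<bar>z_i\<bar>). Since \<bar>k\<bar> \<le>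
  k^2 on the integers, net points have weight at least 2^(-7n), whereas the total weight factorises
  over coordinates and is at most 3^n. The quotient is (2^7 * 3)^n = 384^n.\<close>

lemma card_int_net: "real (card (int_net n)) \<le> 384 ^ n"
proof -
  let ?P = "{..<n} \<rightarrow>\<^sub>E {- int (7 * n)..int (7 * n)}"
  have finP: "finite ?P" by (intro finite_PiE) auto
  have "1 \<le> 2 ^ (7 * n) * (\<Prod>i<n. (1 / 2 :: real) ^ nat \<bar>z i\<bar>)" if "z \<in> int_net n" for z
  proof -
    have "(\<Sum>i<n. \<bar>z i\<bar>) \<le> (\<Sum>i<n. (z i)\<^sup>2)" by (intro sum_mono abs_le_square_int)
    also have "\<dots> \<le> int (7 * n)" using that by (simp add: int_net_def)
    finally have "int (\<Sum>i<n. nat \<bar>z i\<bar>) \<le> int (7 * n)" by simp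
    hence "(\<Sum>i<n. nat \<bar>z i\<bar>) \<le> 7 * n" by (simp only: of_nat_le_iff)
    hence "(1 / 2 :: real) ^ (7 * n) \<le> (1 / 2) ^ (\<Sum>i<n. nat \<bar>z i\<bar>)" by (intro power_decreasing) auto
    also have "\<dots> = (\<Prod>i<n. (1 / 2 :: real) ^ nat \<bar>z i\<bar>)" by (simp add: power_sum)
    finally show ?thesis by (simp add: power_one_over field_simps)
  qed
  hence "(\<Sum>z\<in>int_net n. 1) \<le> (\<Sum>z\<in>int_net n. 2 ^ (7 * n) * (\<Prod>i<n. (1 / 2 :: real) ^ nat \<bar>z i\<bar>))"
    by (intro sum_mono) auto
  also have "\<dots> \<le> (\<Sum>z\<in>?P. 2 ^ (7 * n) * (\<Prod>i<n. (1 / 2 :: real) ^ nat \<bar>z i\<bar>))"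
  proof (rule sum_mono2[OF finP])
    show "int_net n \<subseteq> ?P" unfolding int_net_def by (rule Collect_restrict)
    show "0 \<le> 2 ^ (7 * n) * (\<Prod>i<n. (1 / 2 :: real) ^ nat \<bar>z i\<bar>)" for z :: "nat \<Rightarrow> int"
      by (rule mult_nonneg_nonneg) (simp_all add: prod_nonneg)
  qed
  also have "\<dots> = 2 ^ (7 * n) * (\<Prod>i<n. \<Sum>k\<in>{- int (7 * n)..int (7 * n)}. (1 / 2 :: real) ^ nat \<bar>k\<bar>)"
    unfolding sum_distrib_left[symmetric] by (subst prod_sum_PiE) auto
  also have "\<dots> = 2 ^ (7 * n) * (3 - 2 * (1 / 2) ^ (7 * n)) ^ n" unfolding sum_half_powers by simp
  also have "\<dots> \<le> 2 ^ (7 * n) * 3 ^ n"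
  proof -
    have "(1 / 2 :: real) ^ (7 * n) \<le> 1" by (rule power_le_one) auto
    thus ?thesis by (intro mult_left_mono power_mono) auto
  qed
  also have "\<dots> = 384 ^ n" by (simp add: power_mult flip: power_mult_distrib)
  finally show ?thesis by simp
qed

text \<open>Let K be the supremum of the bilinear form over pairs of unit vectors. Rounding both
  arguments to the scaled net gives the self-bounding inequality K \<le> T / (4n) + 9/16 K. It is
  informative only because K is finite, which a crude entrywise bound provides.\<close>

lemma op_bound_of_net:
  fixes E :: "nat \<Rightarrow> nat \<Rightarrow> real"
  assumes n: "0 < n" and T: "0 \<le> T"
    and net: "\<And>z z'. z \<in> int_net n \<Longrightarrow> z' \<in> int_net n \<Longrightarrow>
                ip n (\<lambda>i. of_int (z i)) (mv n E (\<lambda>i. of_int (z' i))) \<le> T"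
  shows "sqnorm n (mv n E y) \<le> (T / real n)\<^sup>2 * sqnorm n y"
proof -
  define V where "V = {ip n x (mv n E y) | x y. sqnorm n x \<le> 1 \<and> sqnorm n y \<le> 1}"
  have mv_scale: "mv n E (\<lambda>i. a * y i) = (\<lambda>i. a * mv n E y i)" for a y
    by (auto simp: mv_def sum_distrib_left mult_ac)
  have mv_diff: "mv n E (\<lambda>i. x i - y i) = (\<lambda>i. mv n E x i - mv n E y i)" for x y
    by (auto simp: mv_def algebra_simps sum_subtractf)
  have coord: "\<bar>x i\<bar> \<le> 1" if "sqnorm n x \<le> 1" "i < n" for x i
  proof -
    have "x i * x i \<le> sqnorm n x" unfolding ip_def using that by (intro member_le_sum) auto
    hence "(x i)\<^sup>2 \<le> 1" using that(1) by (simp add: power2_eq_square)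
    thus ?thesis by (simp add: abs_square_le_1)
  qed
  have bdd: "bdd_above V"
  proof (rule bdd_aboveI)
    fix v assume "v \<in> V"
    then obtain x y where xy: "v = ip n x (mv n E y)" "sqnorm n x \<le> 1" "sqnorm n y \<le> 1" by (auto simp: V_def)
    have "v = (\<Sum>i<n. \<Sum>j<n. x i * (E i j * y j))" by (simp add: xy ip_def mv_def sum_distrib_left)
    also have "\<dots> \<le> (\<Sum>i<n. \<Sum>j<n. \<bar>E i j\<bar>)"
    proof (intro sum_mono)
      fix i j assume ij: "i \<in> {..<n}" "j \<in> {..<n}"
      have "x i * (E i j * y j) \<le> \<bar>x i\<bar> * (\<bar>E i j\<bar> * \<bar>y j\<bar>)"
        by (metis abs_ge_self abs_mult)
      also have "\<dots> \<le> 1 * (\<bar>E i j\<bar> * 1)" using coord xy ij by (intro mult_mono mult_left_mono) auto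
      finally show "x i * (E i j * y j) \<le> \<bar>E i j\<bar>" by simp
    qed
    finally show "v \<le> (\<Sum>i<n. \<Sum>j<n. \<bar>E i j\<bar>)" .
  qed
  define K where "K = Sup V"
  have ub: "ip n x (mv n E y) \<le> K" if "sqnorm n x \<le> 1" "sqnorm n y \<le> 1" for x y
    unfolding K_def using that by (intro cSup_upper bdd) (auto simp: V_def)
  have K0: "0 \<le> K" using ub[of "\<lambda>_. 0" "\<lambda>_. 0"] by (simp add: ip_def mv_def)
  have scaled: "ip n x (mv n E y) \<le> a * b * K" if "0 < a" "0 < b" "sqnorm n x \<le> a\<^sup>2" "sqnorm n y \<le> b\<^sup>2" for x y a b
  proof -
    have "ip n (\<lambda>i. (1 / a) * x i) (mv n E (\<lambda>i. (1 / b) * y i)) \<le> K"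
      using that by (intro ub; unfold ip_scale_left ip_scale_right) (simp_all add: field_simps power2_eq_square)
    thus ?thesis unfolding mv_scale ip_scale_left ip_scale_right using that by (simp add: field_simps)
  qed
  have round: "\<exists>z\<in>int_net n. sqnorm n (\<lambda>i. x i - of_int (z i) / (2 * sqrt n)) \<le> (1/4)\<^sup>2
        \<and> sqnorm n (\<lambda>i. of_int (z i) / (2 * sqrt n)) \<le> (5/4)\<^sup>2"
    if x: "sqnorm n x \<le> 1" for x
  proof -
    define z where "z = (\<lambda>i\<in>{..<n}. round (2 * sqrt n * x i))"
    define x' where "x' = (\<lambda>i. of_int (z i) / (2 * sqrt n))"
    define w where "w = (\<lambda>i. x' i - x i)"
    have sn: "0 < sqrt n" using n by simp
    have wi: "w i * w i \<le> 1 / (16 * real n)" if "i < n" for i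
    proof -
      have "\<bar>of_int (z i) - 2 * sqrt n * x i\<bar> \<le> 1 / 2" using that of_int_round_abs_le[of "2 * sqrt n * x i"] by (simp only: z_def restrict_apply lessThan_iff if_True)
      moreover have "of_int (z i) - 2 * sqrt n * x i = 2 * sqrt n * w i" using sn by (simp add: w_def x'_def field_simps)
      ultimately have "\<bar>2 * sqrt n * w i\<bar> \<le> \<bar>1 / 2\<bar>" by simp
      hence "(2 * sqrt n * w i)\<^sup>2 \<le> (1 / 2)\<^sup>2" by (simp only: abs_le_square_iff)
      hence "4 * real n * (w i)\<^sup>2 \<le> 1 / 4" by (simp add: power_mult_distrib power_one_over)
      hence "4 * real n * (w i * w i) \<le> 1 / 4" by (simp add: power2_eq_square)
      thus ?thesis using n by (simp add: field_simps)
    qed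
    have "sqnorm n w \<le> (\<Sum>i<n. 1 / (16 * real n))" unfolding ip_def by (intro sum_mono wi) auto
    hence ww: "sqnorm n w \<le> (1/4)\<^sup>2" using n by (simp add: power2_eq_square)
    have "(ip n x w)\<^sup>2 \<le> 1 * (1/4)\<^sup>2"
      using ip_Cauchy_Schwarz[of n x w] mult_mono[OF x ww] by simp
    hence "ip n x w \<le> 1/4" using abs_le_square_iff[of "ip n x w" "1/4"] by simp
    moreover have "sqnorm n x' = sqnorm n (\<lambda>i. x i + w i)" by (simp add: w_def)
    hence "sqnorm n x' = sqnorm n x + 2 * ip n x w + sqnorm n w"
      unfolding ip_add_left ip_add_right by (simp add: ip_commute)
    ultimately have x': "sqnorm n x' \<le> (5/4)\<^sup>2" using x ww by (simp add: power2_eq_square)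
    \<comment> \<open>Rounding at resolution 1 / (2 sqrt n) moves a unit vector by at most 1/4, so
      the integer vector has squared norm at most 4n (5/4)^2 = 6.25 n. This is where 7n in the net
      comes from.\<close>
    have "of_int (\<Sum>i<n. (z i)\<^sup>2) = 4 * real n * sqnorm n x'"
      using n by (simp add: x'_def ip_def power2_eq_square sum_distrib_left)
    also have "\<dots> \<le> 4 * real n * (5/4)\<^sup>2" using x' by (intro mult_left_mono) auto
    also have "\<dots> \<le> of_int (int (7 * n))" by (simp add: power2_eq_square)
    finally have zz: "(\<Sum>i<n. (z i)\<^sup>2) \<le> int (7 * n)" by (simp only: of_int_le_iff)
    have "\<bar>z i\<bar> \<le> int (7 * n)" if "i < n" for i
    proof -
      have "(z i)\<^sup>2 \<le> (\<Sum>i<n. (z i)\<^sup>2)" using that by (intro member_le_sum) auto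
      thus ?thesis using abs_le_square_int[of "z i"] zz by linarith
    qed
    hence "z i \<in> {- int (7 * n)..int (7 * n)}" if "i < n" for i
      using that by (simp only: abs_le_iff atLeastAtMost_iff minus_le_iff)
    hence zP: "z \<in> {..<n} \<rightarrow>\<^sub>E {- int (7 * n)..int (7 * n)}"
      by (intro PiE_I) (simp_all add: z_def)
    have "sqnorm n (\<lambda>i. x i - x' i) = sqnorm n w"
      by (simp add: ip_def w_def algebra_simps)
    hence "z \<in> int_net n" "sqnorm n (\<lambda>i. x i - x' i) \<le> (1/4)\<^sup>2"
      using zP zz ww by (auto simp: int_net_def)
    thus ?thesis using x' unfolding x'_def by blast
  qed
  have "K \<le> T / (4 * real n) + 9 / 16 * K"
    unfolding K_def
  proof (rule cSup_least)
    show "V \<noteq> {}" unfolding V_def by (auto intro!: exI[of _ "\<lambda>_. 0"] simp: ip_def)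
    fix v assume "v \<in> V"
    then obtain x y where xy: "v = ip n x (mv n E y)" "sqnorm n x \<le> 1" "sqnorm n y \<le> 1" by (auto simp: V_def)
    obtain z where z: "z \<in> int_net n"
      "sqnorm n (\<lambda>i. x i - of_int (z i) / (2 * sqrt n)) \<le> (1/4)\<^sup>2"
      "sqnorm n (\<lambda>i. of_int (z i) / (2 * sqrt n)) \<le> (5/4)\<^sup>2"
      using round[OF xy(2)] by blast
    obtain z' where z': "z' \<in> int_net n"
      "sqnorm n (\<lambda>i. y i - of_int (z' i) / (2 * sqrt n)) \<le> (1/4)\<^sup>2"
      using round[OF xy(3)] by blast
    let ?x = "\<lambda>i. of_int (z i) / (2 * sqrt n)" and ?y = "\<lambda>i. of_int (z' i) / (2 * sqrt n)"
    \<comment> \<open>The two error terms pair a remainder of norm 1/4 with a unit vector, and a net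
      point of norm at most 5/4 with a remainder of norm 1/4: 1/4 + 5/16 = 9/16.\<close>
    have "v = ip n ?x (mv n E ?y) + ip n (\<lambda>i. x i - ?x i) (mv n E y) + ip n ?x (mv n E (\<lambda>i. y i - ?y i))"
      unfolding mv_diff ip_diff_left ip_diff_right xy by simp
    also have "ip n ?x (mv n E ?y) = (1 / (4 * real n)) * ip n (\<lambda>i. of_int (z i)) (mv n E (\<lambda>i. of_int (z' i)))"
    proof -
      have "?x = (\<lambda>i. (1 / (2 * sqrt n)) * of_int (z i))" "?y = (\<lambda>i. (1 / (2 * sqrt n)) * of_int (z' i))" by auto
      thus ?thesis by (simp only: mv_scale ip_scale_left ip_scale_right) (simp add: field_simps)
    qed
    also have "\<dots> \<le> (1 / (4 * real n)) * T" by (intro mult_left_mono net z z') auto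
    also have "ip n (\<lambda>i. x i - ?x i) (mv n E y) \<le> 1/4 * 1 * K" using z xy by (intro scaled) auto
    also have "ip n ?x (mv n E (\<lambda>i. y i - ?y i)) \<le> 5/4 * (1/4) * K" using z z' by (intro scaled) auto
    finally have "v \<le> T / (4 * real n) + 9 / 16 * K" by simp
    thus "v \<le> T / (4 * real n) + 9 / 16 * Sup V" by (simp add: K_def)
  qed
  hence "K \<le> 4 / 7 * (T / n)" by simp
  moreover have "0 \<le> T / n" using T by simp
  ultimately have KT: "K \<le> T / n" by linarith
  define w where "w = mv n E y"
  show ?thesis
  proof (cases "sqnorm n y = 0 \<or> sqnorm n w = 0")
    case True
    have "sqnorm n w = 0"
    proof (cases "sqnorm n w = 0")
      case False
      with True have "y i = 0" if "i < n" for i using ip_self_eq_0[of n y] that by blast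
      hence "w = (\<lambda>_. 0)" by (simp add: w_def mv_def)
      thus ?thesis by (simp add: ip_def)
    qed
    thus ?thesis by (simp add: w_def)
  next
    case False
    hence p: "0 < sqnorm n y" "0 < sqnorm n w" using ip_nonneg[of n y] ip_nonneg[of n w] by linarith+
    define a where "a = sqrt (sqnorm n w)"
    define b where "b = sqrt (sqnorm n y)"
    have ab: "0 < a" "0 < b" "a\<^sup>2 = sqnorm n w" "b\<^sup>2 = sqnorm n y" using p by (auto simp: a_def b_def)
    \<comment> \<open>Testing the form at E y itself turns the bilinear bound into a bound on the
      norm of E y.\<close>
    have "ip n w (mv n E y) \<le> a * b * K" using ab by (intro scaled) auto
    hence "a * a \<le> a * (b * K)" using ab by (simp add: w_def power2_eq_square algebra_simps)
    hence "a \<le> b * K" using ab by simp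
    also have "\<dots> \<le> b * (T / n)" using KT ab by (intro mult_left_mono) auto
    finally have "a\<^sup>2 \<le> (b * (T / n))\<^sup>2" using ab by (intro power_mono) auto
    hence "sqnorm n w \<le> sqnorm n y * (T / n)\<^sup>2" unfolding power_mult_distrib ab .
    thus ?thesis by (simp only: w_def mult.commute)
  qed
qed

section \<open>Concentration of the edge noise\<close>

definition edge_set :: "nat \<Rightarrow> (nat \<times> nat) set" where
  "edge_set n = {(i, j). i < j \<and> j < n}"

lemma finite_edge_set [simp]: "finite (edge_set n)"
  by (rule finite_subset[of _ "{..<n} \<times> {..<n}"]) (auto simp: edge_set_def)

lemma sum_offdiag:
  fixes g :: "nat \<Rightarrow> nat \<Rightarrow> 'a :: comm_monoid_add"
  shows "(\<Sum>i<n. \<Sum>j<n. if i \<noteq> j then g i j else 0) = (\<Sum>(i, j)\<in>edge_set n. g i j + g j i)"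
proof -
  have swap: "prod.swap ` edge_set n = {(i, j). j < i \<and> i < n}"
    by (auto simp: edge_set_def image_def)
  have "(\<Sum>i<n. \<Sum>j<n. if i \<noteq> j then g i j else 0)
      = (\<Sum>z\<in>{..<n} \<times> {..<n}. if fst z \<noteq> snd z then g (fst z) (snd z) else 0)"
    by (simp add: sum.cartesian_product case_prod_beta)
  also have "\<dots> = (\<Sum>z\<in>edge_set n \<union> prod.swap ` edge_set n. g (fst z) (snd z))"
    unfolding swap by (rule sum.mono_neutral_cong_right) (auto simp: edge_set_def)
  also have "\<dots> = (\<Sum>z\<in>edge_set n. g (fst z) (snd z)) + (\<Sum>z\<in>prod.swap ` edge_set n. g (fst z) (snd z))"
    by (rule sum.union_disjoint[OF finite_edge_set finite_imageI[OF finite_edge_set]])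
       (unfold swap, auto simp: edge_set_def)
  also have "(\<Sum>z\<in>prod.swap ` edge_set n. g (fst z) (snd z)) = (\<Sum>z\<in>edge_set n. g (snd z) (fst z))"
    by (subst sum.reindex) auto
  finally show ?thesis by (simp add: sum.distrib case_prod_beta)
qed

text \<open>Hoeffding's inequality for the weighted indicators, each of which lies between min 0 (a
  p) and max 0 (a p), an interval of length \<bar>a p\<bar>.\<close>

lemma bernoulli_product_tail:
  fixes a :: "'a \<Rightarrow> real" and q :: "'a \<Rightarrow> real"
  assumes I: "finite I" and q: "\<And>p. p \<in> I \<Longrightarrow> 0 \<le> q p \<and> q p \<le> 1"
    and T: "0 < T" and S: "(\<Sum>p\<in>I. (a p)\<^sup>2) \<le> S" "0 < S"
  shows "measure_pmf.prob (Pi_pmf I False (\<lambda>p. bernoulli_pmf (q p)))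
           {e. T \<le> (\<Sum>p\<in>I. a p * (of_bool (e p) - q p))} \<le> exp (- 2 * T\<^sup>2 / S)"
proof -
  let ?M = "Pi_pmf I False (\<lambda>p. bernoulli_pmf (q p))"
  define Y where "Y = (\<lambda>p e. a p * of_bool (e p :: bool))"
  define lo where "lo = (\<lambda>p. min 0 (a p))"
  define hi where "hi = (\<lambda>p. max 0 (a p))"
  have hl: "(hi p - lo p)\<^sup>2 = (a p)\<^sup>2" for p by (auto simp: hi_def lo_def min_def max_def)
  have ex: "measure_pmf.expectation ?M (Y p) = a p * q p" if p: "p \<in> I" for p
  proof -
    have "measure_pmf.expectation ?M (Y p) =
        measure_pmf.expectation (map_pmf (\<lambda>e. e p) ?M) (\<lambda>b. a p * of_bool b)"
      by (simp add: Y_def)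
    also have "map_pmf (\<lambda>e. e p) ?M = bernoulli_pmf (q p)" using p I by (simp add: Pi_pmf_component)
    finally show ?thesis using q[OF p] by simp
  qed
  interpret H: Hoeffding_ineq "measure_pmf ?M" I Y lo hi "\<Sum>p\<in>I. measure_pmf.expectation ?M (Y p)"
  proof (unfold_locales)
    show "finite I" by (rule I)
    have "prob_space.indep_vars (measure_pmf ?M) (\<lambda>_. borel) (\<lambda>p. (\<lambda>b. a p * of_bool b) \<circ> (\<lambda>e. e p)) I"
      by (rule prob_space.indep_vars_compose[OF measure_pmf.prob_space_axioms indep_vars_Pi_pmf[OF I]]) auto
    thus "prob_space.indep_vars (measure_pmf ?M) (\<lambda>_. borel) Y I" by (simp add: Y_def comp_def)
    show "AE e in measure_pmf ?M. Y p e \<in> {lo p..hi p}" if "p \<in> I" for p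
      by (auto simp: Y_def lo_def hi_def)
  qed simp
  have eq: "{e. T \<le> (\<Sum>p\<in>I. a p * (of_bool (e p) - q p))} =
      {e \<in> space (measure_pmf ?M). (\<Sum>p\<in>I. Y p e) \<ge> (\<Sum>p\<in>I. measure_pmf.expectation ?M (Y p)) + T}"
  proof -
    have "(\<Sum>p\<in>I. measure_pmf.expectation ?M (Y p)) = (\<Sum>p\<in>I. a p * q p)"
      by (intro sum.cong refl ex)
    thus ?thesis by (simp add: Y_def algebra_simps sum_subtractf)
  qed
  show ?thesis
  \<comment> \<open>Hoeffding's inequality divides by the sum of squares. If that sum is 0, all
    weights vanish and the event is empty because T > 0.\<close>
  proof (cases "(\<Sum>p\<in>I. (a p)\<^sup>2) > 0")
    case True
    have "measure_pmf.prob ?M {e. T \<le> (\<Sum>p\<in>I. a p * (of_bool (e p) - q p))}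
        \<le> exp (- 2 * T\<^sup>2 / (\<Sum>p\<in>I. (hi p - lo p)\<^sup>2))"
      unfolding eq by (rule H.Hoeffding_ineq_ge) (use T True in \<open>auto simp: hl\<close>)
    also have "\<dots> \<le> exp (- 2 * T\<^sup>2 / S)"
      unfolding hl exp_le_cancel_iff using True S by (simp add: frac_le)
    finally show ?thesis .
  next
    case False
    moreover have "0 \<le> (\<Sum>p\<in>I. (a p)\<^sup>2)" by (intro sum_nonneg) auto
    ultimately have "(\<Sum>p\<in>I. (a p)\<^sup>2) = 0" by simp
    hence "\<forall>p\<in>I. a p = 0" using I by (simp add: sum_nonneg_eq_0_iff)
    hence "{e. T \<le> (\<Sum>p\<in>I. a p * (of_bool (e p) - q p))} = {}" using T by simp
    thus ?thesis by simp
  qed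
qed

text \<open>The union bound runs over pairs of net points against a tail exp (-20 n) per pair. Since
  384^2 \<le> 2^19 \<le> e^19, one factor exp (-n) survives.\<close>

lemma exp_net_bound: "(384 ^ n)\<^sup>2 * exp (- 20 * real n) \<le> exp (- real n)"
proof -
  have "(2 :: real) ^ 19 \<le> exp 1 ^ 19"
    using exp_ge_add_one_self[of "1 :: real"] by (intro power_mono) auto
  hence "(384 :: real)\<^sup>2 \<le> exp 19" by (simp flip: exp_of_nat_mult)
  hence "((384 :: real)\<^sup>2) ^ n \<le> exp 19 ^ n" by (intro power_mono) auto
  hence "(384 ^ n)\<^sup>2 \<le> exp (19 * real n)"
    by (simp only: power_mult[symmetric] mult.commute exp_of_nat_mult[symmetric])
  hence "(384 ^ n)\<^sup>2 * exp (- 20 * real n) \<le> exp (19 * real n) * exp (- 20 * real n)"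
    by (intro mult_right_mono) auto
  also have "\<dots> = exp (- real n)" by (simp flip: exp_add)
  finally show ?thesis .
qed

text \<open>The noise is centred only off the diagonal: on it the adjacency matrix is 0 and the
  difference is -\<bar>X_i\<bar>^2, in [-1, 0]. The net argument bounds the off-diagonal part by 32
  sqrt n, and the diagonal part has norm at most 1. With the factor 2 from squaring a sum, 2 * 1024
  n + 2 \<le> 2050 n.\<close>

lemma edge_noise_op_bound:
  fixes X :: "nat \<Rightarrow> real ^ 'd"
  assumes n: "0 < n" and X: "\<And>i j. i < n \<Longrightarrow> j < n \<Longrightarrow> 0 \<le> inner (X i) (X j) \<and> inner (X i) (X j) \<le> 1"
  defines "E \<equiv> \<lambda>e i j. adj_of_edges n e $$ (i, j) - inner (X i) (X j)"
  shows "measure_pmf.prob (edge_pmf n X)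
           {e. \<not> (\<forall>y. sqnorm n (mv n (E e) y) \<le> 2050 * real n * sqnorm n y)} \<le> exp (- real n)"
proof -
  define q where "q = (\<lambda>i j. inner (X i) (X j))"
  define E0 where "E0 = (\<lambda>e i j. if i \<noteq> j then of_bool (e (min i j, max i j)) - q i j else 0)"
  define T where "T = 32 * real n * sqrt (real n)"
  \<comment> \<open>Each edge variable occupies two entries of the symmetric noise matrix, so its
    coefficient collects both; the sum is then over independent variables.\<close>
  define a where "a = (\<lambda>(z :: nat \<Rightarrow> int) (z' :: nat \<Rightarrow> int) p. real_of_int (z (fst p) * z' (snd p) + z (snd p) * z' (fst p)))"
  have T0: "0 < T" using n by (simp add: T_def)
  have T2: "T\<^sup>2 = 1024 * real n ^ 3" by (simp add: T_def power_mult_distrib power2_eq_square power3_eq_cube)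
  have q_sym: "q i j = q j i" for i j by (simp add: q_def inner_commute)
  have pmf: "edge_pmf n X = Pi_pmf (edge_set n) False (\<lambda>p. bernoulli_pmf (q (fst p) (snd p)))"
    unfolding edge_pmf_def edge_set_def[symmetric]
  proof (rule Pi_pmf_cong[OF refl refl])
    fix p assume "p \<in> edge_set n"
    thus "(case p of (i, j) \<Rightarrow> bernoulli_pmf (max 0 (min 1 (inner (X i) (X j))))) = bernoulli_pmf (q (fst p) (snd p))"
      using X[of "fst p" "snd p"] by (auto simp: edge_set_def q_def)
  qed
  define W where "W = (\<lambda>z z' e. \<Sum>p\<in>edge_set n. a z z' p * (of_bool (e p) - q (fst p) (snd p)))"
  have form: "ip n (\<lambda>i. of_int (z i)) (mv n (E0 e) (\<lambda>i. of_int (z' i)))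
      = W z z' e" for z z' e
  proof -
    have "ip n (\<lambda>i. of_int (z i)) (mv n (E0 e) (\<lambda>i. of_int (z' i)))
       = (\<Sum>i<n. \<Sum>j<n. if i \<noteq> j then real_of_int (z i * z' j) * (of_bool (e (min i j, max i j)) - q i j) else 0)"
      unfolding ip_def mv_def sum_distrib_left by (intro sum.cong refl) (auto simp: E0_def)
    also have "\<dots> = (\<Sum>(i, j)\<in>edge_set n. real_of_int (z i * z' j) * (of_bool (e (min i j, max i j)) - q i j)
         + real_of_int (z j * z' i) * (of_bool (e (min j i, max j i)) - q j i))"
      by (rule sum_offdiag)
    also have "\<dots> = W z z' e"
      unfolding W_def by (intro sum.cong refl) (auto simp: edge_set_def a_def q_sym algebra_simps)
    finally show ?thesis .
  qed
  have asq: "(\<Sum>p\<in>edge_set n. (a z z' p)\<^sup>2) \<le> 98 * (real n)\<^sup>2" if z: "z \<in> int_net n" "z' \<in> int_net n" for z z'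
  proof -
    have "(\<Sum>p\<in>edge_set n. (a z z' p)\<^sup>2)
      \<le> (\<Sum>(i, j)\<in>edge_set n. 2 * (real_of_int (z i * z' j))\<^sup>2 + 2 * (real_of_int (z j * z' i))\<^sup>2)"
    proof (intro sum_mono)
      fix p
      have "(x + y)\<^sup>2 \<le> 2 * x\<^sup>2 + 2 * y\<^sup>2" for x y :: real
        using zero_le_power2[of "x - y"] unfolding power2_sum power2_diff by linarith
      thus "(a z z' p)\<^sup>2 \<le> (case p of (i, j) \<Rightarrow> 2 * (real_of_int (z i * z' j))\<^sup>2 + 2 * (real_of_int (z j * z' i))\<^sup>2)"
        unfolding a_def of_int_add case_prod_beta .
    qed
    also have "\<dots> = (\<Sum>i<n. \<Sum>j<n. if i \<noteq> j then 2 * (real_of_int (z i * z' j))\<^sup>2 else 0)"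
      by (rule sum_offdiag[symmetric])
    also have "\<dots> \<le> (\<Sum>i<n. \<Sum>j<n. 2 * (real_of_int (z i * z' j))\<^sup>2)" by (intro sum_mono) auto
    also have "\<dots> = 2 * real_of_int ((\<Sum>i<n. (z i)\<^sup>2) * (\<Sum>j<n. (z' j)\<^sup>2))"
      unfolding sum_product by (simp add: sum_distrib_left power_mult_distrib)
    also have "\<dots> \<le> 2 * real_of_int (int (7 * n) * int (7 * n))"
    proof -
      have "(\<Sum>i<n. (z i)\<^sup>2) * (\<Sum>j<n. (z' j)\<^sup>2) \<le> int (7 * n) * int (7 * n)"
        by (rule mult_mono) (use z in \<open>simp_all add: int_net_def sum_nonneg\<close>)
      thus ?thesis by (simp only: of_int_le_iff mult_le_cancel_left_pos zero_less_numeral)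
    qed
    finally show ?thesis by (simp add: power2_eq_square)
  qed
  have tail: "measure_pmf.prob (edge_pmf n X)
      {e. T \<le> W z z' e} \<le> exp (- 20 * real n)"
    if z: "z \<in> int_net n" "z' \<in> int_net n" for z z'
  proof -
    have "measure_pmf.prob (edge_pmf n X)
      {e. T \<le> W z z' e} \<le> exp (- 2 * T\<^sup>2 / (98 * (real n)\<^sup>2))"
      unfolding pmf W_def using n X by (intro bernoulli_product_tail finite_edge_set asq z T0) (auto simp: edge_set_def q_def)
    \<comment> \<open>2 * 1024 / 98 exceeds 20. The 98 is 2 * 7^2, from the squared norms of two net
      points and the factor lost in squaring a sum.\<close>
    also have "- 2 * T\<^sup>2 / (98 * (real n)\<^sup>2) \<le> - 20 * real n"
      unfolding T2 using n by (simp add: power2_eq_square power3_eq_cube field_simps)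
    finally show ?thesis by simp
  qed
  have good: "sqnorm n (mv n (E e) y) \<le> 2050 * real n * sqnorm n y"
    if e: "\<And>z z'. z \<in> int_net n \<Longrightarrow> z' \<in> int_net n \<Longrightarrow>
       W z z' e \<le> T" for e y
  proof -
    have 1: "sqnorm n (mv n (E0 e) y) \<le> (T / real n)\<^sup>2 * sqnorm n y"
      using n T0 e by (intro op_bound_of_net) (auto simp: form)
    have 2: "mv n (E e) y i = mv n (E0 e) y i + (- q i i) * y i" if i: "i < n" for i
    proof -
      have "E e i j = E0 e i j + (if j = i then - q i i else 0)" if "j < n" for j
        using that i by (auto simp: E_def E0_def q_def adj_of_edges_def)
      hence "mv n (E e) y i = (\<Sum>j<n. E0 e i j * y j + (if j = i then - q i i * y i else 0))"
        unfolding mv_def by (intro sum.cong refl) (auto simp: algebra_simps)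
      thus ?thesis using i by (simp add: sum.distrib mv_def)
    qed
    \<comment> \<open>The diagonal correction: entries of modulus at most 1 do not increase the
      norm.\<close>
    have "sqnorm n (\<lambda>i. (- q i i) * y i) \<le> sqnorm n y"
      unfolding ip_def
    proof (intro sum_mono)
      fix i assume "i \<in> {..<n}"
      hence "0 \<le> q i i" "q i i \<le> 1" using X by (auto simp: q_def)
      hence "(q i i * q i i) * (y i * y i) \<le> 1 * (y i * y i)"
        by (intro mult_right_mono) (auto simp: mult_le_one)
      thus "(- q i i) * y i * ((- q i i) * y i) \<le> y i * y i" by (simp add: algebra_simps)
    qed
    moreover have "sqnorm n (mv n (E e) y) = sqnorm n (\<lambda>i. mv n (E0 e) y i + (- q i i) * y i)"
      by (rule ip_cong) (auto simp: 2)
    moreover have "(T / real n)\<^sup>2 = 1024 * real n" using n by (simp add: T_def power_mult_distrib)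
    moreover have "1 * sqnorm n y \<le> real n * sqnorm n y" using n by (intro mult_right_mono) auto
    ultimately show ?thesis
      using ip_add_sq_le[of n "mv n (E0 e) y" "\<lambda>i. (- q i i) * y i"] 1 by (simp add: algebra_simps)
  qed
  define bad where "bad = (\<lambda>zz. {e. T \<le> W (fst zz) (snd zz) e})"
  have "{e. \<not> (\<forall>y. sqnorm n (mv n (E e) y) \<le> 2050 * real n * sqnorm n y)}
      \<subseteq> (\<Union>zz\<in>int_net n \<times> int_net n. bad zz)"
  proof
    fix e assume "e \<in> {e. \<not> (\<forall>y. sqnorm n (mv n (E e) y) \<le> 2050 * real n * sqnorm n y)}"
    then obtain z z' where "z \<in> int_net n" "z' \<in> int_net n"
      "\<not> W z z' e \<le> T"
      using good[of e] by blast
    thus "e \<in> (\<Union>zz\<in>int_net n \<times> int_net n. bad zz)"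
      by (intro UN_I[of "(z, z')"]) (auto simp: bad_def)
  qed
  hence "measure_pmf.prob (edge_pmf n X) {e. \<not> (\<forall>y. sqnorm n (mv n (E e) y) \<le> 2050 * real n * sqnorm n y)}
      \<le> measure_pmf.prob (edge_pmf n X) (\<Union>zz\<in>int_net n \<times> int_net n. bad zz)"
    by (intro measure_pmf.finite_measure_mono) auto
  also have "\<dots> \<le> (\<Sum>zz\<in>int_net n \<times> int_net n. measure_pmf.prob (edge_pmf n X) (bad zz))"
    by (intro measure_pmf.finite_measure_subadditive_finite) (auto simp: finite_int_net)
  also have "\<dots> \<le> (\<Sum>zz\<in>int_net n \<times> int_net n. exp (- 20 * real n))"
    unfolding bad_def by (intro sum_mono tail) auto
  also have "\<dots> = (real (card (int_net n)))\<^sup>2 * exp (- 20 * real n)"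
    by (simp add: card_cartesian_product power2_eq_square)
  also have "\<dots> \<le> (384 ^ n)\<^sup>2 * exp (- 20 * real n)"
    by (intro mult_right_mono power_mono card_int_net) auto
  also have "\<dots> \<le> exp (- real n)" by (rule exp_net_bound)
  finally show ?thesis .
qed

section \<open>Empirical measures and dyadic cells\<close>

abbreviation iid :: "nat \<Rightarrow> 'a measure \<Rightarrow> (nat \<Rightarrow> 'a) measure" where
  "iid n M \<equiv> Pi\<^sub>M {..<n} (\<lambda>_. M)"

definition cell_index :: "nat \<Rightarrow> real ^ 'd \<Rightarrow> 'd \<Rightarrow> int" where
  "cell_index k x = (\<lambda>m. \<lfloor>2 ^ k * vec_nth x m\<rfloor>)"

definition cell :: "nat \<Rightarrow> ('d \<Rightarrow> int) \<Rightarrow> (real ^ 'd) set" where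
  "cell k v = {x. cell_index k x = v}"

definition corner :: "nat \<Rightarrow> ('d \<Rightarrow> int) \<Rightarrow> real ^ 'd" where
  "corner k v = (\<chi> m. of_int (v m) / 2 ^ k)"

text \<open>The indices that points of the unit ball can produce. The upper end 2^k is included
  because a coordinate equal to 1 has exactly this floor.\<close>

definition cells :: "nat \<Rightarrow> ('d \<Rightarrow> int) set" where
  "cells k = UNIV \<rightarrow>\<^sub>E {- (2 ^ k)..2 ^ k}"

text \<open>The l1 distance between the cell masses at scale 2^(-k), weighted by the side of the
  cells and summed over scales: the usual multiscale majorant of the 1-Wasserstein distance, cut off
  at level K.\<close>

definition cell_deviation :: "nat \<Rightarrow> (real ^ 'd) measure \<Rightarrow> (real ^ 'd) measure \<Rightarrow> real" where
  "cell_deviation K P Q =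
     (\<Sum>k\<le>K. (\<Sum>v\<in>cells k. \<bar>measure P (cell k v) - measure Q (cell k v)\<bar>) / 2 ^ k)"

lemma finite_cells [simp]: "finite (cells k :: ('d::finite \<Rightarrow> int) set)"
  unfolding cells_def by (rule finite_PiE) auto

lemma card_cells: "real (card (cells k :: ('d::finite \<Rightarrow> int) set)) \<le> (3 * 2 ^ k) ^ CARD('d)"
proof -
  have "card (cells k :: ('d \<Rightarrow> int) set) = nat (2 * 2 ^ k + 1) ^ CARD('d)"
    unfolding cells_def by (simp add: card_PiE)
  also have "nat (2 * 2 ^ k + 1) = 2 * 2 ^ k + 1"
    by (simp add: nat_add_distrib nat_mult_distrib nat_power_eq)
  finally have "real (card (cells k :: ('d \<Rightarrow> int) set)) = (2 * 2 ^ k + 1) ^ CARD('d)" by (simp add: add.commute)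
  also have "\<dots> \<le> (3 * 2 ^ k) ^ CARD('d)" by (intro power_mono) auto
  finally show ?thesis .
qed

lemma cell_index_measurable [measurable]:
  "(cell_index k :: real ^ 'd \<Rightarrow> 'd::finite \<Rightarrow> int) \<in> borel \<rightarrow>\<^sub>M count_space UNIV"
proof (subst measurable_count_space_eq_countable)
  show "countable (UNIV :: ('d \<Rightarrow> int) set)" by simp
  have "cell_index k -` {v} \<inter> space borel = (\<Inter>m\<in>UNIV. {x :: real ^ 'd. \<lfloor>2 ^ k * vec_nth x m\<rfloor> = v m})" for v :: "'d \<Rightarrow> int"
    by (auto simp: cell_index_def fun_eq_iff)
  moreover have "{x :: real ^ 'd. \<lfloor>2 ^ k * vec_nth x m\<rfloor> = v m} \<in> sets borel" for v m
    by measurable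
  ultimately have "cell_index k -` {v} \<inter> space borel \<in> sets (borel :: (real ^ 'd) measure)" for v :: "'d \<Rightarrow> int"
    by (auto intro!: sets.finite_INT)
  thus "cell_index k \<in> space (borel :: (real ^ 'd) measure) \<rightarrow> (UNIV :: ('d \<Rightarrow> int) set)
      \<and> (\<forall>a\<in>UNIV. cell_index k -` {a} \<inter> space borel \<in> sets (borel :: (real ^ 'd) measure))" by auto
qed

lemma cell_sets [measurable]: "cell k v \<in> sets (borel :: (real ^ 'd::finite) measure)"
proof -
  have "cell k v = cell_index k -` {v} \<inter> space borel" by (auto simp: cell_def)
  thus ?thesis using measurable_sets[OF cell_index_measurable[of k], of "{v}"] by simp
qed

lemma cell_index_in_cells:
  fixes x :: "real ^ 'd::finite"
  assumes "norm x \<le> 1"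
  shows "cell_index k x \<in> cells k"
  unfolding cells_def
proof (rule PiE_I)
  fix m :: 'd
  have "\<bar>vec_nth x m\<bar> \<le> 1" using component_le_norm_cart[of x m] assms by linarith
  hence x: "- 1 \<le> vec_nth x m" "vec_nth x m \<le> 1" by auto
  have "- (2 ^ k) \<le> \<lfloor>2 ^ k * vec_nth x m\<rfloor>"
    unfolding le_floor_iff using mult_left_mono[OF x(1), of "2 ^ k"] by simp
  moreover have "\<lfloor>2 ^ k * vec_nth x m\<rfloor> \<le> 2 ^ k"
  proof -
    have "2 ^ k * vec_nth x m \<le> of_int (2 ^ k)" using mult_left_mono[OF x(2), of "2 ^ k"] by simp
    from floor_mono[OF this] show ?thesis by (simp only: floor_of_int)
  qed
  ultimately show "cell_index k x m \<in> {- (2 ^ k)..2 ^ k}" by (simp add: cell_index_def)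
qed auto

lemma norm_le_of_components:
  fixes x :: "real ^ 'd::finite"
  assumes "\<And>m. \<bar>vec_nth x m\<bar> \<le> b"
  shows "norm x \<le> real CARD('d) * b"
proof -
  have "norm x \<le> (\<Sum>m\<in>UNIV. \<bar>vec_nth x m\<bar>)" by (rule norm_le_l1_cart)
  also have "\<dots> \<le> (\<Sum>m\<in>(UNIV :: 'd set). b)" by (intro sum_mono assms)
  finally show ?thesis by simp
qed

lemma corner_parent_dist:
  "norm (corner (Suc k) v - corner k (\<lambda>m. v m div 2) :: real ^ 'd::finite) \<le> real CARD('d) / 2 ^ Suc k"
proof -
  have "\<bar>vec_nth (corner (Suc k) v - corner k (\<lambda>m. v m div 2) :: real ^ 'd) m\<bar> \<le> 1 / 2 ^ Suc k" for m
  proof -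
    have "v m = 2 * (v m div 2) + v m mod 2" by simp
    hence "real_of_int (v m) = 2 * of_int (v m div 2) + of_int (v m mod 2)"
      by (metis of_int_add of_int_mult of_int_numeral)
    hence eq: "vec_nth (corner (Suc k) v - corner k (\<lambda>m. v m div 2) :: real ^ 'd) m = of_int (v m mod 2) / 2 ^ Suc k"
      by (simp add: corner_def field_simps)
    have "0 \<le> real_of_int (v m mod 2)" "real_of_int (v m mod 2) \<le> 1" by auto
    thus ?thesis unfolding eq by (simp add: divide_right_mono)
  qed
  from norm_le_of_components[OF this] show ?thesis by simp
qed

text \<open>Halving before taking the floor agrees with \<open>div\<close> afterwards, also for
  negative indices, since \<open>div\<close> rounds down. This is the nesting of the dyadic
  cells.\<close>

lemma cell_index_parent: "cell_index k x = (\<lambda>m. cell_index (Suc k) x m div 2)"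
proof
  fix m
  have "2 ^ k * vec_nth x m = (2 ^ Suc k * vec_nth x m) / of_int 2" by simp
  thus "cell_index k x m = cell_index (Suc k) x m div 2"
    unfolding cell_index_def by (metis floor_divide_real_eq_div zero_le_numeral)
qed

lemma dist_corner_cell_index:
  fixes x :: "real ^ 'd::finite"
  shows "norm (x - corner k (cell_index k x)) \<le> real CARD('d) / 2 ^ k"
proof -
  have "\<bar>vec_nth (x - corner k (cell_index k x)) m\<bar> \<le> 1 / 2 ^ k" for m
  proof -
    have "vec_nth (x - corner k (cell_index k x)) m = (2 ^ k * vec_nth x m - of_int \<lfloor>2 ^ k * vec_nth x m\<rfloor>) / 2 ^ k"
      by (simp add: corner_def cell_index_def field_simps)
    moreover have "0 \<le> 2 ^ k * vec_nth x m - of_int \<lfloor>2 ^ k * vec_nth x m\<rfloor>"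
      "2 ^ k * vec_nth x m - of_int \<lfloor>2 ^ k * vec_nth x m\<rfloor> \<le> 1" by linarith+
    ultimately show ?thesis by (simp add: divide_right_mono)
  qed
  from norm_le_of_components[OF this] show ?thesis by simp
qed

text \<open>Common ground for F and for empirical measures of points in the ball. Containment is
  almost sure only, since F is controlled through its support.\<close>

locale unit_ball_measure = prob_space P for P :: "(real ^ 'd::finite) measure" +
  assumes sets_eq [measurable_cong]: "sets P = sets borel"
    and AE_ball: "AE x in P. norm x \<le> 1"
begin

lemma integral_cell_function:
  fixes \<eta> :: "('d \<Rightarrow> int) \<Rightarrow> real"
  shows "integrable P (\<lambda>x. \<eta> (cell_index k x))"
    and "(\<integral>x. \<eta> (cell_index k x) \<partial>P) = (\<Sum>v\<in>cells k. \<eta> v * measure P (cell k v))"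
proof -
  have [measurable]: "\<And>v. cell k v \<in> sets P" by (simp add: sets_eq)
  have eq: "AE x in P. \<eta> (cell_index k x) = (\<Sum>v\<in>cells k. \<eta> v * indicator (cell k v) x)"
    using AE_ball
  proof eventually_elim
    case (elim x)
    have "(\<Sum>v\<in>cells k. \<eta> v * indicator (cell k v) x) = (\<Sum>v\<in>cells k. if v = cell_index k x then \<eta> v else 0)"
      by (intro sum.cong refl) (auto simp: cell_def indicator_def)
    thus ?case using cell_index_in_cells[OF elim, of k] by simp
  qed
  have m: "(\<lambda>x. \<eta> (cell_index k x)) \<in> borel_measurable P" by measurable
  have i: "integrable P (\<lambda>x. \<Sum>v\<in>cells k. \<eta> v * indicator (cell k v) x)"
    by (intro Bochner_Integration.integrable_sum integrable_mult_right) (simp add: emeasure_eq_measure)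
  note m2 = borel_measurable_integrable[OF i]
  show "integrable P (\<lambda>x. \<eta> (cell_index k x))"
    using i integrable_cong_AE[OF m m2 eq] by simp
  have "(\<integral>x. \<eta> (cell_index k x) \<partial>P) = (\<integral>x. (\<Sum>v\<in>cells k. \<eta> v * indicator (cell k v) x) \<partial>P)"
    by (rule integral_cong_AE[OF m m2 eq])
  also have "\<dots> = (\<Sum>v\<in>cells k. \<eta> v * measure P (cell k v))"
    by (subst Bochner_Integration.integral_sum) (simp_all add: emeasure_eq_measure)
  finally show "(\<integral>x. \<eta> (cell_index k x) \<partial>P) = (\<Sum>v\<in>cells k. \<eta> v * measure P (cell k v))" .
qed

end

lemma lipschitz_integral_cell_deviation:
  fixes P Q :: "(real ^ 'd::finite) measure" and g :: "real ^ 'd \<Rightarrow> real"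
  assumes P: "unit_ball_measure P" and Q: "unit_ball_measure Q"
    and L: "0 \<le> L" and lip: "\<And>x y. \<bar>g x - g y\<bar> \<le> L * norm (x - y)"
  shows "(\<integral>x. g x \<partial>P) - (\<integral>x. g x \<partial>Q) \<le> L * real CARD('d) * (cell_deviation K P Q + 2 / 2 ^ K)"
proof -
  interpret P: unit_ball_measure P by fact
  interpret Q: unit_ball_measure Q by fact
  let ?d = "real CARD('d)"
  have g_meas [measurable]: "g \<in> borel_measurable borel"
  proof (rule borel_measurable_continuous_onI)
    have "L-lipschitz_on UNIV g" using L lip by (auto simp: lipschitz_on_def dist_norm)
    thus "continuous_on UNIV g" by (rule lipschitz_on_continuous_on)
  qed
  \<comment> \<open>The increment from the parent corner to the own corner. The chain starts at the
    origin, so the increments of scale 0 are jumps of up to one unit per coordinate and obey the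
    same bound L d / 2^k.\<close>
  define \<eta> where "\<eta> = (\<lambda>k (v :: 'd \<Rightarrow> int). g (corner k v) -
      (case k of 0 \<Rightarrow> g 0 | Suc j \<Rightarrow> g (corner j (\<lambda>m. v m div 2))))"
  have \<eta>_bound: "\<bar>\<eta> k v\<bar> \<le> L * ?d / 2 ^ k" if v: "v \<in> cells k" for k v
  proof (cases k)
    case 0
    have "\<bar>vec_nth (corner 0 v :: real ^ 'd) m\<bar> \<le> 1" for m
    proof -
      have "v m \<in> {- 1..1}" using v by (auto simp: cells_def 0 PiE_def Pi_def)
      hence "- 1 \<le> real_of_int (v m)" "real_of_int (v m) \<le> 1" by auto
      thus ?thesis by (simp add: corner_def abs_le_iff)
    qed
    from norm_le_of_components[OF this] have "norm (corner 0 v :: real ^ 'd) \<le> ?d" by simp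
    hence "L * norm (corner 0 v - 0 :: real ^ 'd) \<le> L * ?d" using L by (intro mult_left_mono) auto
    thus ?thesis using lip[of "corner 0 v" 0] by (simp add: \<eta>_def 0)
  next
    case (Suc j)
    have "\<bar>\<eta> k v\<bar> \<le> L * norm (corner k v - corner j (\<lambda>m. v m div 2) :: real ^ 'd)"
      using lip by (simp add: \<eta>_def Suc)
    also have "\<dots> \<le> L * (?d / 2 ^ k)" unfolding Suc by (intro mult_left_mono corner_parent_dist L)
    finally show ?thesis by simp
  qed
  have tele: "(\<Sum>k\<le>K. \<eta> k (cell_index k x)) = g (corner K (cell_index K x)) - g 0" for x
  proof (induction K)
    case (Suc K)
    have "\<eta> (Suc K) (cell_index (Suc K) x) = g (corner (Suc K) (cell_index (Suc K) x)) - g (corner K (cell_index K x))"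
      by (simp add: \<eta>_def cell_index_parent[of K x])
    thus ?case using Suc by simp
  qed (simp add: \<eta>_def)
  \<comment> \<open>What the chain leaves over below scale K. It is incurred once for P and once for
    Q, whence 2 / 2^K.\<close>
  define h where "h = (\<lambda>x. g x - g (corner K (cell_index K x)))"
  have h: "\<bar>h x\<bar> \<le> L * ?d / 2 ^ K" for x
  proof -
    have "\<bar>h x\<bar> \<le> L * norm (x - corner K (cell_index K x))" unfolding h_def by (rule lip)
    also have "\<dots> \<le> L * (?d / 2 ^ K)" by (intro mult_left_mono dist_corner_cell_index L)
    finally show ?thesis by simp
  qed
  have h_meas [measurable]: "h \<in> borel_measurable borel" unfolding h_def
    by (intro borel_measurable_diff g_meas measurable_compose[OF cell_index_measurable]) auto
  have main: "integrable R h \<and> (\<integral>x. g x \<partial>R) = g 0 + (\<Sum>k\<le>K. \<Sum>v\<in>cells k. \<eta> k v * measure R (cell k v)) + (\<integral>x. h x \<partial>R)"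
    if "unit_ball_measure R" for R
  proof -
    interpret R: unit_ball_measure R by fact
    have ih: "integrable R h"
    proof (rule R.integrable_const_bound)
      show "AE x in R. norm (h x) \<le> L * ?d / 2 ^ K" using h by simp
    qed measurable
    have "g x = g 0 + (\<Sum>k\<le>K. \<eta> k (cell_index k x)) + h x" for x by (simp add: tele h_def)
    hence "(\<integral>x. g x \<partial>R) = (\<integral>x. g 0 + (\<Sum>k\<le>K. \<eta> k (cell_index k x)) + h x \<partial>R)"
      by (rule Bochner_Integration.integral_cong[OF refl])
    also have "\<dots> = g 0 + (\<Sum>k\<le>K. \<integral>x. \<eta> k (cell_index k x) \<partial>R) + (\<integral>x. h x \<partial>R)"
      using ih R.integral_cell_function(1) by (simp add: R.prob_space)
    finally show ?thesis using ih by (simp add: R.integral_cell_function(2))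
  qed
  have hR: "\<bar>\<integral>x. h x \<partial>R\<bar> \<le> L * ?d / 2 ^ K" if "unit_ball_measure R" for R
  proof -
    interpret R: unit_ball_measure R by fact
    have "\<bar>\<integral>x. h x \<partial>R\<bar> \<le> (\<integral>x. \<bar>h x\<bar> \<partial>R)" by (rule integral_abs_bound)
    also have "\<dots> \<le> (\<integral>x. L * ?d / 2 ^ K \<partial>R)" using main[OF that] h by (intro integral_mono) auto
    finally show ?thesis by (simp add: R.prob_space)
  qed
  have "(\<Sum>k\<le>K. \<Sum>v\<in>cells k. \<eta> k v * measure P (cell k v)) - (\<Sum>k\<le>K. \<Sum>v\<in>cells k. \<eta> k v * measure Q (cell k v))
      = (\<Sum>k\<le>K. \<Sum>v\<in>cells k. \<eta> k v * (measure P (cell k v) - measure Q (cell k v)))"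
    by (simp add: sum_subtractf algebra_simps)
  also have "\<dots> \<le> (\<Sum>k\<le>K. \<Sum>v\<in>cells k. L * ?d / 2 ^ k * \<bar>measure P (cell k v) - measure Q (cell k v)\<bar>)"
  proof (intro sum_mono)
    fix k v assume v: "v \<in> (cells k :: ('d \<Rightarrow> int) set)"
    have "\<eta> k v * (measure P (cell k v) - measure Q (cell k v)) \<le> \<bar>\<eta> k v\<bar> * \<bar>measure P (cell k v) - measure Q (cell k v)\<bar>"
      by (metis abs_ge_self abs_mult)
    also have "\<dots> \<le> L * ?d / 2 ^ k * \<bar>measure P (cell k v) - measure Q (cell k v)\<bar>"
      by (intro mult_right_mono \<eta>_bound v) auto
    finally show "\<eta> k v * (measure P (cell k v) - measure Q (cell k v)) \<le> L * ?d / 2 ^ k * \<bar>measure P (cell k v) - measure Q (cell k v)\<bar>" .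
  qed
  also have "\<dots> = L * ?d * cell_deviation K P Q"
    by (simp add: cell_deviation_def sum_distrib_left sum_divide_distrib algebra_simps)
  finally have "(\<Sum>k\<le>K. \<Sum>v\<in>cells k. \<eta> k v * measure P (cell k v)) - (\<Sum>k\<le>K. \<Sum>v\<in>cells k. \<eta> k v * measure Q (cell k v))
      \<le> L * ?d * cell_deviation K P Q" .
  moreover have "L * ?d * (cell_deviation K P Q + 2 / 2 ^ K) = L * ?d * cell_deviation K P Q + 2 * (L * ?d / 2 ^ K)"
    by (simp add: algebra_simps)
  ultimately show ?thesis
    using main[OF P, THEN conjunct2] main[OF Q, THEN conjunct2] hR[OF P] hR[OF Q] by linarith
qed

section \<open>Fluctuations of empirical frequencies\<close>

lemma (in prob_space) expectation_abs_le_sqrt: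
  fixes Y :: "'a \<Rightarrow> real"
  assumes Y: "integrable M Y" "integrable M (\<lambda>x. (Y x)\<^sup>2)"
  shows "expectation (\<lambda>x. \<bar>Y x\<bar>) \<le> sqrt (expectation (\<lambda>x. (Y x)\<^sup>2))"
proof -
  define m where "m = expectation (\<lambda>x. \<bar>Y x\<bar>)"
  have i: "integrable M (\<lambda>x. \<bar>Y x\<bar>)" using Y by simp
  have "0 \<le> expectation (\<lambda>x. (\<bar>Y x\<bar> - m)\<^sup>2)" by simp
  also have "expectation (\<lambda>x. (\<bar>Y x\<bar> - m)\<^sup>2) = expectation (\<lambda>x. (Y x)\<^sup>2 + m\<^sup>2 - 2 * m * \<bar>Y x\<bar>)"
    by (simp add: power2_diff algebra_simps)
  also have "\<dots> = expectation (\<lambda>x. (Y x)\<^sup>2) + m\<^sup>2 - 2 * m * m"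
    using i Y by (simp add: prob_space m_def)
  finally have "m\<^sup>2 \<le> expectation (\<lambda>x. (Y x)\<^sup>2)" by (simp add: power2_eq_square)
  thus ?thesis unfolding m_def by (rule real_le_rsqrt)
qed

lemma PiM_integral_pair:
  fixes F :: "'a measure" and f g :: "'a \<Rightarrow> real"
  assumes F: "prob_space F" and ij: "i < n" "j < n" "i \<noteq> j" and fg: "integrable F f" "integrable F g"
  shows "(\<integral>x. f (x i) * g (x j) \<partial>Pi\<^sub>M {..<n :: nat} (\<lambda>_. F)) = (\<integral>x. f x \<partial>F) * (\<integral>x. g x \<partial>F)"
proof -
  interpret F: prob_space F by fact
  interpret product_prob_space "\<lambda>_. F" "{..<n}" by unfold_locales
  define u where "u = (\<lambda>k. if k = i then f else if k = j then g else (\<lambda>_. 1))"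
  have "(\<Prod>k<n. u k (x k)) = f (x i) * g (x j)" for x
  proof -
    have "(\<Prod>k<n. u k (x k)) = (\<Prod>k\<in>{i, j}. u k (x k))"
      using ij by (intro prod.mono_neutral_right) (auto simp: u_def)
    thus ?thesis using ij by (simp add: u_def)
  qed
  moreover have "(\<Prod>k<n. \<integral>x. u k x \<partial>F) = (\<integral>x. f x \<partial>F) * (\<integral>x. g x \<partial>F)"
  proof -
    have "(\<Prod>k<n. \<integral>x. u k x \<partial>F) = (\<Prod>k\<in>{i, j}. \<integral>x. u k x \<partial>F)"
      using ij by (intro prod.mono_neutral_right) (auto simp: u_def F.prob_space)
    thus ?thesis using ij by (simp add: u_def)
  qed
  moreover have "(\<integral>x. (\<Prod>k<n. u k (x k)) \<partial>iid n F) = (\<Prod>k<n. \<integral>x. u k x \<partial>F)"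
    using fg by (intro product_integral_prod) (auto simp: u_def)
  ultimately show ?thesis by simp
qed

lemma PiM_integral_component:
  fixes F :: "'a measure" and f :: "'a \<Rightarrow> real"
  assumes F: "prob_space F" and i: "i < n" and f: "f \<in> borel_measurable F"
  shows "(\<integral>x. f (x i) \<partial>Pi\<^sub>M {..<n :: nat} (\<lambda>_. F)) = (\<integral>x. f x \<partial>F)"
proof -
  have "(\<integral>x. f x \<partial>F) = (\<integral>x. f x \<partial>distr (iid n F) F (\<lambda>x. x i))"
    using distr_PiM_component[of "{..<n}" "\<lambda>_. F" i] F i by simp
  also have "\<dots> = (\<integral>x. f (x i) \<partial>iid n F)"
    using i f by (intro integral_distr measurable_component_singleton) auto
  finally show ?thesis by simp
qed

lemma measure_empirical:
  assumes "0 < n" "S \<in> sets borel"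
  shows "measure (empirical n x) S = (\<Sum>i<n. indicator S (x i)) / real n"
proof -
  have "measure (empirical n x) S = measure_pmf.prob (pmf_of_set {..<n}) (x -` S)"
    unfolding empirical_def using assms by (subst measure_distr) auto
  also have "\<dots> = card ({..<n} \<inter> x -` S) / card {..<n}"
    using assms by (intro measure_pmf_of_set) auto
  also have "real (card ({..<n} \<inter> x -` S)) = (\<Sum>i<n. indicator S (x i))"
    by (simp add: indicator_def sum.If_cases vimage_def Int_def)
  finally show ?thesis by simp
qed

text \<open>The variance of an average of n independent centred indicators is at most F(S) / n,
  cross terms having mean 0. The factor F(S) is retained on purpose: summed over cells by
  Cauchy-Schwarz it gives the square root of (number of cells) / n, where a uniform bound 1 / n
  would give the number of cells over sqrt n.\<close>

lemma empirical_cell_error: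
  fixes F :: "(real ^ 'd::finite) measure"
  assumes F: "prob_space F" "sets F = sets borel" and n: "0 < n" and S: "S \<in> sets borel"
  shows "integrable (iid n F) (\<lambda>x. \<bar>measure (empirical n x) S - measure F S\<bar>)"
    and "(\<integral>x. \<bar>measure (empirical n x) S - measure F S\<bar> \<partial>iid n F) \<le> sqrt (measure F S / real n)"
proof -
  interpret F: prob_space F by fact
  let ?M = "iid n F"
  interpret M: prob_space ?M by (intro prob_space_PiM F)
  have [measurable]: "S \<in> sets F" using S F by simp
  define h where "h = (\<lambda>x. indicator S x - measure F S)"
  have [measurable]: "h \<in> borel_measurable F" unfolding h_def by measurable
  have hb: "\<bar>h x\<bar> \<le> 1" for x by (auto simp: h_def indicator_def)
  have ih: "integrable F h" by (rule F.integrable_const_bound[of _ 1]) (use hb in auto)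
  have hm: "(\<integral>x. h x \<partial>F) = 0"
    unfolding h_def by (subst Bochner_Integration.integral_diff) (auto simp: F.prob_space F.emeasure_eq_measure)
  have hh: "(\<integral>x. h x * h x \<partial>F) \<le> measure F S"
  proof -
    have "(\<integral>x. h x * h x \<partial>F) = (\<integral>x. indicator S x * (1 - 2 * measure F S) + (measure F S)\<^sup>2 \<partial>F)"
      by (intro Bochner_Integration.integral_cong) (auto simp: h_def indicator_def power2_eq_square algebra_simps)
    also have "\<dots> = measure F S * (1 - 2 * measure F S) + (measure F S)\<^sup>2"
      by (subst Bochner_Integration.integral_add) (auto simp: F.prob_space F.emeasure_eq_measure)
    also have "\<dots> = measure F S - (measure F S)\<^sup>2" by (simp add: power2_eq_square algebra_simps)
    finally show ?thesis by simp
  qed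
  define Y where "Y = (\<lambda>x :: nat \<Rightarrow> real ^ 'd. measure (empirical n x) S - measure F S)"
  have Y: "Y x = (\<Sum>i<n. h (x i)) / real n" for x
    using n by (simp add: Y_def measure_empirical[OF n S] h_def sum_subtractf field_simps)
  have hx: "(\<lambda>x. h (x i)) \<in> borel_measurable ?M" if "i < n" for i
    using that by (intro measurable_compose[OF measurable_component_singleton]) auto
  have Ym [measurable]: "Y \<in> borel_measurable ?M"
    unfolding Y[abs_def] by (intro borel_measurable_divide borel_measurable_sum hx) auto
  have Yb: "\<bar>Y x\<bar> \<le> 1" for x
  proof -
    have "\<bar>\<Sum>i<n. h (x i)\<bar> \<le> (\<Sum>i<n. \<bar>h (x i)\<bar>)" by (rule sum_abs)
    also have "\<dots> \<le> (\<Sum>i<n. 1)" by (intro sum_mono hb)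
    finally show ?thesis using n by (simp add: Y)
  qed
  have iY: "integrable ?M Y" by (rule M.integrable_const_bound[of _ 1]) (use Yb in auto)
  have iY2: "integrable ?M (\<lambda>x. (Y x)\<^sup>2)"
    by (rule M.integrable_const_bound[of _ 1]) (use Yb in \<open>auto simp: abs_square_le_1\<close>)
  show "integrable ?M (\<lambda>x. \<bar>measure (empirical n x) S - measure F S\<bar>)" using iY by (simp add: Y_def)
  have ihh: "integrable ?M (\<lambda>x. h (x i) * h (x j))" if "i < n" "j < n" for i j
  proof (rule M.integrable_const_bound[of _ 1])
    show "AE x in ?M. norm (h (x i) * h (x j)) \<le> 1" using hb by (auto simp: abs_mult intro!: mult_le_one)
    show "(\<lambda>x. h (x i) * h (x j)) \<in> borel_measurable ?M" using that by (intro borel_measurable_times hx)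
  qed
  have "(\<integral>x. (Y x)\<^sup>2 \<partial>?M) = (\<integral>x. (\<Sum>i<n. \<Sum>j<n. h (x i) * h (x j)) / (real n)\<^sup>2 \<partial>?M)"
    by (simp add: Y power2_eq_square sum_product)
  also have "\<dots> = (\<Sum>i<n. \<Sum>j<n. \<integral>x. h (x i) * h (x j) \<partial>?M) / (real n)\<^sup>2"
  proof -
    have "(\<integral>x. (\<Sum>i<n. \<Sum>j<n. h (x i) * h (x j)) \<partial>?M) = (\<Sum>i<n. \<integral>x. (\<Sum>j<n. h (x i) * h (x j)) \<partial>?M)"
      by (intro Bochner_Integration.integral_sum Bochner_Integration.integrable_sum ihh) auto
    also have "\<dots> = (\<Sum>i<n. \<Sum>j<n. \<integral>x. h (x i) * h (x j) \<partial>?M)"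
      by (intro sum.cong refl Bochner_Integration.integral_sum ihh) auto
    finally show ?thesis by simp
  qed
  also have "\<dots> = (\<Sum>i<n. \<Sum>j<n. if i = j then \<integral>x. h x * h x \<partial>F else 0) / (real n)\<^sup>2"
  proof -
    have "(\<integral>x. h (x i) * h (x j) \<partial>?M) = (if i = j then \<integral>x. h x * h x \<partial>F else 0)" if "i < n" "j < n" for i j
      using PiM_integral_pair[OF F(1) that _ ih ih] PiM_integral_component[OF F(1) that(1), of "\<lambda>x. h x * h x"]
      by (auto simp: hm)
    thus ?thesis by simp
  qed
  also have "\<dots> = (\<integral>x. h x * h x \<partial>F) / real n" using n by (simp add: power2_eq_square)
  also have "\<dots> \<le> measure F S / real n" using hh by (intro divide_right_mono) auto
  finally have "sqrt (\<integral>x. (Y x)\<^sup>2 \<partial>?M) \<le> sqrt (measure F S / real n)" by simp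
  from order_trans[OF M.expectation_abs_le_sqrt[OF iY iY2] this]
  show "(\<integral>x. \<bar>measure (empirical n x) S - measure F S\<bar> \<partial>?M) \<le> sqrt (measure F S / real n)"
    unfolding Y_def .
qed

lemma expected_cell_deviation:
  fixes F :: "(real ^ 'd::finite) measure"
  assumes F: "prob_space F" "sets F = sets borel" and n: "0 < n"
  shows "integrable (iid n F) (\<lambda>x. cell_deviation K (empirical n x) F)"
    and "(\<integral>x. cell_deviation K (empirical n x) F \<partial>iid n F)
      \<le> (\<Sum>k\<le>K. sqrt ((3 * 2 ^ k) ^ CARD('d) / real n) / 2 ^ k)"
proof -
  interpret F: prob_space F by fact
  let ?M = "iid n F"
  note err = empirical_cell_error[OF F n cell_sets]
  show "integrable ?M (\<lambda>x. cell_deviation K (empirical n x) F)"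
    unfolding cell_deviation_def
    by (intro Bochner_Integration.integrable_sum integrable_divide err(1))
  \<comment> \<open>Cauchy-Schwarz against the constant 1, with the disjoint cells having total mass
    at most 1.\<close>
  have cs: "(\<Sum>v\<in>cells k. sqrt (measure F (cell k v) / real n)) \<le> sqrt ((3 * 2 ^ k) ^ CARD('d) / real n)" for k
  proof -
    have "(\<Sum>v\<in>cells k. measure F (cell k v)) = measure F (\<Union>v\<in>cells k. cell k v)"
      using F(2) by (subst F.finite_measure_finite_Union) (auto simp: disjoint_family_on_def cell_def intro!: cell_sets[unfolded cell_def])
    hence tot: "(\<Sum>v\<in>cells k. measure F (cell k v)) \<le> 1" by simp
    have "(\<Sum>v\<in>cells k. 1 * sqrt (measure F (cell k v) / real n))\<^sup>2
      \<le> (\<Sum>v\<in>(cells k :: ('d \<Rightarrow> int) set). 1\<^sup>2) * (\<Sum>v\<in>cells k. (sqrt (measure F (cell k v) / real n))\<^sup>2)"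
      by (rule Cauchy_Schwarz_ineq_sum)
    also have "\<dots> = real (card (cells k :: ('d \<Rightarrow> int) set)) * ((\<Sum>v\<in>cells k. measure F (cell k v)) / real n)"
      by (simp add: sum_divide_distrib)
    also have "\<dots> \<le> (3 * 2 ^ k) ^ CARD('d) * (1 / real n)"
      by (intro mult_mono card_cells divide_right_mono tot) (auto intro!: divide_nonneg_nonneg sum_nonneg)
    finally show ?thesis by (intro real_le_rsqrt) simp
  qed
  have "(\<integral>x. cell_deviation K (empirical n x) F \<partial>?M)
     = (\<Sum>k\<le>K. (\<Sum>v\<in>cells k. \<integral>x. \<bar>measure (empirical n x) (cell k v) - measure F (cell k v)\<bar> \<partial>?M) / 2 ^ k)"
    unfolding cell_deviation_def
    by (subst Bochner_Integration.integral_sum) (auto simp: Bochner_Integration.integral_sum err(1) intro!: Bochner_Integration.integrable_sum integrable_divide)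
  also have "\<dots> \<le> (\<Sum>k\<le>K. (\<Sum>v\<in>cells k. sqrt (measure F (cell k v) / real n)) / 2 ^ k)"
    by (intro sum_mono divide_right_mono err(2)) auto
  also have "\<dots> \<le> (\<Sum>k\<le>K. sqrt ((3 * 2 ^ k) ^ CARD('d) / real n) / 2 ^ k)"
    by (intro sum_mono divide_right_mono cs) auto
  finally show "(\<integral>x. cell_deviation K (empirical n x) F \<partial>?M)
      \<le> (\<Sum>k\<le>K. sqrt ((3 * 2 ^ k) ^ CARD('d) / real n) / 2 ^ k)" .
qed

text \<open>K is the largest integer with 2^(dK) \<le> n, so 2^(-K) is n^(-1/d) up to a factor 2.
  Apart from sqrt (3^d / n), scale k contributes 2^(k (d/2 - 1)): at most 1 if d = 1, and largest at
  k = K if d \<ge> 2.\<close>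

lemma dyadic_rate:
  fixes d n :: nat
  assumes d: "1 \<le> d" and n: "2 \<le> n"
  obtains K where
    "(\<Sum>k\<le>K. sqrt ((3 * 2 ^ k) ^ d / real n) / 2 ^ k) + 2 / 2 ^ K
       \<le> (8 * sqrt (3 ^ d) + 8) * ((real n powr (- 1 / 2) + real n powr (- 1 / real d)) * ln (real n))"
proof -
  have "2 \<le> (2 :: nat) ^ d" using d power_increasing[of 1 d "2 :: nat"] by simp
  then obtain K where K: "(2 ^ d) ^ K \<le> n" "n < (2 ^ d) ^ (K + 1)"
    using ex_power_ivl1[of "2 ^ d" n] n by auto
  have n0: "0 < real n" using n by simp
  define r where "r = real n powr (- 1 / real d)"
  have "real n \<le> real (2 ^ (K + 1)) ^ d"
  proof -
    have "n < (2 ^ (K + 1)) ^ d" using K(2) by (simp only: power_mult[symmetric] mult.commute)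
    hence "real n < real ((2 ^ (K + 1)) ^ d)" by (simp only: of_nat_less_iff)
    thus ?thesis by (simp only: of_nat_power less_imp_le)
  qed
  hence "real n powr (1 / real d) \<le> ((2 ^ (K + 1)) ^ d) powr (1 / real d)"
    using n0 by (intro powr_mono2) auto
  also have "\<dots> = 2 ^ (K + 1)"
  proof -
    have *: "(x ^ d) powr (1 / real d) = x" if "0 < x" for x :: real
      using d that by (simp add: powr_powr flip: powr_realpow)
    show ?thesis by (rule *) simp
  qed
  finally have "inverse (2 ^ (K + 1)) \<le> inverse (real n powr (1 / real d))"
    using n0 by (intro le_imp_inverse_le) auto
  hence K1: "1 / 2 ^ K \<le> 2 * r"
    by (simp add: r_def powr_minus field_simps)
  \<comment> \<open>One bound for both regimes: the summand 1 serves d = 1 and turns into n^(-1/2)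
    after division by sqrt n, the other serves d \<ge> 2 and turns into 2 n^(-1/d).\<close>
  have term_bound: "sqrt ((2 ^ k) ^ d) / 2 ^ k \<le> 1 + 2 * (sqrt (real n) * r)" if k: "k \<le> K" for k
  proof (cases "d = 1")
    case True
    have "sqrt (2 ^ k) \<le> sqrt ((2 ^ k)\<^sup>2)"
      by (rule real_sqrt_le_mono) (simp add: self_le_power)
    hence "sqrt ((2 ^ k) ^ d) / 2 ^ k \<le> 1" by (simp add: True)
    moreover have "0 \<le> 2 * (sqrt (real n) * r)" by (simp add: r_def)
    ultimately show ?thesis by linarith
  next
    case False
    then obtain e where e: "d = e + 2" using d by (metis add.commute le_Suc_ex Suc_1 not_less_eq_eq le_antisym)
    have eq: "sqrt ((2 ^ k) ^ d) / 2 ^ k = sqrt ((2 ^ k) ^ e)" for k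
    proof -
      have "(2 ^ k :: real) ^ d = (2 ^ k) ^ e * (2 ^ k)\<^sup>2" by (simp only: e power_add)
      thus ?thesis by (simp only: real_sqrt_mult real_sqrt_abs) simp
    qed
    have "sqrt ((2 ^ k) ^ e) \<le> sqrt ((2 ^ K) ^ e)"
      using k by (intro real_sqrt_le_mono power_mono power_increasing) auto
    also have "\<dots> = sqrt ((2 ^ K) ^ d) * (1 / 2 ^ K)" using eq[of K] by simp
    also have "\<dots> \<le> sqrt (real n) * (2 * r)"
    proof (intro mult_mono K1 real_sqrt_le_mono)
      have "(2 ^ K) ^ d = real ((2 ^ d) ^ K)" by (simp flip: power_mult add: mult.commute)
      also have "\<dots> \<le> real n" using K(1) by (simp only: of_nat_le_iff)
      finally show "(2 ^ K) ^ d \<le> real n" .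
    qed auto
    finally show ?thesis unfolding eq by simp
  qed
  have ln2: "1 / 2 \<le> ln (2 :: real)" using ln2_ge_two_thirds by simp
  have lnn: "1 / 2 \<le> ln (real n)"   proof -
    have "ln 2 \<le> ln (real n)" using n by (subst ln_le_cancel_iff) auto
    thus ?thesis using ln2 by simp
  qed
  \<comment> \<open>From 2^K \<le> n and ln 2 \<ge> 1/2 follows K \<le> 2 ln n, and n \<ge> 2
    absorbs the remaining 1 into another 2 ln n.\<close>
  have Kln: "real K + 1 \<le> 4 * ln (real n)"
  proof -
    have "(2 :: nat) ^ K \<le> (2 ^ d) ^ K" using d \<open>2 \<le> 2 ^ d\<close> by (intro power_mono) auto
    hence "real (2 ^ K) \<le> real n" using K(1) by (simp only: of_nat_le_iff)
    hence "ln (2 ^ K :: real) \<le> ln (real n)" using n0 by (subst ln_le_cancel_iff) auto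
    hence "real K * ln 2 \<le> ln (real n)" by (simp add: ln_realpow)
    moreover have "real K * (1 / 2) \<le> real K * ln 2" using ln2 by (intro mult_left_mono) auto
    ultimately show ?thesis using lnn by linarith
  qed
  define c where "c = sqrt (3 ^ d :: real)"
  have c0: "0 \<le> c" by (simp add: c_def)
  define q where "q = real n powr (- 1 / 2)"
  have q: "1 / sqrt (real n) = q" 
    using powr_minus_divide[of "real n" "1 / 2"] powr_half_sqrt[of "real n"] n0 by (simp add: q_def)
  have qr: "0 \<le> q" "0 \<le> r" by (auto simp: q_def r_def)
  have "(\<Sum>k\<le>K. sqrt ((3 * 2 ^ k) ^ d / real n) / 2 ^ k) \<le> (\<Sum>k\<le>K. c * (q + 2 * r))"
  proof (intro sum_mono)
    fix k assume "k \<in> {..K}"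
    have "sqrt ((3 * 2 ^ k) ^ d / real n) / 2 ^ k = c * (sqrt ((2 ^ k) ^ d) / 2 ^ k) * (1 / sqrt (real n))"
      by (simp add: c_def power_mult_distrib real_sqrt_mult real_sqrt_divide)
    also have "\<dots> \<le> c * (1 + 2 * (sqrt (real n) * r)) * (1 / sqrt (real n))"
      using term_bound \<open>k \<in> {..K}\<close> c0 by (intro mult_right_mono mult_left_mono) auto
    also have "\<dots> = c * (1 / sqrt (real n) + 2 * r)" using n0 by (simp add: field_simps)
    finally show "sqrt ((3 * 2 ^ k) ^ d / real n) / 2 ^ k \<le> c * (q + 2 * r)" unfolding q .
  qed
  also have "\<dots> = (real K + 1) * (c * (q + 2 * r))" by simp
  also have "\<dots> \<le> (4 * ln (real n)) * (c * (q + 2 * r))"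
    using Kln c0 qr by (intro mult_right_mono) auto
  also have "\<dots> \<le> (4 * ln (real n)) * (c * (2 * (q + r)))"
    using c0 qr lnn by (intro mult_left_mono) auto
  finally have 1: "(\<Sum>k\<le>K. sqrt ((3 * 2 ^ k) ^ d / real n) / 2 ^ k) \<le> 8 * c * ((q + r) * ln (real n))"
    by (simp add: algebra_simps)
  have "2 / 2 ^ K \<le> 4 * (r * 1)" using K1 by simp
  also have "\<dots> \<le> 4 * ((q + r) * (2 * ln (real n)))"
    using qr lnn by (intro mult_left_mono mult_mono) auto
  finally have 2: "2 / 2 ^ K \<le> 8 * ((q + r) * ln (real n))" by simp
  show ?thesis
    by (rule that[of K], unfold c_def[symmetric] q_def[symmetric] r_def[symmetric])
       (use 1 2 in \<open>simp add: distrib_right\<close>)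
qed

section \<open>Replacing latent positions\<close>

lemma finite_set_Pi_bernoulli:
  assumes "finite I"
  shows "finite (set_pmf (Pi_pmf I False (\<lambda>i. bernoulli_pmf (p i))))"
  using assms by (intro finite_subset[OF set_Pi_pmf_subset'] finite_PiE_dflt) auto

text \<open>Condition on one coordinate at a time. Changing its parameter costs the change times the
  mean effect of a flip, at most \<open>L\<close>; with the coordinate frozen, the function still
  has flips bounded by \<open>L\<close> in the others. The bound is that of the monotone coupling,
  obtained without constructing it.\<close>

lemma Pi_bernoulli_expectation_lipschitz:
  fixes f :: "('a \<Rightarrow> bool) \<Rightarrow> real"
  assumes "finite I" and "\<And>i. i \<in> I \<Longrightarrow> p i \<in> {0..1} \<and> q i \<in> {0..1}"
    and "\<And>e i. i \<in> I \<Longrightarrow> \<bar>f (e(i := True)) - f (e(i := False))\<bar> \<le> L"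
  shows "\<bar>measure_pmf.expectation (Pi_pmf I False (\<lambda>i. bernoulli_pmf (p i))) f
       - measure_pmf.expectation (Pi_pmf I False (\<lambda>i. bernoulli_pmf (q i))) f\<bar> \<le> L * (\<Sum>i\<in>I. \<bar>p i - q i\<bar>)"
  using assms
proof (induction I arbitrary: f rule: finite_induct)
  case (insert x I)
  define G where "G = (\<lambda>p b. measure_pmf.expectation (Pi_pmf I False (\<lambda>i. bernoulli_pmf (p i))) (\<lambda>e. f (e(x := b))))"
  have split: "measure_pmf.expectation (Pi_pmf (insert x I) False (\<lambda>i. bernoulli_pmf (r i))) f
      = r x * G r True + (1 - r x) * G r False" if r: "r x \<in> {0..1}" for r :: "'a \<Rightarrow> real"
  proof -
    have "Pi_pmf (insert x I) False (\<lambda>i. bernoulli_pmf (r i)) =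
        bernoulli_pmf (r x) \<bind> (\<lambda>b. map_pmf (\<lambda>e. e(x := b)) (Pi_pmf I False (\<lambda>i. bernoulli_pmf (r i))))"
      using insert(1,2) by (simp add: Pi_pmf_insert' map_pmf_def)
    also have "measure_pmf.expectation \<dots> f = (\<Sum>b\<in>UNIV. pmf (bernoulli_pmf (r x)) b *\<^sub>R
        measure_pmf.expectation (map_pmf (\<lambda>e. e(x := b)) (Pi_pmf I False (\<lambda>i. bernoulli_pmf (r i)))) f)"
      using insert(1) by (intro pmf_expectation_bind) (auto simp: finite_set_Pi_bernoulli)
    also have "\<dots> = (\<Sum>b\<in>UNIV. pmf (bernoulli_pmf (r x)) b * G r b)"
      by (simp only: G_def integral_map_pmf real_scaleR_def)
    finally show ?thesis using r by (simp add: UNIV_bool)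
  qed
  define D where "D = L * (\<Sum>i\<in>I. \<bar>p i - q i\<bar>)"
  have IH: "\<bar>G p b - G q b\<bar> \<le> D" for b
    unfolding G_def D_def
  proof (rule insert.IH)
    show "p i \<in> {0..1} \<and> q i \<in> {0..1}" if "i \<in> I" for i using insert.prems(1) that by simp
    fix e i assume i: "i \<in> I"
    hence "i \<noteq> x" using insert(2) by auto
    hence eq: "e(i := v, x := b) = e(x := b, i := v)" for v by (rule fun_upd_twist)
    show "\<bar>f (e(i := True, x := b)) - f (e(i := False, x := b))\<bar> \<le> L"
      unfolding eq by (rule insert.prems(2)) (use i in simp)
  qed
  have fin: "integrable (measure_pmf (Pi_pmf I False (\<lambda>i. bernoulli_pmf (q i)))) h" for h :: "_ \<Rightarrow> real"
    by (intro integrable_measure_pmf_finite finite_set_Pi_bernoulli insert(1))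
  have flip: "\<bar>G q True - G q False\<bar> \<le> L"
  proof -
    have "\<bar>G q True - G q False\<bar> = \<bar>measure_pmf.expectation (Pi_pmf I False (\<lambda>i. bernoulli_pmf (q i)))
          (\<lambda>e. f (e(x := True)) - f (e(x := False)))\<bar>"
      unfolding G_def by (subst Bochner_Integration.integral_diff) (auto intro: fin)
    also have "\<dots> \<le> measure_pmf.expectation (Pi_pmf I False (\<lambda>i. bernoulli_pmf (q i)))
          (\<lambda>e. \<bar>f (e(x := True)) - f (e(x := False))\<bar>)" by (rule integral_abs_bound)
    also have "\<dots> \<le> measure_pmf.expectation (Pi_pmf I False (\<lambda>i. bernoulli_pmf (q i))) (\<lambda>_. L)"
      by (intro integral_mono fin insert.prems(2)) auto
    finally show ?thesis by simp
  qed
  have px: "p x \<in> {0..1}" "q x \<in> {0..1}" using insert.prems(1) by auto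
  \<comment> \<open>The first two terms change the law of the other coordinates at a frozen value of
    x, the third changes the parameter of x alone.\<close>
  have "p x * G p True + (1 - p x) * G p False - (q x * G q True + (1 - q x) * G q False)
      = p x * (G p True - G q True) + (1 - p x) * (G p False - G q False) + (p x - q x) * (G q True - G q False)"
    by (simp add: algebra_simps)
  also have "\<bar>\<dots>\<bar> \<le> p x * D + (1 - p x) * D + \<bar>p x - q x\<bar> * L"
  proof -
    have "\<bar>p x * (G p True - G q True)\<bar> \<le> p x * D"
      using px IH by (simp add: abs_mult mult_left_mono)
    moreover have "\<bar>(1 - p x) * (G p False - G q False)\<bar> \<le> (1 - p x) * D"
      using px IH by (simp add: abs_mult mult_left_mono)
    moreover have "\<bar>(p x - q x) * (G q True - G q False)\<bar> \<le> \<bar>p x - q x\<bar> * L"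
      using flip by (simp add: abs_mult mult_left_mono)
    ultimately show ?thesis by linarith
  qed
  also have "\<dots> = L * (\<Sum>i\<in>insert x I. \<bar>p i - q i\<bar>)"
    using insert(1,2) by (simp add: D_def algebra_simps)
  finally show ?case using split[of p] split[of q] px by simp
qed simp

text \<open>A hybrid argument: by Fubini one coordinate is integrated out, where exchanging P for Q
  costs at most \<open>\<epsilon>\<close> uniformly in the others. \<open>one\<close> is a dual
  1-Wasserstein bound at Lipschitz constant \<open>L\<close>. Boundedness and measurability of
  \<open>\<psi>\<close> are carried along because the induction applies to partially integrated
  functions.\<close>

lemma PiM_lipschitz_replace:
  fixes \<psi> :: "('i \<Rightarrow> real ^ 'd::finite) \<Rightarrow> real"
  assumes "finite I"
    and P: "prob_space P" "sets P = sets borel" and Q: "prob_space Q" "sets Q = sets borel"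
    and L: "0 \<le> L"
    and one: "\<And>g. (\<And>y z. \<bar>g y - g z\<bar> \<le> L * norm (y - z)) \<Longrightarrow> (\<integral>x. g x \<partial>P) - (\<integral>x. g x \<partial>Q) \<le> \<epsilon>"
    and "\<And>x. \<bar>\<psi> x\<bar> \<le> B" and "\<psi> \<in> borel_measurable (Pi\<^sub>M I (\<lambda>_. borel))"
    and "\<And>x i y z. i \<in> I \<Longrightarrow> \<bar>\<psi> (x(i := y)) - \<psi> (x(i := z))\<bar> \<le> L * norm (y - z)"
  shows "(\<integral>x. \<psi> x \<partial>Pi\<^sub>M I (\<lambda>_. P)) - (\<integral>x. \<psi> x \<partial>Pi\<^sub>M I (\<lambda>_. Q)) \<le> real (card I) * \<epsilon>"
  using assms(1,8-)
proof (induction I arbitrary: \<psi> rule: finite_induct)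
  case empty
  show ?case by (simp add: PiM_empty)
next
  case (insert j I)
  note bound = insert.prems(1) and meas = insert.prems(2) and lip = insert.prems(3)
  interpret P: prob_space P by fact
  interpret Q: prob_space Q by fact
  interpret PP: product_prob_space "\<lambda>_. P" "insert j I" by unfold_locales
  interpret QQ: product_prob_space "\<lambda>_. Q" "insert j I" by unfold_locales
  have sI: "sets (Pi\<^sub>M J (\<lambda>_. R)) = sets (Pi\<^sub>M J (\<lambda>_. borel))" if "sets R = sets borel"
    for R :: "(real ^ 'd) measure" and J :: "'i set"
    using that by (intro sets_PiM_cong) auto
  have int: "integrable (Pi\<^sub>M J (\<lambda>_. R)) h"
    if "prob_space R" "sets R = sets borel" "h \<in> borel_measurable (Pi\<^sub>M J (\<lambda>_. borel))" "\<And>x. \<bar>h x\<bar> \<le> C"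
    for R :: "(real ^ 'd) measure" and J :: "'i set" and h :: "_ \<Rightarrow> real" and C
  proof -
    interpret J: prob_space "Pi\<^sub>M J (\<lambda>_. R)" by (intro prob_space_PiM that(1))
    show ?thesis
      using that(3,4) by (intro J.integrable_const_bound[of _ C]) (auto cong: measurable_cong_sets simp: sI[OF that(2)])
  qed
  have lipm: "(\<lambda>y. \<psi> (x(j := y))) \<in> borel_measurable borel" for x
  proof (rule borel_measurable_continuous_onI)
    have "L-lipschitz_on UNIV (\<lambda>y. \<psi> (x(j := y)))" 
      by (intro lipschitz_onI L; unfold dist_norm real_norm_def; rule lip[OF insertI1])
    thus "continuous_on UNIV (\<lambda>y. \<psi> (x(j := y)))" by (rule lipschitz_on_continuous_on)
  qed
  have int1: "integrable R (\<lambda>y. \<psi> (x(j := y)))" if "prob_space R" "sets R = sets borel" for R x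
  proof -
    interpret R: prob_space R by fact
    show ?thesis
      using lipm[of x] bound by (intro R.integrable_const_bound[of _ B]) (auto cong: measurable_cong_sets simp: that(2))
  qed
  define u where "u = (\<lambda>R x. \<integral>y. \<psi> (x(j := y)) \<partial>R)"
  have um: "u R \<in> borel_measurable (Pi\<^sub>M I (\<lambda>_. borel))" if R: "prob_space R" "sets R = sets borel" for R
  proof -
    interpret R: prob_space R by fact
    have "(\<lambda>(x, y). \<psi> (x(j := y))) \<in> borel_measurable (Pi\<^sub>M I (\<lambda>_. borel) \<Otimes>\<^sub>M borel)"
      unfolding split_beta' by (rule measurable_compose[OF _ meas]) measurable
    hence "(\<lambda>(x, y). \<psi> (x(j := y))) \<in> borel_measurable (Pi\<^sub>M I (\<lambda>_. borel) \<Otimes>\<^sub>M R)"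
      using R(2) by (simp cong: measurable_cong_sets sets_pair_measure_cong)
    thus ?thesis unfolding u_def by (rule R.borel_measurable_lebesgue_integral)
  qed
  have ub: "\<bar>u R x\<bar> \<le> B" if R: "prob_space R" "sets R = sets borel" for R x
  proof -
    interpret R: prob_space R by fact
    have "\<bar>u R x\<bar> \<le> (\<integral>y. \<bar>\<psi> (x(j := y))\<bar> \<partial>R)" unfolding u_def by (rule integral_abs_bound)
    also have "\<dots> \<le> (\<integral>y. B \<partial>R)" using int1[OF R] bound by (intro integral_mono) auto
    finally show ?thesis by (simp add: R.prob_space)
  qed
  have "(\<integral>x. \<psi> x \<partial>Pi\<^sub>M (insert j I) (\<lambda>_. P)) = (\<integral>x. u P x \<partial>Pi\<^sub>M I (\<lambda>_. P))"
    unfolding u_def by (rule PP.product_integral_insert[OF insert(1,2) int[OF P meas bound]])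
  also have "\<dots> \<le> (\<integral>x. u Q x + \<epsilon> \<partial>Pi\<^sub>M I (\<lambda>_. P))"
  proof (intro integral_mono int[OF P um[OF P] ub[OF P]])
    interpret J: prob_space "Pi\<^sub>M I (\<lambda>_. P)" by (intro prob_space_PiM P)
    show "integrable (Pi\<^sub>M I (\<lambda>_. P)) (\<lambda>x. u Q x + \<epsilon>)"
      by (intro Bochner_Integration.integrable_add int[OF P um[OF Q] ub[OF Q]]) auto
    have "u P x - u Q x \<le> \<epsilon>" for x
      unfolding u_def by (rule one) (rule lip[OF insertI1])
    thus "u P x \<le> u Q x + \<epsilon>" for x by (simp add: algebra_simps)
  qed
  also have "\<dots> = (\<integral>x. u Q x \<partial>Pi\<^sub>M I (\<lambda>_. P)) + \<epsilon>"
  proof -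
    interpret J: prob_space "Pi\<^sub>M I (\<lambda>_. P)" by (intro prob_space_PiM P)
    show ?thesis by (subst Bochner_Integration.integral_add[OF int[OF P um[OF Q] ub[OF Q]]]) (auto simp: J.prob_space)
  qed
  \<comment> \<open>Averaging over the exchanged coordinate keeps the Lipschitz constant in the
    remaining ones, so the induction hypothesis applies to \<open>u Q\<close>.\<close>
  also have "(\<integral>x. u Q x \<partial>Pi\<^sub>M I (\<lambda>_. P)) \<le> (\<integral>x. u Q x \<partial>Pi\<^sub>M I (\<lambda>_. Q)) + real (card I) * \<epsilon>"
  proof -
    have "\<bar>u Q (x(i := y)) - u Q (x(i := z))\<bar> \<le> L * norm (y - z)" if i: "i \<in> I" for x i y z
    proof -
      have ne: "i \<noteq> j" using i insert(2) by auto
      have "\<bar>u Q (x(i := y)) - u Q (x(i := z))\<bar> = \<bar>\<integral>w. \<psi> (x(i := y, j := w)) - \<psi> (x(i := z, j := w)) \<partial>Q\<bar>"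
        unfolding u_def by (subst Bochner_Integration.integral_diff[OF int1[OF Q] int1[OF Q]]) simp
      also have "\<dots> \<le> (\<integral>w. \<bar>\<psi> (x(i := y, j := w)) - \<psi> (x(i := z, j := w))\<bar> \<partial>Q)" by (rule integral_abs_bound)
      also have "\<dots> \<le> (\<integral>w. L * norm (y - z) \<partial>Q)"
      proof (intro integral_mono)
        show "integrable Q (\<lambda>w. \<bar>\<psi> (x(i := y, j := w)) - \<psi> (x(i := z, j := w))\<bar>)"
          by (intro integrable_abs Bochner_Integration.integrable_diff int1[OF Q])
        show "\<bar>\<psi> (x(i := y, j := w)) - \<psi> (x(i := z, j := w))\<bar> \<le> L * norm (y - z)" for w
          unfolding fun_upd_twist[OF ne] by (rule lip) (use i in simp)
      qed auto
      finally show ?thesis by (simp add: Q.prob_space)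
    qed
    from insert.IH[OF ub[OF Q] um[OF Q] this] show ?thesis by simp
  qed
  also have "(\<integral>x. u Q x \<partial>Pi\<^sub>M I (\<lambda>_. Q)) = (\<integral>x. \<psi> x \<partial>Pi\<^sub>M (insert j I) (\<lambda>_. Q))"
    unfolding u_def by (rule QQ.product_integral_insert[OF insert(1,2) int[OF Q meas bound], symmetric])
  finally show ?case using insert(1,2) by (simp add: algebra_simps)
qed

section \<open>Edge laws as functions of the latent positions\<close>

definition clip :: "real \<Rightarrow> real" where
  "clip x = max 0 (min 1 x)"

lemma clip_range: "clip x \<in> {0..1}"
  by (auto simp: clip_def)

lemma clip_lipschitz: "\<bar>clip x - clip y\<bar> \<le> \<bar>x - y\<bar>"
  by (auto simp: clip_def max_def min_def)

lemma edge_pmf_clip: "edge_pmf n X = Pi_pmf (edge_set n) False (\<lambda>z. bernoulli_pmf (clip (inner (X (fst z)) (X (snd z)))))"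
  by (simp add: edge_pmf_def edge_set_def clip_def split_def)

text \<open>A finite set, independent of the positions, that carries every edge law. Expectations
  become finite sums over it with coefficients measurable in the positions.\<close>

definition edge_configs :: "nat \<Rightarrow> (nat \<times> nat \<Rightarrow> bool) set" where
  "edge_configs n = PiE_dflt (edge_set n) False (\<lambda>_. UNIV)"

lemma finite_edge_configs [simp]: "finite (edge_configs n)"
  unfolding edge_configs_def by (intro finite_PiE_dflt) auto

lemma set_edge_pmf: "set_pmf (edge_pmf n X) \<subseteq> edge_configs n"
  unfolding edge_pmf_clip edge_configs_def
  by (rule order_trans[OF set_Pi_pmf_subset']) (auto simp: PiE_dflt_def)

abbreviation edge_mean :: "nat \<Rightarrow> (nat \<Rightarrow> real ^ 'd) \<Rightarrow> ((nat \<times> nat \<Rightarrow> bool) \<Rightarrow> real) \<Rightarrow> real" where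
  "edge_mean n X \<equiv> measure_pmf.expectation (edge_pmf n X)"

lemma edge_expectation_sum:
  fixes f :: "_ \<Rightarrow> real"
  shows "edge_mean n X f = (\<Sum>e\<in>edge_configs n. pmf (edge_pmf n X) e * f e)"
  using integral_measure_pmf[of "edge_configs n" "edge_pmf n X" f] set_edge_pmf[of n X] by auto

lemma pmf_edge_pmf_measurable [measurable]:
  fixes X :: "'x \<Rightarrow> nat \<Rightarrow> real ^ 'd::finite"
  shows "(\<lambda>X :: nat \<Rightarrow> real ^ 'd. pmf (edge_pmf n X) e) \<in> borel_measurable (latent_space n)"
proof -
  have m: "(\<lambda>X :: nat \<Rightarrow> real ^ 'd. pmf (bernoulli_pmf (clip (inner (X i) (X j)))) b) \<in> borel_measurable (latent_space n)"
    if "i < n" "j < n" for i j b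
  proof -
    have "(\<lambda>X :: nat \<Rightarrow> real ^ 'd. clip (inner (X i) (X j))) \<in> borel_measurable (latent_space n)"
      unfolding clip_def using that
      by (intro borel_measurable_max borel_measurable_min borel_measurable_const borel_measurable_inner
          measurable_component_singleton) auto
    moreover have "pmf (bernoulli_pmf (clip x)) b = (if b then clip x else 1 - clip x)" for x
      using clip_range[of x] by auto
    ultimately show ?thesis by (cases b) auto
  qed
  have "pmf (edge_pmf n X) e = (if \<forall>x. x \<notin> edge_set n \<longrightarrow> e x = False then
      \<Prod>z\<in>edge_set n. pmf (bernoulli_pmf (clip (inner (X (fst z)) (X (snd z))))) (e z) else 0)" for X :: "nat \<Rightarrow> real ^ 'd"
    unfolding edge_pmf_clip by (rule pmf_Pi[OF finite_edge_set])
  moreover have "(\<lambda>X :: nat \<Rightarrow> real ^ 'd. \<Prod>z\<in>edge_set n. pmf (bernoulli_pmf (clip (inner (X (fst z)) (X (snd z))))) (e z))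
      \<in> borel_measurable (latent_space n)"
    by (intro borel_measurable_prod m) (auto simp: edge_set_def)
  ultimately show ?thesis by simp
qed

section \<open>Hamming distance and graph matching distance\<close>

definition hamming :: "nat \<Rightarrow> real mat \<Rightarrow> real mat \<Rightarrow> real" where
  "hamming n A B = inverse (real (n choose 2)) * (l1_norm (A - B) / 2)"

lemma adj_mats_carrier: "A \<in> adj_mats n \<Longrightarrow> A \<in> carrier_mat n n"
  by (simp add: adj_mats_def)

lemma adj_of_edges_in_adj_mats: "adj_of_edges n e \<in> adj_mats n"
  by (auto simp: adj_mats_def adj_of_edges_def min.commute max.commute)

lemma adj_mats_eq_image: "adj_mats n = adj_of_edges n ` edge_configs n"
proof
  show "adj_of_edges n ` edge_configs n \<subseteq> adj_mats n" using adj_of_edges_in_adj_mats by blast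
  show "adj_mats n \<subseteq> adj_of_edges n ` edge_configs n"
  proof
    fix A assume A: "A \<in> adj_mats n"
    define e where "e = (\<lambda>z. z \<in> edge_set n \<and> A $$ z = 1)"
    have e: "e \<in> edge_configs n" by (auto simp: e_def edge_configs_def PiE_dflt_def)
    have "A = adj_of_edges n e"
    proof (rule eq_matI)
      fix i j assume "i < dim_row (adj_of_edges n e)" "j < dim_col (adj_of_edges n e)"
      hence ij: "i < n" "j < n" by (auto simp: adj_of_edges_def)
      have sym: "A $$ (i, j) = A $$ (j, i)" and bit: "A $$ (i, j) = 0 \<or> A $$ (i, j) = 1" and diag: "A $$ (i, i) = 0"
        using A ij by (auto simp: adj_mats_def)
      consider "i < j" | "i = j" | "j < i" by linarith
      thus "A $$ (i, j) = adj_of_edges n e $$ (i, j)"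
      proof cases
        case 1 thus ?thesis using ij bit by (auto simp: adj_of_edges_def e_def edge_set_def)
      next
        case 2 thus ?thesis using ij diag by (simp add: adj_of_edges_def)
      next
        case 3 thus ?thesis using ij bit sym by (auto simp: adj_of_edges_def e_def edge_set_def)
      qed
    qed (use adj_mats_carrier[OF A] in \<open>auto simp: adj_of_edges_def\<close>)
    thus "A \<in> adj_of_edges n ` edge_configs n" using e by blast
  qed
qed

lemma finite_adj_mats [simp]: "finite (adj_mats n)"
  unfolding adj_mats_eq_image by simp

lemma card_edge_set: "card (edge_set n) = n choose 2"
proof -
  have "(\<Sum>i<n. \<Sum>j<n. if i \<noteq> j then 1 else 0 :: nat) = (\<Sum>i<n. n - 1)"
  proof (intro sum.cong refl)
    fix i assume i: "i \<in> {..<n}"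
    have "(\<Sum>j<n. if i \<noteq> j then 1 else 0 :: nat) = card ({..<n} - {i})"
      by (simp add: sum.If_cases Int_def set_diff_eq eq_commute)
    thus "(\<Sum>j<n. if i \<noteq> j then 1 else 0 :: nat) = n - 1" using i by simp
  qed
  hence "2 * card (edge_set n) = n * (n - 1)"
    using sum_offdiag[where n = n and g = "\<lambda>_ _. 1 :: nat"] by (simp add: case_prod_beta)
  thus ?thesis by (simp add: choose_two)
qed

lemma hamming_adj_of_edges:
  "hamming n (adj_of_edges n e) (adj_of_edges n e') =
     inverse (real (n choose 2)) * (\<Sum>z\<in>edge_set n. \<bar>of_bool (e z) - of_bool (e' z)\<bar>)"
proof -
  define w where "w = (\<lambda>z. \<bar>of_bool (e z) - of_bool (e' z)\<bar> :: real)"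
  have "l1_norm (adj_of_edges n e - adj_of_edges n e') = (\<Sum>i<n. \<Sum>j<n. if i \<noteq> j then w (min i j, max i j) else 0)"
    unfolding l1_norm_def
    by (simp add: adj_of_edges_def, intro sum.cong refl) (auto simp: w_def)
  also have "\<dots> = (\<Sum>(i, j)\<in>edge_set n. w (min i j, max i j) + w (min j i, max j i))" by (rule sum_offdiag)
  also have "\<dots> = (\<Sum>z\<in>edge_set n. 2 * w z)" by (intro sum.cong refl) (auto simp: edge_set_def)
  finally show ?thesis by (simp add: hamming_def w_def sum_distrib_left[symmetric])
qed

lemma hamming_bounds:
  assumes "A \<in> adj_mats n" "B \<in> adj_mats n"
  shows "0 \<le> hamming n A B" "hamming n A B \<le> 1"
proof -
  obtain e e' where e: "A = adj_of_edges n e" "B = adj_of_edges n e'" using assms by (auto simp: adj_mats_eq_image)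
  show "0 \<le> hamming n A B" unfolding e hamming_adj_of_edges by (intro mult_nonneg_nonneg sum_nonneg) auto
  have "(\<Sum>z\<in>edge_set n. \<bar>of_bool (e z) - of_bool (e' z)\<bar> :: real) \<le> (\<Sum>z\<in>edge_set n. 1)"
    by (intro sum_mono) auto
  also have "\<dots> = real (n choose 2)" by (simp add: card_edge_set)
  finally have "hamming n A B \<le> inverse (real (n choose 2)) * real (n choose 2)"
    unfolding e hamming_adj_of_edges by (intro mult_left_mono) auto
  \<comment> \<open>For n < 2 there are no pairs and \<open>inverse 0 = 0\<close>, so the product is
    0 and only an inequality holds in general.\<close>
  also have "inverse x * x \<le> 1" for x :: real by (cases "x = 0") auto
  finally show "hamming n A B \<le> 1" .
qed

lemma hamming_self: "A \<in> adj_mats n \<Longrightarrow> hamming n A A = 0"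
  by (auto simp: adj_mats_eq_image hamming_adj_of_edges)

lemma hamming_triangle:
  assumes "A \<in> adj_mats n" "B \<in> adj_mats n" "C \<in> adj_mats n"
  shows "hamming n A C \<le> hamming n A B + hamming n B C"
proof -
  obtain e e' e'' where e: "A = adj_of_edges n e" "B = adj_of_edges n e'" "C = adj_of_edges n e''"
    using assms by (auto simp: adj_mats_eq_image)
  show ?thesis unfolding e hamming_adj_of_edges distrib_left[symmetric] sum.distrib[symmetric]
    by (intro mult_left_mono sum_mono) auto
qed

lemma finite_perm_mats [simp]: "finite (perm_mats n)"
proof -
  have "perm_mats n = (\<lambda>\<sigma>. mat n n (\<lambda>(i, j). if i = \<sigma> j then 1 else 0)) ` {\<sigma>. \<sigma> permutes {..<n}}"
    by (auto simp: perm_mats_def)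
  thus ?thesis by (simp add: finite_permutations)
qed

lemma one_mat_in_perm_mats: "1\<^sub>m n \<in> perm_mats n"
  unfolding perm_mats_def one_mat_def
  by (auto intro!: exI[of _ id] permutes_id)

lemma d_GM_bounds:
  assumes A: "A \<in> adj_mats n" and B: "B \<in> adj_mats n"
  shows "0 \<le> d_GM A B" "d_GM A B \<le> hamming n A B"
proof -
  have n: "dim_row A = n" using adj_mats_carrier[OF A] by simp
  let ?f = "\<lambda>P. inverse (real (n choose 2)) * (l1_norm (A - P * B * transpose_mat P) / 2)"
  have d: "d_GM A B = Min (?f ` perm_mats n)" by (simp add: d_GM_def n)
  have ne: "perm_mats n \<noteq> {}" using one_mat_in_perm_mats by blast
  show "0 \<le> d_GM A B" unfolding d using ne
    by (subst Min_ge_iff) (auto simp: l1_norm_def intro!: mult_nonneg_nonneg sum_nonneg divide_nonneg_nonneg)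
  have "?f (1\<^sub>m n) = hamming n A B"
    using adj_mats_carrier[OF B] by (simp add: hamming_def)
  moreover have "d_GM A B \<le> ?f (1\<^sub>m n)" 
    unfolding d by (rule Min_le[OF finite_imageI[OF finite_perm_mats] imageI[OF one_mat_in_perm_mats]])
  ultimately show "d_GM A B \<le> hamming n A B" by simp
qed

lemma d_GM_powr_le_hamming:
  assumes A: "A \<in> adj_mats n" and B: "B \<in> adj_mats n" and p: "1 \<le> p"
  shows "d_GM A B powr p \<le> hamming n A B"
proof -
  have "d_GM A B powr p \<le> d_GM A B powr 1"
    using d_GM_bounds[OF A B] hamming_bounds[OF A B] p by (intro powr_mono') auto
  thus ?thesis using d_GM_bounds[OF A B] by simp
qed

definition hamming_lipschitz :: "nat \<Rightarrow> (real mat \<Rightarrow> real) \<Rightarrow> bool" where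
  "hamming_lipschitz n \<phi> \<longleftrightarrow> (\<forall>A\<in>adj_mats n. \<forall>B\<in>adj_mats n. \<phi> A - \<phi> B \<le> hamming n A B)"

text \<open>The conditional expectation of \<open>\<phi>\<close> of the graph given the positions.
  The expectations under both models are averages of this one function over i.i.d. positions, drawn
  from F or from an empirical measure.\<close>

definition graph_mean :: "nat \<Rightarrow> (real mat \<Rightarrow> real) \<Rightarrow> (nat \<Rightarrow> real ^ 'd) \<Rightarrow> real" where
  "graph_mean n \<phi> X = edge_mean n X (\<lambda>e. \<phi> (adj_of_edges n e))"

lemma graph_mean_cong: "(\<And>i. i < n \<Longrightarrow> X i = Y i) \<Longrightarrow> graph_mean n \<phi> X = graph_mean n \<phi> Y"
proof -
  assume *: "\<And>i. i < n \<Longrightarrow> X i = Y i"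
  have "edge_pmf n X = edge_pmf n Y"
    unfolding edge_pmf_def by (rule Pi_pmf_cong) (auto simp: *)
  thus ?thesis by (simp add: graph_mean_def)
qed

lemma graph_mean_measurable [measurable]:
  "(graph_mean n \<phi> :: (nat \<Rightarrow> real ^ 'd::finite) \<Rightarrow> real) \<in> borel_measurable (latent_space n)"
  unfolding graph_mean_def[abs_def] edge_expectation_sum by measurable

lemma graph_mean_bounded:
  "\<bar>graph_mean n \<phi> X\<bar> \<le> (\<Sum>A\<in>adj_mats n. \<bar>\<phi> A\<bar>)"
proof -
  have "\<bar>graph_mean n \<phi> X\<bar> \<le> edge_mean n X (\<lambda>e. \<bar>\<phi> (adj_of_edges n e)\<bar>)"
    unfolding graph_mean_def by (rule integral_abs_bound)
  also have "\<dots> \<le> edge_mean n X (\<lambda>_. \<Sum>A\<in>adj_mats n. \<bar>\<phi> A\<bar>)"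
  proof (rule integral_mono)
    show "integrable (measure_pmf (edge_pmf n X)) (\<lambda>e. \<bar>\<phi> (adj_of_edges n e)\<bar>)"
      by (intro integrable_measure_pmf_finite finite_subset[OF set_edge_pmf]) simp
    show "\<bar>\<phi> (adj_of_edges n e)\<bar> \<le> (\<Sum>A\<in>adj_mats n. \<bar>\<phi> A\<bar>)" for e
      by (intro member_le_sum[of "adj_of_edges n e" _ "\<lambda>A. \<bar>\<phi> A\<bar>"] adj_of_edges_in_adj_mats) auto
  qed simp
  finally show ?thesis by simp
qed

text \<open>Flipping one edge moves a graph by exactly 1 / binom(n, 2) in normalised Hamming
  distance, which is the flip constant for the product of Bernoulli laws.\<close>

lemma graph_mean_lipschitz:
  assumes "hamming_lipschitz n \<phi>"
  shows "\<bar>graph_mean n \<phi> X - graph_mean n \<phi> Y\<bar> \<le> inverse (real (n choose 2)) *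
    (\<Sum>z\<in>edge_set n. \<bar>clip (inner (X (fst z)) (X (snd z))) - clip (inner (Y (fst z)) (Y (snd z)))\<bar>)"
  unfolding graph_mean_def edge_pmf_clip
proof (rule Pi_bernoulli_expectation_lipschitz)
  fix e z assume z: "z \<in> edge_set n"
  let ?A = "adj_of_edges n (e(z := True))" and ?B = "adj_of_edges n (e(z := False))"
  have h: "hamming n (adj_of_edges n (e(z := b))) (adj_of_edges n (e(z := \<not> b))) = inverse (real (n choose 2))" for b
  proof -
    have "(\<Sum>z'\<in>edge_set n. \<bar>of_bool ((e(z := b)) z') - of_bool ((e(z := \<not> b)) z')\<bar> :: real)
      = (\<Sum>z'\<in>edge_set n. if z' = z then 1 else 0)" by (intro sum.cong refl) auto
    also have "\<dots> = 1" using z by simp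
    finally show ?thesis unfolding hamming_adj_of_edges by simp
  qed
  have "hamming n ?A ?B = inverse (real (n choose 2))" "hamming n ?B ?A = inverse (real (n choose 2))"
    using h[of True] h[of False] by (simp_all only: not_True_eq_False not_False_eq_True)
  moreover have "\<phi> ?A - \<phi> ?B \<le> hamming n ?A ?B" "\<phi> ?B - \<phi> ?A \<le> hamming n ?B ?A"
    using assms adj_of_edges_in_adj_mats unfolding hamming_lipschitz_def by blast+
  ultimately show "\<bar>\<phi> ?A - \<phi> ?B\<bar> \<le> inverse (real (n choose 2))" by linarith
qed (use clip_range in auto)

text \<open>Points outside the unit ball are projected onto it, which makes the graph mean globally
  Lipschitz in each latent position.\<close>

lemma empirical_graph_mean:
  fixes F :: "(real ^ 'd::finite) measure" and X :: "nat \<Rightarrow> real ^ 'd"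
  assumes n: "2 \<le> n" and lip: "hamming_lipschitz n \<phi>"
    and F: "unit_ball_measure F" and X: "\<And>i. i < n \<Longrightarrow> norm (X i) \<le> 1"
  shows "(\<integral>x. graph_mean n \<phi> x \<partial>iid n (empirical n X)) - (\<integral>x. graph_mean n \<phi> x \<partial>iid n F)
     \<le> 2 * real CARD('d) * (cell_deviation K (empirical n X) F + 2 / 2 ^ K)"
proof -
  interpret F: unit_ball_measure F by fact
  interpret G: unit_ball_measure "empirical n X"
  proof -
    have "prob_space (empirical n X)" unfolding empirical_def
      by (intro prob_space.prob_space_distr measure_pmf.prob_space_axioms) auto
    moreover have "AE x in empirical n X. norm x \<le> 1"
      unfolding empirical_def using n X
      by (subst AE_distr_iff) (auto simp: AE_measure_pmf_iff set_pmf_of_set lessThan_empty_iff)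
    moreover have "sets (empirical n X) = sets borel" by (simp add: empirical_def)
    ultimately show "unit_ball_measure (empirical n X)"
      by (simp add: unit_ball_measure_def unit_ball_measure_axioms_def)
  qed
  define \<pi> where "\<pi> = closest_point (cball (0 :: real ^ 'd) 1)"
  have \<pi>_ball: "norm (\<pi> x) \<le> 1" for x
    using closest_point_in_set[of "cball (0 :: real ^ 'd) 1" x] by (simp add: \<pi>_def)
  have \<pi>_id: "\<pi> x = x" if "norm x \<le> 1" for x
    using that by (simp add: \<pi>_def closest_point_self)
  have \<pi>_lip: "norm (\<pi> x - \<pi> y) \<le> norm (x - y)" for x y
    using closest_point_lipschitz[of "cball (0 :: real ^ 'd) 1" x y] by (simp add: \<pi>_def dist_norm)
  have \<pi>_meas [measurable]: "\<pi> \<in> borel_measurable borel"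
    unfolding \<pi>_def by (intro borel_measurable_continuous_onI continuous_on_closest_point) auto
  define \<psi> where "\<psi> = (\<lambda>x. graph_mean n \<phi> (\<lambda>i\<in>{..<n}. \<pi> (x i)))"
  have \<psi>_bound: "\<bar>\<psi> x\<bar> \<le> (\<Sum>A\<in>adj_mats n. \<bar>\<phi> A\<bar>)" for x unfolding \<psi>_def by (rule graph_mean_bounded)
  have \<psi>_meas: "\<psi> \<in> borel_measurable (latent_space n)"
    unfolding \<psi>_def by (rule measurable_compose[OF _ graph_mean_measurable]) measurable
  have nn: "real (n choose 2) = real n * (real n - 1) / 2"
    using n by (simp add: choose_two real_of_nat_div of_nat_diff)
  have \<psi>_lip: "\<bar>\<psi> (x(i := y)) - \<psi> (x(i := z))\<bar> \<le> 2 / real n * norm (y - z)" if i: "i \<in> {..<n}" for x i y z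
  proof -
    let ?Y = "\<lambda>k\<in>{..<n}. \<pi> ((x(i := y)) k)" and ?Z = "\<lambda>k\<in>{..<n}. \<pi> ((x(i := z)) k)"
    \<comment> \<open>Only pairs containing the moved vertex i are affected. The other member lies
      in the ball after projection, so by Cauchy-Schwarz the inner product changes by at most the
      displacement.\<close>
    define w where "w = (\<lambda>k l. if k = i \<or> l = i then norm (y - z) else 0)"
    have D: "\<bar>clip (inner (?Y k) (?Y l)) - clip (inner (?Z k) (?Z l))\<bar> \<le> w k l" if kl: "k < n" "l < n" "k \<noteq> l" for k l
    proof -
      have step: "\<bar>inner a (\<pi> y) - inner a (\<pi> z)\<bar> \<le> norm (y - z)" if "norm a \<le> 1" for a
      proof -
        have "\<bar>inner a (\<pi> y - \<pi> z)\<bar> \<le> norm a * norm (\<pi> y - \<pi> z)" by (rule Cauchy_Schwarz_ineq2)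
        also have "\<dots> \<le> 1 * norm (y - z)" using that \<pi>_lip by (intro mult_mono) auto
        finally show ?thesis by (simp add: inner_diff_right)
      qed
      have step': "\<bar>inner (\<pi> y) a - inner (\<pi> z) a\<bar> \<le> norm (y - z)" if "norm a \<le> 1" for a
        using step[OF that] by (simp add: inner_commute)
      have "\<bar>inner (?Y k) (?Y l) - inner (?Z k) (?Z l)\<bar> \<le> w k l"
        using kl step[OF \<pi>_ball] step'[OF \<pi>_ball] by (auto simp: w_def)
      thus ?thesis using clip_lipschitz order_trans by blast
    qed
    have "\<bar>\<psi> (x(i := y)) - \<psi> (x(i := z))\<bar> \<le> inverse (real (n choose 2)) *
        (\<Sum>v\<in>edge_set n. \<bar>clip (inner (?Y (fst v)) (?Y (snd v))) - clip (inner (?Z (fst v)) (?Z (snd v)))\<bar>)"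
      unfolding \<psi>_def by (rule graph_mean_lipschitz[OF lip])
    also have "\<dots> \<le> inverse (real (n choose 2)) * (\<Sum>v\<in>edge_set n. w (fst v) (snd v))"
      by (intro mult_left_mono sum_mono D) (auto simp: edge_set_def)
    also have "(\<Sum>v\<in>edge_set n. w (fst v) (snd v)) = (real n - 1) * norm (y - z)"
    proof -
      have "2 * (\<Sum>v\<in>edge_set n. w (fst v) (snd v)) = (\<Sum>(k, l)\<in>edge_set n. w k l + w l k)"
        unfolding sum_distrib_left by (intro sum.cong refl) (auto simp: w_def)
      also have "\<dots> = (\<Sum>k<n. \<Sum>l<n. if k \<noteq> l then w k l else 0)" by (rule sum_offdiag[symmetric])
      \<comment> \<open>Row i plus column i, less the diagonal entry (i, i), which is counted twice
        there and must not be counted at all.\<close>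
      also have "\<dots> = (\<Sum>k<n. \<Sum>l<n. (if k = i then norm (y - z) else 0) + (if l = i then norm (y - z) else 0)
           - (if k = i then if l = i then 2 * norm (y - z) else 0 else 0))"
        by (intro sum.cong refl) (auto simp: w_def)
      also have "\<dots> = 2 * ((real n - 1) * norm (y - z))"
      proof -
        have 1: "(\<Sum>k<n. \<Sum>l<n. if k = i then v else 0) = real n * v" for v :: real
          using i by (simp flip: sum_distrib_left)
        have 2: "(\<Sum>k<n. \<Sum>l<n. if l = i then v else 0) = real n * v" for v :: real
          using i by simp
        have "(\<Sum>k<n. \<Sum>l<n. if k = i then if l = i then v else 0 else 0)
            = (\<Sum>k<n. if k = i then \<Sum>l<n. if l = i then v else 0 else 0)" for v :: real
          by (intro sum.cong refl) auto
        hence 3: "(\<Sum>k<n. \<Sum>l<n. if k = i then if l = i then v else 0 else 0) = v" for v :: real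
          using i by simp
        show ?thesis unfolding sum.distrib sum_subtractf 1 2 3 by (simp add: algebra_simps)
      qed
      finally show ?thesis by simp
    qed
    also have "inverse (real (n choose 2)) * ((real n - 1) * norm (y - z)) = 2 / real n * norm (y - z)"
      using n unfolding nn by (simp add: field_simps)
    finally show ?thesis .
  qed
  \<comment> \<open>The Lipschitz constant 2 / n is (n - 1) / binom(n, 2); it cancels the number n
    of replacements.\<close>
  let ?\<epsilon> = "2 / real n * real CARD('d) * (cell_deviation K (empirical n X) F + 2 / 2 ^ K)"
  have main: "(\<integral>x. \<psi> x \<partial>iid n (empirical n X)) - (\<integral>x. \<psi> x \<partial>iid n F) \<le> real (card {..<n}) * ?\<epsilon>"
  proof (rule PiM_lipschitz_replace[OF _ G.prob_space_axioms G.sets_eq F.prob_space_axioms F.sets_eq _ _ \<psi>_bound \<psi>_meas \<psi>_lip])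
    show "(\<integral>x. g x \<partial>empirical n X) - (\<integral>x. g x \<partial>F) \<le> ?\<epsilon>"
      if "\<And>y z. \<bar>g y - g z\<bar> \<le> 2 / real n * norm (y - z)" for g
      by (rule lipschitz_integral_cell_deviation[OF G.unit_ball_measure_axioms F _ that]) auto
  qed auto
  \<comment> \<open>Under either measure all positions lie in the ball almost surely, so the
    projection does not change the integral.\<close>
  have eq: "(\<integral>x. \<psi> x \<partial>iid n R) = (\<integral>x. graph_mean n \<phi> x \<partial>iid n R)"
    if R: "unit_ball_measure R" for R :: "(real ^ 'd) measure"
  proof -
    interpret R: unit_ball_measure R by fact
    have s: "sets (iid n R) = sets (latent_space n)" using R.sets_eq by (intro sets_PiM_cong) auto
    have m: "h \<in> borel_measurable (latent_space n) \<Longrightarrow> h \<in> borel_measurable (iid n R)" for h :: "_ \<Rightarrow> real"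
      by (simp cong: measurable_cong_sets add: s)
    have "AE x in iid n R. \<forall>i\<in>{..<n}. norm (x i) \<le> 1"
      by (intro AE_finite_allI AE_PiM_component R.prob_space_axioms R.AE_ball) auto
    hence "AE x in iid n R. \<psi> x = graph_mean n \<phi> x"
    proof eventually_elim
      case (elim x)
      thus ?case unfolding \<psi>_def by (intro graph_mean_cong) (auto simp: \<pi>_id)
    qed
    thus ?thesis by (intro integral_cong_AE m \<psi>_meas graph_mean_measurable)
  qed
  have "real (card {..<n}) * ?\<epsilon> = 2 * real CARD('d) * (cell_deviation K (empirical n X) F + 2 / 2 ^ K)"
    using n by (simp add: field_simps)
  thus ?thesis using main unfolding eq[OF F] eq[OF G.unit_ball_measure_axioms] by linarith
qed

text \<open>Both samples are drawn with the same i.i.d. uniform indices, applied once to the rows of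
  Y and once to those of X. A pair of distinct vertices then receives a uniform pair of indices,
  possibly equal, so the expected discrepancy per edge is the average over all n^2 pairs, diagonal
  included.\<close>

lemma resampled_graph_mean:
  fixes X Y :: "nat \<Rightarrow> real ^ 'd::finite"
  assumes n: "2 \<le> n" and lip: "hamming_lipschitz n \<phi>"
  shows "(\<integral>x. graph_mean n \<phi> x \<partial>iid n (empirical n Y)) - (\<integral>x. graph_mean n \<phi> x \<partial>iid n (empirical n X))
     \<le> (\<Sum>k<n. \<Sum>l<n. \<bar>clip (inner (Y k) (Y l)) - clip (inner (X k) (X l))\<bar>) / (real n)\<^sup>2"
proof -
  define U where "U = pmf_of_set {..<n}"
  have setU: "set_pmf U = {..<n}" using n by (auto simp: U_def set_pmf_of_set lessThan_empty_iff)
  define D where "D = (\<lambda>k l. \<bar>clip (inner (Y k) (Y l)) - clip (inner (X k) (X l))\<bar>)"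
  define M where "M = iid n (measure_pmf U)"
  interpret M: prob_space M unfolding M_def by (intro prob_space_PiM measure_pmf.prob_space_axioms)
  have comp_meas: "compose {..<n} Z \<in> M \<rightarrow>\<^sub>M latent_space n" for Z :: "nat \<Rightarrow> real ^ 'd"
    unfolding compose_def M_def by measurable
  \<comment> \<open>An i.i.d. sample from an empirical measure is the image of an i.i.d. sample of
    indices; this places both samples on one probability space.\<close>
  have emp: "iid n (empirical n Z) = distr M (latent_space n) (compose {..<n} Z)" for Z :: "nat \<Rightarrow> real ^ 'd"
  proof -
    let ?E = "empirical n Z"
    have E: "prob_space ?E" "sets ?E = sets borel" unfolding empirical_def
      by (auto intro!: prob_space.prob_space_distr measure_pmf.prob_space_axioms)
    have "distr M (iid n ?E) (compose {..<n} Z) = iid n (distr (measure_pmf U) ?E Z)"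
      unfolding M_def
    proof (rule distr_PiM_finite_prob_space')
      have "Z \<in> measure_pmf U \<rightarrow>\<^sub>M borel" by simp
      thus "Z \<in> measure_pmf U \<rightarrow>\<^sub>M ?E" using measurable_cong_sets[OF refl E(2)] by blast
    qed (auto intro: measure_pmf.prob_space_axioms E)
    also have "distr (measure_pmf U) ?E Z = distr (measure_pmf U) borel Z"
      by (rule distr_cong) (auto simp: E(2))
    also have "\<dots> = ?E" by (simp add: empirical_def U_def)
    also have "distr M (iid n ?E) (compose {..<n} Z) = distr M (latent_space n) (compose {..<n} Z)"
      by (intro distr_cong sets_PiM_cong refl) (simp add: E(2))
    finally show ?thesis by simp
  qed
  have gm: "(\<lambda>I. graph_mean n \<phi> (compose {..<n} Z I)) \<in> borel_measurable M" for Z :: "nat \<Rightarrow> real ^ 'd"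
    by (rule measurable_compose[OF comp_meas graph_mean_measurable])
  have gi: "integrable M (\<lambda>I. graph_mean n \<phi> (compose {..<n} Z I))" for Z :: "nat \<Rightarrow> real ^ 'd"
    by (rule M.integrable_const_bound[OF _ gm]) (auto intro: graph_mean_bounded)
  have pr: "(\<integral>x. graph_mean n \<phi> x \<partial>iid n (empirical n Z)) = (\<integral>I. graph_mean n \<phi> (compose {..<n} Z I) \<partial>M)"
    for Z :: "nat \<Rightarrow> real ^ 'd"
    unfolding emp by (rule integral_distr[OF comp_meas graph_mean_measurable])
  have AEM: "AE I in M. \<forall>i\<in>{..<n}. I i < n"
    unfolding M_def
    by (intro AE_finite_allI AE_PiM_component measure_pmf.prob_space_axioms) (auto simp: AE_measure_pmf_iff setU)
  have Dm: "(\<lambda>I. D (I i) (I j)) \<in> borel_measurable M" if "i < n" "j < n" for i j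
  proof -
    have [measurable]: "(\<lambda>I. I k) \<in> M \<rightarrow>\<^sub>M count_space UNIV" if "k < n" for k
    proof -
      have "(\<lambda>I. I k) \<in> M \<rightarrow>\<^sub>M measure_pmf U"
        unfolding M_def using that by (intro measurable_component_singleton) auto
      thus ?thesis using measurable_cong_sets[OF refl sets_measure_pmf_count_space] by blast
    qed
    show ?thesis using that by measurable
  qed
  have D01: "\<bar>D k l\<bar> \<le> 1" for k l
    using clip_range[of "inner (Y k) (Y l)"] clip_range[of "inner (X k) (X l)"] by (auto simp: D_def)
  have Di: "integrable M (\<lambda>I. D (I i) (I j))" if "i < n" "j < n" for i j
    by (rule M.integrable_const_bound[of _ 1]) (use D01 Dm[OF that] in auto)
  have ind: "integrable (measure_pmf U) (\<lambda>a. indicator {k} a :: real)" 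
     "(\<integral>a. indicator {k} a \<partial>measure_pmf U) = (if k < n then 1 / real n else 0)" for k
  proof -
    show "integrable (measure_pmf U) (\<lambda>a. indicator {k} a :: real)"
      by (intro integrable_measure_pmf_finite) (simp add: setU)
    show "(\<integral>a. indicator {k} a \<partial>measure_pmf U) = (if k < n then 1 / real n else 0)"
    proof -
      have "(\<integral>a. indicator {k} a \<partial>measure_pmf U) = pmf U k"
        by (subst Bochner_Integration.integral_indicator) (simp add: measure_pmf_single)
      thus ?thesis using n by (auto simp: U_def pmf_of_set lessThan_empty_iff)
    qed
  qed
  \<comment> \<open>Expanding in indicators of the two index values reduces the claim to
    independence of two coordinates, each pair of values having probability 1 / n^2.\<close>
  have ED: "(\<integral>I. D (I i) (I j) \<partial>M) = (\<Sum>k<n. \<Sum>l<n. D k l) / (real n)\<^sup>2" if ij: "i < n" "j < n" "i \<noteq> j" for i j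
  proof -
    have im: "integrable M (\<lambda>I. D k l * (indicator {k} (I i) * indicator {l} (I j)))" for k l
    proof (intro integrable_mult_right M.integrable_const_bound[of _ 1])
      have "(\<lambda>I. indicator {k} (I i) * indicator {l} (I j) :: real) \<in> borel_measurable (iid n (measure_pmf U))"
        by (intro borel_measurable_times measurable_compose[OF measurable_component_singleton]) (use ij in auto)
      thus "(\<lambda>I. indicator {k} (I i) * indicator {l} (I j) :: real) \<in> borel_measurable M" by (simp add: M_def)
    qed (auto simp: indicator_def)
    have "(\<integral>I. D (I i) (I j) \<partial>M) = (\<integral>I. (\<Sum>k<n. \<Sum>l<n. D k l * (indicator {k} (I i) * indicator {l} (I j))) \<partial>M)"
    proof (rule integral_cong_AE)
      show "AE I in M. D (I i) (I j) = (\<Sum>k<n. \<Sum>l<n. D k l * (indicator {k} (I i) * indicator {l} (I j)))"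
        using AEM
      proof eventually_elim
        case (elim I)
        have "(\<Sum>k<n. \<Sum>l<n. D k l * (indicator {k} (I i) * indicator {l} (I j))) =
            (\<Sum>k<n. \<Sum>l<n. if l = I j then if k = I i then D k l else 0 else 0)"
          by (intro sum.cong refl) (auto simp: indicator_def)
        thus ?case using elim ij by simp
      qed
      show "(\<lambda>I. \<Sum>k<n. \<Sum>l<n. D k l * (indicator {k} (I i) * indicator {l} (I j))) \<in> borel_measurable M"
        by (intro borel_measurable_sum borel_measurable_integrable im)
    qed (use Dm ij in auto)
    also have "\<dots> = (\<Sum>k<n. \<integral>I. (\<Sum>l<n. D k l * (indicator {k} (I i) * indicator {l} (I j))) \<partial>M)"
      by (intro Bochner_Integration.integral_sum Bochner_Integration.integrable_sum im)
    also have "\<dots> = (\<Sum>k<n. \<Sum>l<n. \<integral>I. D k l * (indicator {k} (I i) * indicator {l} (I j)) \<partial>M)"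
      by (intro sum.cong refl Bochner_Integration.integral_sum im)
    also have "\<dots> = (\<Sum>k<n. \<Sum>l<n. D k l / (real n)\<^sup>2)"
    proof (intro sum.cong refl)
      fix k l assume kl: "k \<in> {..<n}" "l \<in> {..<n}"
      have "(\<integral>I. D k l * (indicator {k} (I i) * indicator {l} (I j)) \<partial>M)
        = D k l * ((\<integral>a. indicator {k} a \<partial>measure_pmf U) * (\<integral>a. indicator {l} a \<partial>measure_pmf U))"
        unfolding M_def
        by (subst integral_mult_right_zero, subst PiM_integral_pair[OF measure_pmf.prob_space_axioms ij ind(1) ind(1)]) (rule refl)
      also have "\<dots> = D k l / (real n)\<^sup>2"
        using kl unfolding ind(2) by (simp add: power2_eq_square)
      finally show "(\<integral>I. D k l * (indicator {k} (I i) * indicator {l} (I j)) \<partial>M) = D k l / (real n)\<^sup>2" .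
    qed
    finally show ?thesis by (simp add: sum_divide_distrib)
  qed
  define c where "c = inverse (real (n choose 2))"
  have c: "c * real (n choose 2) = 1" using n by (simp add: c_def)
  have "(\<integral>I. graph_mean n \<phi> (compose {..<n} Y I) \<partial>M) - (\<integral>I. graph_mean n \<phi> (compose {..<n} X I) \<partial>M)
      = (\<integral>I. graph_mean n \<phi> (compose {..<n} Y I) - graph_mean n \<phi> (compose {..<n} X I) \<partial>M)"
    by (rule Bochner_Integration.integral_diff[OF gi gi, symmetric])
  also have "\<dots> \<le> (\<integral>I. c * (\<Sum>z\<in>edge_set n. D (I (fst z)) (I (snd z))) \<partial>M)"
  proof (rule integral_mono)
    show "integrable M (\<lambda>I. graph_mean n \<phi> (compose {..<n} Y I) - graph_mean n \<phi> (compose {..<n} X I))"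
      by (intro Bochner_Integration.integrable_diff gi)
    show "integrable M (\<lambda>I. c * (\<Sum>z\<in>edge_set n. D (I (fst z)) (I (snd z))))"
      by (intro integrable_mult_right Bochner_Integration.integrable_sum Di) (auto simp: edge_set_def)
    fix I
    have "(\<Sum>z\<in>edge_set n. \<bar>clip (inner (compose {..<n} Y I (fst z)) (compose {..<n} Y I (snd z)))
        - clip (inner (compose {..<n} X I (fst z)) (compose {..<n} X I (snd z)))\<bar>) = (\<Sum>z\<in>edge_set n. D (I (fst z)) (I (snd z)))"
      by (intro sum.cong refl) (auto simp: D_def compose_def edge_set_def)
    hence "\<bar>graph_mean n \<phi> (compose {..<n} Y I) - graph_mean n \<phi> (compose {..<n} X I)\<bar> \<le> c * (\<Sum>z\<in>edge_set n. D (I (fst z)) (I (snd z)))"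
      using graph_mean_lipschitz[OF lip, of "compose {..<n} Y I" "compose {..<n} X I"] unfolding c_def by (simp only:)
    thus "graph_mean n \<phi> (compose {..<n} Y I) - graph_mean n \<phi> (compose {..<n} X I) \<le> c * (\<Sum>z\<in>edge_set n. D (I (fst z)) (I (snd z)))"
      by linarith
  qed
  also have "\<dots> = c * (\<Sum>z\<in>edge_set n. \<integral>I. D (I (fst z)) (I (snd z)) \<partial>M)"
  proof -
    have "(\<integral>I. (\<Sum>z\<in>edge_set n. D (I (fst z)) (I (snd z))) \<partial>M) = (\<Sum>z\<in>edge_set n. \<integral>I. D (I (fst z)) (I (snd z)) \<partial>M)"
      by (intro Bochner_Integration.integral_sum Di) (auto simp: edge_set_def)
    thus ?thesis by simp
  qed
  also have "\<dots> = c * (\<Sum>z\<in>edge_set n. (\<Sum>k<n. \<Sum>l<n. D k l) / (real n)\<^sup>2)"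
    by (intro arg_cong[of _ _ "(*) c"] sum.cong refl ED) (auto simp: edge_set_def)
  also have "\<dots> = (c * real (n choose 2)) * ((\<Sum>k<n. \<Sum>l<n. D k l) / (real n)\<^sup>2)" by (simp add: card_edge_set)
  also have "\<dots> = (\<Sum>k<n. \<Sum>l<n. D k l) / (real n)\<^sup>2" by (simp add: c)
  finally show ?thesis unfolding pr D_def .
qed

lemma sum_abs_le_frobenius:
  fixes a :: "nat \<Rightarrow> nat \<Rightarrow> real"
  shows "(\<Sum>k<n. \<Sum>l<n. \<bar>a k l\<bar>) \<le> real n * sqrt (\<Sum>k<n. \<Sum>l<n. (a k l)\<^sup>2)"
proof -
  have "(\<Sum>z\<in>{..<n} \<times> {..<n}. 1 * \<bar>a (fst z) (snd z)\<bar>)\<^sup>2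
     \<le> (\<Sum>z\<in>{..<n} \<times> {..<n}. 1\<^sup>2) * (\<Sum>z\<in>{..<n} \<times> {..<n}. \<bar>a (fst z) (snd z)\<bar>\<^sup>2)"
    by (rule Cauchy_Schwarz_ineq_sum)
  hence "(\<Sum>k<n. \<Sum>l<n. \<bar>a k l\<bar>)\<^sup>2 \<le> (real n)\<^sup>2 * (\<Sum>k<n. \<Sum>l<n. (a k l)\<^sup>2)"
    by (simp add: sum.cartesian_product case_prod_beta power2_eq_square)
  hence "(\<Sum>k<n. \<Sum>l<n. \<bar>a k l\<bar>) \<le> sqrt ((real n)\<^sup>2 * (\<Sum>k<n. \<Sum>l<n. (a k l)\<^sup>2))" by (rule real_le_rsqrt)
  thus ?thesis by (simp add: real_sqrt_mult)
qed

section \<open>Laws of the random graphs\<close>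

lemma edge_pmf_kernel [measurable]:
  "(\<lambda>X :: nat \<Rightarrow> real ^ 'd::finite. measure_pmf (edge_pmf n X)) \<in> latent_space n \<rightarrow>\<^sub>M subprob_algebra (count_space UNIV)"
proof (rule measurable_subprob_algebra)
  show "subprob_space (measure_pmf (edge_pmf n X))" for X :: "nat \<Rightarrow> real ^ 'd"
    by (intro prob_space_imp_subprob_space measure_pmf.prob_space_axioms)
  show "sets (measure_pmf (edge_pmf n X)) = sets (count_space UNIV)" for X :: "nat \<Rightarrow> real ^ 'd" by simp
  fix S :: "(nat \<times> nat \<Rightarrow> bool) set"
  have "emeasure (measure_pmf (edge_pmf n X)) S = ennreal (\<Sum>e\<in>edge_configs n. pmf (edge_pmf n X) e * indicator S e)"
    for X :: "nat \<Rightarrow> real ^ 'd"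
  proof -
    have "measure_pmf.prob (edge_pmf n X) S = edge_mean n X (indicator S)" by simp
    thus ?thesis by (simp only: measure_pmf.emeasure_eq_measure edge_expectation_sum)
  qed
  moreover have "(\<lambda>X :: nat \<Rightarrow> real ^ 'd. ennreal (\<Sum>e\<in>edge_configs n. pmf (edge_pmf n X) e * indicator S e))
      \<in> borel_measurable (latent_space n)" by measurable
  ultimately show "(\<lambda>X :: nat \<Rightarrow> real ^ 'd. emeasure (measure_pmf (edge_pmf n X)) S) \<in> borel_measurable (latent_space n)"
    by simp
qed

lemma rdpg_kernel:
  fixes R :: "(real ^ 'd::finite) measure"
  assumes R: "sets R = sets borel"
  shows "(\<lambda>X. distr (measure_pmf (edge_pmf n X)) (graph_space n \<Otimes>\<^sub>M latent_space n) (\<lambda>e. (adj_of_edges n e, X)))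
     \<in> iid n R \<rightarrow>\<^sub>M subprob_algebra (graph_space n \<Otimes>\<^sub>M (latent_space n :: (nat \<Rightarrow> real ^ 'd) measure))"
proof -
  have s: "sets (iid n R) = sets (latent_space n)" using R by (intro sets_PiM_cong) auto
  have "(\<lambda>X. distr (measure_pmf (edge_pmf n X)) (graph_space n \<Otimes>\<^sub>M latent_space n) (\<lambda>e. (adj_of_edges n e, X)))
     \<in> latent_space n \<rightarrow>\<^sub>M subprob_algebra (graph_space n \<Otimes>\<^sub>M (latent_space n :: (nat \<Rightarrow> real ^ 'd) measure))"
  proof (rule measurable_distr2[OF _ edge_pmf_kernel])
    have "(\<lambda>z. adj_of_edges n (snd z)) \<in> (latent_space n :: (nat \<Rightarrow> real ^ 'd) measure) \<Otimes>\<^sub>M count_space UNIV \<rightarrow>\<^sub>M graph_space n"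
      by (rule measurable_compose[OF measurable_snd]) (simp add: adj_of_edges_in_adj_mats)
    hence "(\<lambda>z. (adj_of_edges n (snd z), fst z)) \<in> (latent_space n :: (nat \<Rightarrow> real ^ 'd) measure) \<Otimes>\<^sub>M count_space UNIV
        \<rightarrow>\<^sub>M graph_space n \<Otimes>\<^sub>M latent_space n"
      by (intro measurable_Pair measurable_fst)
    thus "(\<lambda>(X, e). (adj_of_edges n e, X)) \<in> (latent_space n :: (nat \<Rightarrow> real ^ 'd) measure) \<Otimes>\<^sub>M count_space UNIV
        \<rightarrow>\<^sub>M graph_space n \<Otimes>\<^sub>M latent_space n" by (simp add: split_beta')
  qed
  thus ?thesis using measurable_cong_sets[OF s refl] by blast
qed

lemma adj_pair_measurable:
  assumes "X \<in> space (latent_space n)"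
  shows "(\<lambda>e. (adj_of_edges n e, X)) \<in> measure_pmf q \<rightarrow>\<^sub>M graph_space n \<Otimes>\<^sub>M latent_space n"
  using assms by (intro measurable_Pair measurable_const) (auto simp: adj_of_edges_in_adj_mats)

context
  fixes R :: "(real ^ 'd::finite) measure" and n :: nat
  assumes R: "prob_space R" "sets R = sets borel"
begin

lemma space_PiM_latent: "space (iid n R) = space (latent_space n)"
  using sets_eq_imp_space_eq[OF R(2)] by (simp add: space_PiM)

lemma PiM_not_empty: "space (iid n R) \<noteq> {}"
  by (rule prob_space.not_empty[OF prob_space_PiM]) (rule R)

lemma sets_rdpg: "sets (rdpg R n) = sets (graph_space n \<Otimes>\<^sub>M latent_space n)"
  unfolding rdpg_def by (rule sets_bind[OF sets_kernel[OF rdpg_kernel[OF R(2)]] PiM_not_empty])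

lemma prob_space_rdpg: "prob_space (rdpg R n)"
  unfolding rdpg_def
proof (rule prob_space.prob_space_bind[OF prob_space_PiM _ rdpg_kernel[OF R(2)]])
  show "AE X in iid n R. prob_space (distr (measure_pmf (edge_pmf n X))
      (graph_space n \<Otimes>\<^sub>M latent_space n) (\<lambda>e. (adj_of_edges n e, X)))"
    by (intro AE_I2 prob_space.prob_space_distr measure_pmf.prob_space_axioms adj_pair_measurable)
       (simp add: space_PiM_latent)
qed (rule R)

lemma integral_rdpg:
  assumes h: "h \<in> borel_measurable (graph_space n \<Otimes>\<^sub>M latent_space n)" and B: "\<And>z. \<bar>h z\<bar> \<le> (B :: real)"
  shows "(\<integral>z. h z \<partial>rdpg R n) = (\<integral>X. edge_mean n X (\<lambda>e. h (adj_of_edges n e, X)) \<partial>iid n R)"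
proof -
  interpret P: prob_space "iid n R" by (intro prob_space_PiM R)
  let ?K = "\<lambda>X. distr (measure_pmf (edge_pmf n X)) (graph_space n \<Otimes>\<^sub>M latent_space n) (\<lambda>e. (adj_of_edges n e, X))"
  have K1: "AE X in iid n R. emeasure (?K X) (space (?K X)) \<le> ennreal 1"
    using subprob_space.emeasure_space_le_1[OF subprob_space_kernel[OF rdpg_kernel[OF R(2)]]] by (intro AE_I2) simp
  have "(\<integral>z. h z \<partial>rdpg R n) = (\<integral>X. \<integral>z. h z \<partial>?K X \<partial>iid n R)"
    unfolding rdpg_def
    by (rule integral_bind[OF h _ rdpg_kernel[OF R(2)] P.finite_measure_axioms K1]) (rule B)
  also have "\<dots> = (\<integral>X. edge_mean n X (\<lambda>e. h (adj_of_edges n e, X)) \<partial>iid n R)"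
    by (intro Bochner_Integration.integral_cong refl integral_distr adj_pair_measurable h) (simp add: space_PiM_latent)
  finally show ?thesis .
qed

lemma fst_rdpg_measurable: "fst \<in> rdpg R n \<rightarrow>\<^sub>M graph_space n"
  using measurable_fst measurable_cong_sets[OF sets_rdpg refl] by blast

lemma sets_rdpg_graph: "sets (rdpg_graph R n) = sets (graph_space n)"
  by (simp add: rdpg_graph_def)

lemma prob_space_rdpg_graph: "prob_space (rdpg_graph R n)"
  unfolding rdpg_graph_def by (intro prob_space.prob_space_distr prob_space_rdpg fst_rdpg_measurable)

lemma integral_fst_rdpg:
  "(\<integral>z. \<phi> (fst z) \<partial>rdpg R n) = (\<integral>X. graph_mean n \<phi> X \<partial>iid n R)"
proof -
  \<comment> \<open>Values of \<open>\<phi>\<close> at other matrices are arbitrary, while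
    integration over a bind asks for a global bound; extension by 0 supplies it without changing the
    integral.\<close>
  define \<phi>' where "\<phi>' = (\<lambda>A. if A \<in> adj_mats n then \<phi> A else 0)"
  have b: "\<bar>\<phi>' A\<bar> \<le> (\<Sum>A\<in>adj_mats n. \<bar>\<phi> A\<bar>)" for A
    using member_le_sum[of A "adj_mats n" "\<lambda>A. \<bar>\<phi> A\<bar>"] by (auto simp: \<phi>'_def intro: sum_nonneg)
  have "(\<integral>z. \<phi> (fst z) \<partial>rdpg R n) = (\<integral>z. \<phi>' (fst z) \<partial>rdpg R n)"
    using measurable_space[OF fst_rdpg_measurable] by (intro Bochner_Integration.integral_cong) (auto simp: \<phi>'_def)
  also have "\<dots> = (\<integral>X. edge_mean n X (\<lambda>e. \<phi>' (fst (adj_of_edges n e, X))) \<partial>iid n R)"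
    by (rule integral_rdpg[OF _ b]) (rule measurable_compose[OF measurable_fst], simp)
  also have "\<dots> = (\<integral>X. graph_mean n \<phi> X \<partial>iid n R)"
    by (simp add: \<phi>'_def adj_of_edges_in_adj_mats graph_mean_def)
  finally show ?thesis .
qed

lemma integral_rdpg_graph:
  "(\<integral>A. \<phi> A \<partial>rdpg_graph R n) = (\<integral>X. graph_mean n \<phi> X \<partial>iid n R)"
  unfolding rdpg_graph_def by (subst integral_distr[OF fst_rdpg_measurable]) (auto simp: integral_fst_rdpg)

end

lemma prob_space_empirical: "prob_space (empirical n Y)" and sets_empirical: "sets (empirical n Y) = sets borel"
  by (auto simp: empirical_def intro!: prob_space.prob_space_distr measure_pmf.prob_space_axioms)

text \<open>The resampling measure depends on A alone, and every function on the discrete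
  \<open>graph_space n\<close> is measurable, so any selection of embeddings yields a
  kernel.\<close>

lemma resampling_kernel:
  fixes F :: "(real ^ 'd::finite) measure"
  assumes F: "prob_space F" "sets F = sets borel"
  shows "(\<lambda>(A, X). distr (rdpg_graph (empirical n (ase A)) n)
                ((graph_space n \<Otimes>\<^sub>M latent_space n) \<Otimes>\<^sub>M graph_space n) (\<lambda>B. ((A, X), B)))
     \<in> rdpg F n \<rightarrow>\<^sub>M subprob_algebra ((graph_space n \<Otimes>\<^sub>M (latent_space n :: (nat \<Rightarrow> real ^ 'd) measure)) \<Otimes>\<^sub>M graph_space n)"
proof -
  note E = prob_space_empirical sets_empirical
  have "(\<lambda>A. rdpg_graph (empirical n (ase A)) n) \<in> graph_space n \<rightarrow>\<^sub>M subprob_algebra (graph_space n)"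
    by (auto simp: space_subprob_algebra sets_rdpg_graph[OF E]
        intro!: prob_space_imp_subprob_space prob_space_rdpg_graph E)
  hence g: "(\<lambda>z. rdpg_graph (empirical n (ase (fst z))) n) \<in> graph_space n \<Otimes>\<^sub>M (latent_space n :: (nat \<Rightarrow> real ^ 'd) measure)
      \<rightarrow>\<^sub>M subprob_algebra (graph_space n)"
    by (rule measurable_compose[OF measurable_fst])
  have "(\<lambda>z. distr (rdpg_graph (empirical n (ase (fst z))) n)
                ((graph_space n \<Otimes>\<^sub>M latent_space n) \<Otimes>\<^sub>M graph_space n) (\<lambda>B. (z, B)))
     \<in> graph_space n \<Otimes>\<^sub>M latent_space n \<rightarrow>\<^sub>M
       subprob_algebra ((graph_space n \<Otimes>\<^sub>M (latent_space n :: (nat \<Rightarrow> real ^ 'd) measure)) \<Otimes>\<^sub>M graph_space n)"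
    by (rule measurable_distr2[OF _ g]) simp
  thus ?thesis by (simp add: split_beta' measurable_cong_sets[OF sets_rdpg[OF F] refl])
qed

lemma sets_resampling_law:
  fixes F :: "(real ^ 'd::finite) measure"
  assumes F: "prob_space F" "sets F = sets borel"
  shows "sets (resampling_law ase F n) = sets ((graph_space n \<Otimes>\<^sub>M latent_space n) \<Otimes>\<^sub>M graph_space n)"
  unfolding resampling_law_def
  by (rule sets_bind[OF sets_kernel[OF resampling_kernel[OF F]] prob_space.not_empty[OF prob_space_rdpg[OF F]]])

lemma integral_snd_resampling_law:
  fixes F :: "(real ^ 'd::finite) measure"
  assumes F: "prob_space F" "sets F = sets borel"
  shows "(\<integral>z. \<phi> (snd z) \<partial>resampling_law ase F n) =
     (\<integral>X. edge_mean n X (\<lambda>e. \<integral>x. graph_mean n \<phi> x \<partial>iid n (empirical n (ase (adj_of_edges n e))))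
        \<partial>iid n F)"
proof -
  note E = prob_space_empirical sets_empirical
  define \<phi>' where "\<phi>' = (\<lambda>A. if A \<in> adj_mats n then \<phi> A else 0)"
  define b where "b = (\<Sum>A\<in>adj_mats n. \<bar>\<phi> A\<bar>)"
  have b: "\<bar>\<phi>' A\<bar> \<le> b" for A
    using member_le_sum[of A "adj_mats n" "\<lambda>A. \<bar>\<phi> A\<bar>"] by (auto simp: \<phi>'_def b_def intro: sum_nonneg)
  interpret R: prob_space "rdpg F n" by (rule prob_space_rdpg[OF F])
  let ?N = "(graph_space n \<Otimes>\<^sub>M (latent_space n :: (nat \<Rightarrow> real ^ 'd) measure)) \<Otimes>\<^sub>M graph_space n"
  let ?K = "\<lambda>(A, X). distr (rdpg_graph (empirical n (ase A)) n) ?N (\<lambda>B. ((A, X), B))"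
  let ?\<Psi> = "\<lambda>A. \<integral>x. graph_mean n \<phi> x \<partial>iid n (empirical n (ase A))"
  have sm: "snd \<in> resampling_law ase F n \<rightarrow>\<^sub>M graph_space n"
    using measurable_snd measurable_cong_sets[OF sets_resampling_law[OF F] refl] by blast
  have K1: "AE z in rdpg F n. emeasure (?K z) (space (?K z)) \<le> ennreal 1"
    using subprob_space.emeasure_space_le_1[OF subprob_space_kernel[OF resampling_kernel[OF F]]] by (intro AE_I2) simp
  have h: "(\<lambda>z. \<phi>' (snd z)) \<in> borel_measurable ?N" by (rule measurable_compose[OF measurable_snd]) simp
  have "(\<integral>z. \<phi> (snd z) \<partial>resampling_law ase F n) = (\<integral>z. \<phi>' (snd z) \<partial>resampling_law ase F n)"
    using measurable_space[OF sm] by (intro Bochner_Integration.integral_cong) (auto simp: \<phi>'_def)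
  also have "\<dots> = (\<integral>z. \<integral>w. \<phi>' (snd w) \<partial>?K z \<partial>rdpg F n)"
    unfolding resampling_law_def
    by (rule integral_bind[OF h _ resampling_kernel[OF F] R.finite_measure_axioms K1]) (rule b)
  also have "\<dots> = (\<integral>z. ?\<Psi> (fst z) \<partial>rdpg F n)"
  proof (rule Bochner_Integration.integral_cong[OF refl])
    fix z assume z: "z \<in> space (rdpg F n)"
    hence z': "z \<in> space (graph_space n \<Otimes>\<^sub>M (latent_space n :: (nat \<Rightarrow> real ^ 'd) measure))"
      using sets_eq_imp_space_eq[OF sets_rdpg[OF F]] by blast
    have m: "(\<lambda>B. (z, B)) \<in> rdpg_graph (empirical n (ase (fst z))) n \<rightarrow>\<^sub>M ?N"
      using measurable_Pair1'[OF z'] measurable_cong_sets[OF sets_rdpg_graph[OF E] refl] by blast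
    have "(\<integral>w. \<phi>' (snd w) \<partial>?K z) = (\<integral>B. \<phi>' (snd (z, B)) \<partial>rdpg_graph (empirical n (ase (fst z))) n)"
      using integral_distr[OF m h] by (simp add: split_beta')
    also have "\<dots> = (\<integral>B. \<phi> B \<partial>rdpg_graph (empirical n (ase (fst z))) n)"
      using sets_eq_imp_space_eq[OF sets_rdpg_graph[OF E]]
      by (intro Bochner_Integration.integral_cong refl) (auto simp: \<phi>'_def)
    also have "\<dots> = ?\<Psi> (fst z)" by (rule integral_rdpg_graph[OF E])
    finally show "(\<integral>w. \<phi>' (snd w) \<partial>?K z) = ?\<Psi> (fst z)" .
  qed
  \<comment> \<open>The inner expectation is again a function of the graph A only, so the formula
    for the first stage applies to it.\<close>
  also have "\<dots> = (\<integral>X. graph_mean n ?\<Psi> X \<partial>iid n F)" by (rule integral_fst_rdpg[OF F])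
  finally show ?thesis by (simp add: graph_mean_def)
qed

text \<open>Each point outside the support has a null neighbourhood, hence a null basic one, and the
  countably many null basic sets have null union.\<close>

lemma AE_msupp:
  fixes M :: "'a::second_countable_topology measure"
  assumes M: "sets M = sets borel"
  shows "AE x in M. x \<in> msupp M"
proof -
  obtain \<B> :: "'a set set" where \<B>: "countable \<B>" "topological_basis \<B>" using ex_countable_basis by blast
  define N where "N = \<Union>{U \<in> \<B>. emeasure M U = 0}"
  have "(\<Union>U\<in>{U \<in> \<B>. emeasure M U = 0}. U) \<in> null_sets M"
  proof (rule null_sets_UN')
    show "countable {U \<in> \<B>. emeasure M U = 0}" using \<B>(1) by simp
    show "U \<in> null_sets M" if "U \<in> {U \<in> \<B>. emeasure M U = 0}" for U
      using that topological_basis_open[OF \<B>(2)] M by auto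
  qed
  hence null: "N \<in> null_sets M" by (simp add: N_def)
  have "x \<in> N" if x: "x \<notin> msupp M" for x
  proof -
    obtain U where U: "open U" "x \<in> U" "emeasure M U = 0" using x by (auto simp: msupp_def)
    obtain V where V: "V \<in> \<B>" "x \<in> V" "V \<subseteq> U" using topological_basisE[OF \<B>(2) U(1,2)] by blast
    have "emeasure M V \<le> emeasure M U" using V U M by (intro emeasure_mono) auto
    thus ?thesis using V U by (auto simp: N_def)
  qed
  thus ?thesis by (intro AE_I'[OF null]) auto
qed

section \<open>From the dual bound to the Wasserstein distance\<close>

lemma integral_finite_count_space:
  fixes f :: "'a \<Rightarrow> real"
  assumes S: "finite S" and M: "finite_measure M" "sets M = sets (count_space S)"
  shows "(\<integral>x. f x \<partial>M) = (\<Sum>x\<in>S. f x * measure M {x})"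
proof -
  interpret finite_measure M by fact
  have sp: "space M = S" using sets_eq_imp_space_eq[OF M(2)] by simp
  have [measurable]: "{x} \<in> sets M" if "x \<in> S" for x using that M(2) by simp
  have "(\<integral>x. f x \<partial>M) = (\<integral>x. (\<Sum>y\<in>S. f y * indicator {y} x) \<partial>M)"
  proof (rule Bochner_Integration.integral_cong[OF refl])
    fix x assume "x \<in> space M"
    have "(\<Sum>y\<in>S. f y * indicator {y} x) = (\<Sum>y\<in>S. if y = x then f y else 0)"
      by (intro sum.cong refl) (auto simp: indicator_def)
    thus "f x = (\<Sum>y\<in>S. f y * indicator {y} x)" using S \<open>x \<in> space M\<close> sp by simp
  qed
  also have "\<dots> = (\<Sum>y\<in>S. \<integral>x. f y * indicator {y} x \<partial>M)"
    by (intro Bochner_Integration.integral_sum integrable_mult_right) (simp add: emeasure_eq_measure)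
  also have "\<dots> = (\<Sum>y\<in>S. f y * measure M {y})"
  proof (intro sum.cong refl)
    fix y assume y: "y \<in> S"
    have "(\<integral>x. indicator {y} x \<partial>M) = measure M {y}"
      using y sp by (subst Bochner_Integration.integral_indicator) (simp add: Int_absorb2)
    thus "(\<integral>x. f y * indicator {y} x \<partial>M) = f y * measure M {y}" by (simp only: integral_mult_right_zero)
  qed
  finally show ?thesis .
qed

text \<open>The coupling delivered by duality serves both claims: its cost is the upper bound, and
  its existence makes the infimum range over a nonempty set, without which the lower bound could not
  be read off.\<close>

lemma wasserstein_pow_nonneg_le:
  assumes p: "1 \<le> p"
    and M: "prob_space M" "sets M = sets (graph_space n)" and N: "prob_space N" "sets N = sets (graph_space n)"
    and dual: "\<And>\<phi>. hamming_lipschitz n \<phi> \<Longrightarrow> (\<integral>A. \<phi> A \<partial>M) - (\<integral>A. \<phi> A \<partial>N) \<le> \<epsilon>"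
  shows "0 \<le> wasserstein_pow p M N" and "wasserstein_pow p M N \<le> \<epsilon>"
proof -
  let ?S = "adj_mats n"
  interpret M: prob_space M by fact
  interpret N: prob_space N by fact
  have sp: "space M = ?S" "space N = ?S" using sets_eq_imp_space_eq[OF M(2)] sets_eq_imp_space_eq[OF N(2)] by simp_all
  note iM = integral_finite_count_space[OF finite_adj_mats M.finite_measure_axioms M(2)]
  note iN = integral_finite_count_space[OF finite_adj_mats N.finite_measure_axioms N(2)]
  have tot: "(\<Sum>x\<in>?S. measure M {x}) = 1" "(\<Sum>x\<in>?S. measure N {x}) = 1"
    using iM[of "\<lambda>_. 1"] iN[of "\<lambda>_. 1"] by (simp_all add: M.prob_space N.prob_space)
  obtain \<gamma> :: "real mat \<times> real mat \<Rightarrow> real" where g0: "\<And>z. z \<in> ?S \<times> ?S \<Longrightarrow> 0 \<le> \<gamma> z"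
    and g1: "\<And>x. x \<in> ?S \<Longrightarrow> (\<Sum>y\<in>?S. \<gamma> (x, y)) = measure M {x}"
    and g2: "\<And>y. y \<in> ?S \<Longrightarrow> (\<Sum>x\<in>?S. \<gamma> (x, y)) = measure N {y}"
    and gc: "(\<Sum>z\<in>?S \<times> ?S. \<gamma> z * hamming n (fst z) (snd z)) \<le> \<epsilon>"
  proof (rule finite_kantorovich_duality[of ?S "hamming n" "\<lambda>x. measure M {x}" "\<lambda>x. measure N {x}" \<epsilon>])
    fix \<phi> :: "real mat \<Rightarrow> real"
    assume "\<And>x y. x \<in> ?S \<Longrightarrow> y \<in> ?S \<Longrightarrow> \<phi> x - \<phi> y \<le> hamming n x y"
    hence "hamming_lipschitz n \<phi>" by (simp add: hamming_lipschitz_def)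
    from dual[OF this] show "(\<Sum>x\<in>?S. \<phi> x * measure M {x}) - (\<Sum>x\<in>?S. \<phi> x * measure N {x}) \<le> \<epsilon>"
      unfolding iM iN .
  qed (auto simp: hamming_self hamming_triangle tot)
  \<comment> \<open>On a finite discrete product all subsets are measurable, so the weights define a
    coupling with the required sigma-algebra and its marginals are checked on singletons.\<close>
  define C where "C = point_measure (?S \<times> ?S) (\<lambda>z. ennreal (\<gamma> z))"
  have setsC: "sets C = sets (M \<Otimes>\<^sub>M N)"
  proof -
    have "sets (M \<Otimes>\<^sub>M N) = sets (graph_space n \<Otimes>\<^sub>M graph_space n)" by (intro sets_pair_measure_cong M(2) N(2))
    also have "graph_space n \<Otimes>\<^sub>M graph_space n = count_space (?S \<times> ?S)"
      by (intro pair_measure_countable countable_finite finite_adj_mats)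
    finally show ?thesis by (simp add: C_def sets_point_measure)
  qed
  have spC: "space C = ?S \<times> ?S" by (simp add: C_def space_point_measure)
  have emC: "emeasure C X = ennreal (\<Sum>z\<in>X. \<gamma> z)" if "X \<subseteq> ?S \<times> ?S" for X
  proof -
    have "emeasure C X = (\<Sum>z\<in>X. ennreal (\<gamma> z))"
      unfolding C_def using that by (intro emeasure_point_measure_finite2) (auto intro: finite_subset)
    also have "\<dots> = ennreal (\<Sum>z\<in>X. \<gamma> z)" using that g0 by (intro sum_ennreal) auto
    finally show ?thesis .
  qed
  have mfst: "fst \<in> C \<rightarrow>\<^sub>M M" and msnd: "snd \<in> C \<rightarrow>\<^sub>M N"
    using measurable_fst measurable_snd measurable_cong_sets[OF setsC refl] by blast+
  have dfst: "distr C M fst = M"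
  proof (rule measure_eqI_finite)
    show "sets (distr C M fst) = Pow ?S" "sets M = Pow ?S" using M(2) by simp_all
    fix x assume x: "x \<in> ?S"
    have "emeasure (distr C M fst) {x} = emeasure C (fst -` {x} \<inter> space C)"
      using x M(2) by (intro emeasure_distr mfst) simp
    also have "fst -` {x} \<inter> space C = Pair x ` ?S" using x by (auto simp: spC)
    also have "emeasure C (Pair x ` ?S) = ennreal (\<Sum>y\<in>?S. \<gamma> (x, y))"
      using x by (subst emC) (auto simp: sum.reindex inj_on_def)
    finally show "emeasure (distr C M fst) {x} = emeasure M {x}"
      using g1[OF x] by (simp add: M.emeasure_eq_measure)
  qed simp
  have dsnd: "distr C N snd = N"
  proof (rule measure_eqI_finite)
    show "sets (distr C N snd) = Pow ?S" "sets N = Pow ?S" using N(2) by simp_all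
    fix y assume y: "y \<in> ?S"
    have "emeasure (distr C N snd) {y} = emeasure C (snd -` {y} \<inter> space C)"
      using y N(2) by (intro emeasure_distr msnd) simp
    also have "snd -` {y} \<inter> space C = (\<lambda>x. (x, y)) ` ?S" using y by (auto simp: spC)
    also have "emeasure C ((\<lambda>x. (x, y)) ` ?S) = ennreal (\<Sum>x\<in>?S. \<gamma> (x, y))"
      using y by (subst emC) (auto simp: sum.reindex inj_on_def)
    finally show "emeasure (distr C N snd) {y} = emeasure N {y}"
      using g2[OF y] by (simp add: N.emeasure_eq_measure)
  qed simp
  have CC: "C \<in> couplings M N" using setsC dfst dsnd by (simp add: couplings_def)
  have cost: "(\<integral>z. d_GM (fst z) (snd z) powr p \<partial>C) \<le> \<epsilon>"
  proof -
    have "(\<integral>z. d_GM (fst z) (snd z) powr p \<partial>C) = (\<Sum>z\<in>?S \<times> ?S. \<gamma> z * d_GM (fst z) (snd z) powr p)"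
      unfolding C_def using g0 by (subst lebesgue_integral_point_measure_finite) auto
    also have "\<dots> \<le> (\<Sum>z\<in>?S \<times> ?S. \<gamma> z * hamming n (fst z) (snd z))"
      using g0 p by (intro sum_mono mult_left_mono d_GM_powr_le_hamming) auto
    finally show ?thesis using gc by simp
  qed
  have nn: "0 \<le> (\<integral>z. d_GM (fst z) (snd z) powr p \<partial>C')" for C' :: "(real mat \<times> real mat) measure" by simp
  show "0 \<le> wasserstein_pow p M N"
    unfolding wasserstein_pow_def using CC nn by (intro cINF_greatest) auto
  have "wasserstein_pow p M N \<le> (\<integral>z. d_GM (fst z) (snd z) powr p \<partial>C)"
    unfolding wasserstein_pow_def using nn by (intro cINF_lower CC bdd_belowI2[of _ 0]) auto
  thus "wasserstein_pow p M N \<le> \<epsilon>" using cost by simp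
qed

section \<open>Assembly of the rate\<close>

lemma inner_product_distribution_unit_ball:
  fixes F :: "(real ^ 'd::finite) measure"
  assumes "inner_product_distribution F"
  shows "unit_ball_measure F"
proof -
  have F: "prob_space F" "sets F = sets borel" "\<And>x. x \<in> msupp F \<Longrightarrow> inner x x \<le> 1"
    using assms by (auto simp: inner_product_distribution_def)
  \<comment> \<open>The condition on the support, taken with both points equal, bounds the squared
    norm by 1.\<close>
  have "AE x in F. norm x \<le> 1"
    using AE_msupp[OF F(2)]
  proof eventually_elim
    case (elim x)
    thus ?case using F(3)[OF elim] by (simp add: norm_eq_sqrt_inner)
  qed
  thus ?thesis using F by (simp add: unit_ball_measure_def unit_ball_measure_axioms_def)
qed

text \<open>Off the bad event the discrepancy between the Gram matrices is n^(-2) * n * sqrt (14 d *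
  2050 n), and 14 * 2050 = 28700. On the bad event clipped probabilities differ by at most 1, so the
  loss is at most 1 and is weighted by exp (-n).\<close>

lemma conditional_resampling_bound:
  fixes F :: "(real ^ 'd::finite) measure" and X :: "nat \<Rightarrow> real ^ 'd" and ase :: "real mat \<Rightarrow> nat \<Rightarrow> real ^ 'd"
  assumes n: "2 \<le> n" and lip: "hamming_lipschitz n \<phi>" and F: "unit_ball_measure F"
    and X: "\<And>i j. i < n \<Longrightarrow> j < n \<Longrightarrow> 0 \<le> inner (X i) (X j) \<and> inner (X i) (X j) \<le> 1"
    and ase: "\<And>B. B \<in> adj_mats n \<Longrightarrow> is_ASE B (ase B)"
  shows "measure_pmf.expectation (edge_pmf n X)
           (\<lambda>e. \<integral>x. graph_mean n \<phi> x \<partial>iid n (empirical n (ase (adj_of_edges n e))))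
     \<le> (\<integral>x. graph_mean n \<phi> x \<partial>iid n F) + 2 * real CARD('d) * (cell_deviation K (empirical n X) F + 2 / 2 ^ K)
        + sqrt (28700 * real CARD('d)) / sqrt (real n) + exp (- real n)"
proof -
  let ?d = "real CARD('d)"
  let ?\<Psi> = "\<lambda>Y. \<integral>x. graph_mean n \<phi> x \<partial>iid n (empirical n Y)"
  define E where "E = (\<lambda>e i j. adj_of_edges n e $$ (i, j) - inner (X i) (X j))"
  define bad where "bad = {e. \<not> (\<forall>y. sqnorm n (mv n (E e) y) \<le> 2050 * real n * sqnorm n y)}"
  define s where "s = sqrt (28700 * ?d) / sqrt (real n)"
  define G where "G = ?\<Psi> X"
  have s0: "0 \<le> s" by (simp add: s_def)
  have n0: "0 < real n" using n by simp
  have pt: "?\<Psi> (ase (adj_of_edges n e)) \<le> G + s + indicator bad e" for e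
  proof -
    let ?Y = "ase (adj_of_edges n e)"
    let ?D = "\<Sum>k<n. \<Sum>l<n. \<bar>clip (inner (?Y k) (?Y l)) - clip (inner (X k) (X l))\<bar>"
    have 1: "?\<Psi> ?Y - G \<le> ?D / (real n)\<^sup>2" unfolding G_def by (rule resampled_graph_mean[OF n lip])
    show ?thesis
    proof (cases "e \<in> bad")
      case True
      have "?D \<le> (\<Sum>k<n. \<Sum>l<n. 1)"
      proof (intro sum_mono)
        fix k l show "\<bar>clip (inner (?Y k) (?Y l)) - clip (inner (X k) (X l))\<bar> \<le> 1"
          using clip_range[of "inner (?Y k) (?Y l)"] clip_range[of "inner (X k) (X l)"] by auto
      qed
      also have "\<dots> = (real n)\<^sup>2" by (simp add: power2_eq_square)
      finally have "?D / (real n)\<^sup>2 \<le> 1" using n0 by simp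
      thus ?thesis using 1 True s0 by simp
    next
      case False
      have "?D \<le> (\<Sum>k<n. \<Sum>l<n. \<bar>inner (?Y k) (?Y l) - inner (X k) (X l)\<bar>)"
        by (intro sum_mono clip_lipschitz)
      also have "\<dots> \<le> real n * sqrt (\<Sum>k<n. \<Sum>l<n. (inner (?Y k) (?Y l) - inner (X k) (X l))\<^sup>2)"
        by (rule sum_abs_le_frobenius)
      also have "\<dots> \<le> real n * sqrt (14 * ?d * (sqrt (2050 * real n))\<^sup>2)"
      proof (intro mult_left_mono real_sqrt_le_mono ase_frobenius ase adj_of_edges_in_adj_mats)
        fix y
        show "ip n (mv n (\<lambda>i j. adj_of_edges n e $$ (i, j) - inner (X i) (X j)) y)
               (mv n (\<lambda>i j. adj_of_edges n e $$ (i, j) - inner (X i) (X j)) y) \<le> (sqrt (2050 * real n))\<^sup>2 * sqnorm n y"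
          using False unfolding bad_def E_def by simp
      qed (auto simp: adj_of_edges_in_adj_mats intro: ase)
      also have "\<dots> = (real n)\<^sup>2 * s"
      proof -
        have "14 * ?d * (sqrt (2050 * real n))\<^sup>2 = (28700 * ?d) * real n" by simp
        hence "real n * sqrt (14 * ?d * (sqrt (2050 * real n))\<^sup>2) = real n * (sqrt (28700 * ?d) * sqrt (real n))"
          by (simp only: real_sqrt_mult)
        also have "\<dots> = (real n)\<^sup>2 * s"
          using n0 by (simp add: s_def field_simps power2_eq_square)
        finally show ?thesis .
      qed
      finally have "?D / (real n)\<^sup>2 \<le> s" using n0 by (simp add: divide_le_eq mult.commute)
      thus ?thesis using 1 False by simp
    qed
  qed
  have fin: "integrable (measure_pmf (edge_pmf n X)) f" for f :: "_ \<Rightarrow> real"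
    by (intro integrable_measure_pmf_finite finite_subset[OF set_edge_pmf]) simp
  have "edge_mean n X (\<lambda>e. ?\<Psi> (ase (adj_of_edges n e)))
      \<le> edge_mean n X (\<lambda>e. G + s + indicator bad e)"
    by (intro integral_mono fin pt)
  also have "\<dots> = G + s + measure_pmf.prob (edge_pmf n X) bad"
    by (subst Bochner_Integration.integral_add[OF fin fin]) simp
  also have "measure_pmf.prob (edge_pmf n X) bad \<le> exp (- real n)"
    unfolding bad_def E_def using n by (intro edge_noise_op_bound X) auto
  finally have 1: "edge_mean n X (\<lambda>e. ?\<Psi> (ase (adj_of_edges n e))) \<le> G + s + exp (- real n)"
    by simp
  have "norm (X i) \<le> 1" if "i < n" for i using X[OF that that] by (simp add: norm_eq_sqrt_inner)
  from empirical_graph_mean[where X = X and K = K, OF n lip F this]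
  show ?thesis using 1 unfolding G_def s_def by linarith
qed

lemma resampling_dual_bound:
  fixes F :: "(real ^ 'd::finite) measure" and ase :: "real mat \<Rightarrow> nat \<Rightarrow> real ^ 'd"
  assumes n: "2 \<le> n" and lip: "hamming_lipschitz n \<phi>" and F: "inner_product_distribution F"
    and ase: "\<And>B. B \<in> adj_mats n \<Longrightarrow> is_ASE B (ase B)"
  shows "(\<integral>z. \<phi> (snd z) \<partial>resampling_law ase F n) - (\<integral>z. \<phi> (fst z) \<partial>rdpg F n)
     \<le> 2 * real CARD('d) * ((\<Sum>k\<le>K. sqrt ((3 * 2 ^ k) ^ CARD('d) / real n) / 2 ^ k) + 2 / 2 ^ K)
        + sqrt (28700 * real CARD('d)) / sqrt (real n) + exp (- real n)"
proof -
  have Fb: "unit_ball_measure F" by (rule inner_product_distribution_unit_ball[OF F])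
  interpret F: unit_ball_measure F by fact
  note Fp = F.prob_space_axioms F.sets_eq
  let ?M = "iid n F"
  interpret M: prob_space ?M by (intro prob_space_PiM Fp)
  define \<Theta> where "\<Theta> = (\<lambda>X :: nat \<Rightarrow> real ^ 'd. measure_pmf.expectation (edge_pmf n X)
      (\<lambda>e. \<integral>x. graph_mean n \<phi> x \<partial>iid n (empirical n (ase (adj_of_edges n e)))))"
  define c where "c = (\<integral>x. graph_mean n \<phi> x \<partial>?M) + 2 * real CARD('d) * (2 / 2 ^ K)
      + sqrt (28700 * real CARD('d)) / sqrt (real n) + exp (- real n)"
  have s: "sets ?M = sets (latent_space n)" using F.sets_eq by (intro sets_PiM_cong) auto
  \<comment> \<open>Read as the graph mean of a functional of A, the conditional expectation
    inherits measurability and a bound, hence integrability.\<close>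
  have gm: "\<Theta> = graph_mean n (\<lambda>A. \<integral>x. graph_mean n \<phi> x \<partial>iid n (empirical n (ase A)))"
    by (simp add: \<Theta>_def graph_mean_def fun_eq_iff)
  have i\<Theta>: "integrable ?M \<Theta>" unfolding gm
  proof (rule M.integrable_const_bound)
    show "graph_mean n f \<in> borel_measurable ?M" for f
      using graph_mean_measurable[of n f] measurable_cong_sets[OF s refl] by blast
    show "AE X in ?M. norm (graph_mean n f X) \<le> (\<Sum>A\<in>adj_mats n. \<bar>f A\<bar>)" for f
      by (auto intro: graph_mean_bounded)
  qed
  note dev = expected_cell_deviation[OF Fp, of n K]
  have n': "0 < n" using n by simp
  \<comment> \<open>Almost surely all n positions lie in the support at once, which makes every
    pairwise inner product an admissible probability, diagonal pairs included.\<close>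
  have AEs: "AE X in ?M. \<forall>i\<in>{..<n}. X i \<in> msupp F"
    by (intro AE_finite_allI AE_PiM_component Fp AE_msupp) auto
  have AEb: "AE X in ?M. \<Theta> X \<le> c + 2 * real CARD('d) * cell_deviation K (empirical n X) F"
    using AEs
  proof eventually_elim
    case (elim X)
    have "0 \<le> inner (X i) (X j) \<and> inner (X i) (X j) \<le> 1" if "i < n" "j < n" for i j
      using F elim that by (auto simp: inner_product_distribution_def)
    from conditional_resampling_bound[where X = X and K = K, OF n lip Fb this ase]
    show ?case unfolding \<Theta>_def c_def by (simp add: algebra_simps)
  qed
  have "(\<integral>z. \<phi> (snd z) \<partial>resampling_law ase F n) = (\<integral>X. \<Theta> X \<partial>?M)"
    unfolding \<Theta>_def by (rule integral_snd_resampling_law[OF Fp])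
  also have "\<dots> \<le> (\<integral>X. c + 2 * real CARD('d) * cell_deviation K (empirical n X) F \<partial>?M)"
    by (intro integral_mono_AE i\<Theta> AEb Bochner_Integration.integrable_add integrable_mult_right dev(1) n') auto
  also have "\<dots> = c + 2 * real CARD('d) * (\<integral>X. cell_deviation K (empirical n X) F \<partial>?M)"
    using dev(1)[OF n'] by (simp add: M.prob_space)
  also have "\<dots> \<le> c + 2 * real CARD('d) * (\<Sum>k\<le>K. sqrt ((3 * 2 ^ k) ^ CARD('d) / real n) / 2 ^ k)"
    using dev(2)[OF n'] by (intro add_left_mono mult_left_mono) auto
  finally show ?thesis using integral_fst_rdpg[OF Fp, of n \<phi>] unfolding c_def by (simp add: algebra_simps)
qed

theorem theorem5:
  fixes p :: real
    and F :: "(real ^ 'd) measure"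
    and ase :: "real mat \<Rightarrow> nat \<Rightarrow> real ^ 'd"
    and M :: "nat \<Rightarrow> 'w measure"
    and A Astar H :: "nat \<Rightarrow> 'w \<Rightarrow> real mat"
    and X Z :: "nat \<Rightarrow> 'w \<Rightarrow> nat \<Rightarrow> real ^ 'd"
  assumes "1 \<le> p"
    and "inner_product_distribution F"
    and "rank (second_moment F) = CARD('d)"
    and "\<And>n B. CARD('d) \<le> n \<Longrightarrow> B \<in> adj_mats n \<Longrightarrow> is_ASE B (ase B)"
    and "\<And>n. prob_space (M n)"
    and "\<And>n. has_law (M n) (\<lambda>w. (A n w, X n w)) (rdpg F n)"
    and "\<And>n. has_law (M n) (\<lambda>w. ((A n w, X n w), Astar n w)) (resampling_law ase F n)"
    and "\<And>n. has_law (M n) (\<lambda>w. (H n w, Z n w)) (rdpg F n)"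
    and "\<And>n. prob_space.indep_var (M n)
           (rdpg F n) (\<lambda>w. (A n w, X n w)) (rdpg F n) (\<lambda>w. (H n w, Z n w))"
  shows "(\<lambda>n. wasserstein_pow p (distr (M n) (graph_space n) (Astar n))
                                (distr (M n) (graph_space n) (H n)))
         \<in> O(\<lambda>n. (real n powr (- 1 / 2) + real n powr (- 1 / real CARD('d))) * ln (real n))"
proof -
  let ?d = "CARD('d)"
  interpret F: unit_ball_measure F by (rule inner_product_distribution_unit_ball) fact
  note Fp = F.prob_space_axioms F.sets_eq
  define r where "r = (\<lambda>n. (real n powr (- 1 / 2) + real n powr (- 1 / real ?d)) * ln (real n))"
  \<comment> \<open>The summands belong to the dyadic bound, the edge noise and the bad event. In
    the last two the factor 2 converts n^(-1/2) into r n, as ln n \<ge> 1/2.\<close>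
  define C where "C = 2 * real ?d * (8 * sqrt (3 ^ ?d) + 8) + 2 * sqrt (28700 * real ?d) + 2"
  have bound: "norm (wasserstein_pow p (distr (M n) (graph_space n) (Astar n)) (distr (M n) (graph_space n) (H n)))
      \<le> C * norm (r n)" if n: "2 \<le> n" "?d \<le> n" for n
  proof -
    interpret M: prob_space "M n" by fact
    have mAstar: "(\<lambda>w. ((A n w, X n w), Astar n w)) \<in> M n \<rightarrow>\<^sub>M resampling_law ase F n"
      and lAstar: "distr (M n) (resampling_law ase F n) (\<lambda>w. ((A n w, X n w), Astar n w)) = resampling_law ase F n"
      using assms(7)[of n] by (auto simp: has_law_def)
    have mH: "(\<lambda>w. (H n w, Z n w)) \<in> M n \<rightarrow>\<^sub>M rdpg F n"
      and lH: "distr (M n) (rdpg F n) (\<lambda>w. (H n w, Z n w)) = rdpg F n"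
      using assms(8)[of n] by (auto simp: has_law_def)
    have msnd: "snd \<in> resampling_law ase F n \<rightarrow>\<^sub>M graph_space n"
      using measurable_snd measurable_cong_sets[OF sets_resampling_law[OF Fp] refl] by blast
    note mfst = fst_rdpg_measurable[OF Fp]
    have mA: "Astar n \<in> M n \<rightarrow>\<^sub>M graph_space n" using measurable_compose[OF mAstar msnd] by simp
    have mH': "H n \<in> M n \<rightarrow>\<^sub>M graph_space n" using measurable_compose[OF mH mfst] by simp
    have eA: "distr (M n) (graph_space n) (Astar n) = distr (resampling_law ase F n) (graph_space n) snd"
      by (subst lAstar[symmetric], subst distr_distr[OF msnd mAstar]) (simp add: comp_def)
    have eH: "distr (M n) (graph_space n) (H n) = distr (rdpg F n) (graph_space n) fst"
      by (subst lH[symmetric], subst distr_distr[OF mfst mH]) (simp add: comp_def)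
    have "1 \<le> ?d" by simp
    then obtain K where K: "(\<Sum>k\<le>K. sqrt ((3 * 2 ^ k) ^ ?d / real n) / 2 ^ k) + 2 / 2 ^ K
       \<le> (8 * sqrt (3 ^ ?d) + 8) * r n"
      unfolding r_def using dyadic_rate[OF _ n(1)] by blast
    let ?W = "wasserstein_pow p (distr (M n) (graph_space n) (Astar n)) (distr (M n) (graph_space n) (H n))"
    let ?\<epsilon> = "2 * real ?d * ((\<Sum>k\<le>K. sqrt ((3 * 2 ^ k) ^ ?d / real n) / 2 ^ k) + 2 / 2 ^ K)
        + sqrt (28700 * real ?d) / sqrt (real n) + exp (- real n)"
    have dual: "(\<integral>B. \<phi> B \<partial>distr (M n) (graph_space n) (Astar n)) - (\<integral>B. \<phi> B \<partial>distr (M n) (graph_space n) (H n)) \<le> ?\<epsilon>"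
      if "hamming_lipschitz n \<phi>" for \<phi>
    proof -
      have "(\<integral>B. \<phi> B \<partial>distr (M n) (graph_space n) (Astar n)) = (\<integral>z. \<phi> (snd z) \<partial>resampling_law ase F n)"
        unfolding eA by (rule integral_distr[OF msnd]) simp
      moreover have "(\<integral>B. \<phi> B \<partial>distr (M n) (graph_space n) (H n)) = (\<integral>z. \<phi> (fst z) \<partial>rdpg F n)"
        unfolding eH by (rule integral_distr[OF mfst]) simp
      ultimately show ?thesis
        using resampling_dual_bound[OF n(1) that assms(2) assms(4)[OF n(2)], of K] by simp
    qed
    note W = wasserstein_pow_nonneg_le[OF assms(1) M.prob_space_distr[OF mA] sets_distr M.prob_space_distr[OF mH'] sets_distr dual]
    have lnn: "1 / 2 \<le> ln (real n)"
    proof -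
      have "ln 2 \<le> ln (real n)" using n by (subst ln_le_cancel_iff) auto
      thus ?thesis using ln2_ge_two_thirds by simp
    qed
    have sq: "1 / sqrt (real n) = real n powr (- 1 / 2)"
      using powr_minus_divide[of "real n" "1 / 2"] powr_half_sqrt[of "real n"] n by simp
    have "1 / sqrt (real n) * (1 / 2) \<le> r n"
      unfolding sq r_def using lnn by (intro mult_mono) auto
    hence q: "1 / sqrt (real n) \<le> 2 * r n" by simp
    have "sqrt (real n) \<le> exp (real n)"
    proof -
      have "sqrt (real n) \<le> real n" using n by (intro real_le_lsqrt) (auto simp: power2_eq_square)
      also have "\<dots> \<le> exp (real n)" using exp_ge_add_one_self[of "real n"] by linarith
      finally show ?thesis .
    qed
    hence "exp (- real n) \<le> 1 / sqrt (real n)"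
      using n by (simp add: exp_minus field_simps)
    hence e: "exp (- real n) \<le> 2 * r n" using q by linarith
    have "0 \<le> 1 / sqrt (real n)" by simp
    hence r0: "0 \<le> r n" using q by linarith
    have "sqrt (28700 * real ?d) / sqrt (real n) \<le> sqrt (28700 * real ?d) * (2 * r n)"
      using mult_left_mono[OF q, of "sqrt (28700 * real ?d)"] by simp
    moreover have "2 * real ?d * ((\<Sum>k\<le>K. sqrt ((3 * 2 ^ k) ^ ?d / real n) / 2 ^ k) + 2 / 2 ^ K)
        \<le> 2 * real ?d * ((8 * sqrt (3 ^ ?d) + 8) * r n)" by (intro mult_left_mono K) auto
    ultimately have "?\<epsilon> \<le> C * r n" using e unfolding C_def by (simp add: algebra_simps)
    thus ?thesis using W r0 by simp
  qed
  show ?thesis unfolding r_def[symmetric]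
  proof (rule bigoI[of _ C])
    show "eventually (\<lambda>n. norm (wasserstein_pow p (distr (M n) (graph_space n) (Astar n)) (distr (M n) (graph_space n) (H n)))
      \<le> C * norm (r n)) at_top"
      \<comment> \<open>n \<ge> 2 keeps ln n and the number of pairs away from 0, and n \<ge> d is
        the range in which embeddings are provided.\<close>
      using eventually_ge_at_top[of 2] eventually_ge_at_top[of ?d]
      by eventually_elim (rule bound)
  qed
qed

end
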